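(* Let $\mathcal{P}$ be a finite translation surface and let $\alpha$ be a real number which is not the slope of any saddle connection of $\mathcal{P}$. Then every non-empty open set $G\subset\mathcal{P}$ has positive visiting frequency relative to geodesic segments of slope $\alpha$; that is, there exist constants $\mathfrak{F}=\mathfrak{F}(G;\mathcal{P};\alpha)>0$ and $c_5=c_5(G;\mathcal{P};\alpha)>0$ such that every geodesic segment $L$ on $\mathcal{P}$ with slope $\alpha$ and length $|L|\ge c_5$ satisfies $\lambda_1(G\cap L)\ge\mathfrak{F}|L|$, where $\lambda_1$ denotes $1$-dimensional Lebesgue measure.
   Context: A finite translation surface $\mathcal{P}$ is a flat surface made of finitely many polygonal faces in the plane, where parallel edges of the same length are identified in pairs by translation, and identified edges from the same face have opposite orientation. Its vertices (points arising from polygon vertices) may be singular. Geodesics are straight lines of a fixed slope, continued across identified edges; a geodesic segment is a finite piece of such a line on $\mathcal{P}$. A saddle connection is a finite geodesic segment on $\mathcal{P}$ whose two endpoints are vertices of $\mathcal{P}$ and which contains no vertex of $\mathcal{P}$ in its interior.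
   Formalization: The finite translation surface is assumed connected (for two disjoint tori the claim fails: G in one, L in the other), and all identified edges, not only those from the same face, have opposite boundary orientation, as needed for geodesics to continue straight across them. *)

theory Defs
  imports "HOL-Complex_Analysis.Complex_Analysis"
begin

text \<open>The plane is modelled by the complex numbers. A finite translation surface is given
by n faces; face i (i < n) is the closed polygon whose vertex list is V i (in
counterclockwise order); edge j of face i runs from vertex j to vertex j+1 (cyclically).
The map sig pairs edges; paired edges are glued by translation.\<close>

fun polyline :: "complex list \<Rightarrow> real \<Rightarrow> complex" where
  "polyline [] = linepath 0 0"
| "polyline [a] = linepath a a"
| "polyline [a, b] = linepath a b"
| "polyline (a # b # c # xs) = linepath a b +++ polyline (b # c # xs)"

definition boundary_path :: "complex list \<Rightarrow> real \<Rightarrow> complex" where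
  "boundary_path vs = polyline (vs @ [hd vs])"

definition face_region :: "complex list \<Rightarrow> complex set" where
  "face_region vs = path_image (boundary_path vs) \<union> inside (path_image (boundary_path vs))"

definition edge_start :: "(nat \<Rightarrow> complex list) \<Rightarrow> nat \<times> nat \<Rightarrow> complex" where
  "edge_start V e = V (fst e) ! snd e"

definition edge_end :: "(nat \<Rightarrow> complex list) \<Rightarrow> nat \<times> nat \<Rightarrow> complex" where
  "edge_end V e = V (fst e) ! ((snd e + 1) mod length (V (fst e)))"

definition edges :: "nat \<Rightarrow> (nat \<Rightarrow> complex list) \<Rightarrow> (nat \<times> nat) set" where
  "edges n V = {(i, j). i < n \<and> j < length (V i)}"

definition translation_surface ::
  "nat \<Rightarrow> (nat \<Rightarrow> complex list) \<Rightarrow> (nat \<times> nat \<Rightarrow> nat \<times> nat) \<Rightarrow> bool" where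
  "translation_surface n V sig \<longleftrightarrow>
     (\<forall>i<n. length (V i) \<ge> 3
        \<and> simple_path (boundary_path (V i))
        \<and> (\<forall>z \<in> inside (path_image (boundary_path (V i))).
               winding_number (boundary_path (V i)) z = 1))
   \<and> (\<forall>e \<in> edges n V. sig e \<in> edges n V \<and> sig e \<noteq> e \<and> sig (sig e) = e
        \<and> edge_end V (sig e) - edge_start V (sig e) = - (edge_end V e - edge_start V e))
   \<and> (\<forall>i<n. \<forall>i'<n. (\<lambda>a b. a < n \<and> (\<exists>j<length (V a). fst (sig (a, j)) = b))\<^sup>*\<^sup>* i i')"

definition surf_points :: "nat \<Rightarrow> (nat \<Rightarrow> complex list) \<Rightarrow> (nat \<times> complex) set" where
  "surf_points n V = {(i, p). i < n \<and> p \<in> face_region (V i)}"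

definition glue ::
  "nat \<Rightarrow> (nat \<Rightarrow> complex list) \<Rightarrow> (nat \<times> nat \<Rightarrow> nat \<times> nat) \<Rightarrow> nat \<times> complex \<Rightarrow> nat \<times> complex \<Rightarrow> bool" where
  "glue n V sig x y \<longleftrightarrow> (\<exists>e \<in> edges n V. fst e = fst x
      \<and> snd x \<in> closed_segment (edge_start V e) (edge_end V e)
      \<and> fst y = fst (sig e)
      \<and> snd y = snd x + (edge_end V (sig e) - edge_start V e))"

definition same_point ::
  "nat \<Rightarrow> (nat \<Rightarrow> complex list) \<Rightarrow> (nat \<times> nat \<Rightarrow> nat \<times> nat) \<Rightarrow> nat \<times> complex \<Rightarrow> nat \<times> complex \<Rightarrow> bool" where
  "same_point n V sig = (symclp (glue n V sig))\<^sup>*\<^sup>*"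

definition is_vertex :: "nat \<Rightarrow> (nat \<Rightarrow> complex list) \<Rightarrow> nat \<times> complex \<Rightarrow> bool" where
  "is_vertex n V x \<longleftrightarrow> fst x < n \<and> snd x \<in> set (V (fst x))"

text \<open>Open sets of the surface (quotient topology), given by their sets of representatives.\<close>

definition surf_open ::
  "nat \<Rightarrow> (nat \<Rightarrow> complex list) \<Rightarrow> (nat \<times> nat \<Rightarrow> nat \<times> nat) \<Rightarrow> (nat \<times> complex) set \<Rightarrow> bool" where
  "surf_open n V sig G \<longleftrightarrow> G \<subseteq> surf_points n V
     \<and> (\<forall>x\<in>G. \<forall>y\<in>surf_points n V. same_point n V sig x y \<longrightarrow> y \<in> G)
     \<and> (\<forall>i<n. openin (top_of_set (face_region (V i))) {p. (i, p) \<in> G})"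

definition slope_dir :: "real \<Rightarrow> complex \<Rightarrow> bool" where
  "slope_dir \<alpha> d \<longleftrightarrow> d = Complex 1 \<alpha> / complex_of_real (cmod (Complex 1 \<alpha>))
                    \<or> d = - (Complex 1 \<alpha> / complex_of_real (cmod (Complex 1 \<alpha>)))"

text \<open>A geodesic segment is a nonempty list of straight pieces (face i, start point z,
length l) in unit direction d; each piece lies in its closed face, and the end of each
piece is the same surface point as the start of the next one.\<close>

definition piece_end :: "complex \<Rightarrow> nat \<times> complex \<times> real \<Rightarrow> nat \<times> complex" where
  "piece_end d pc = (case pc of (i, z, l) \<Rightarrow> (i, z + complex_of_real l * d))"

definition geodesic_segment ::
  "nat \<Rightarrow> (nat \<Rightarrow> complex list) \<Rightarrow> (nat \<times> nat \<Rightarrow> nat \<times> nat) \<Rightarrow> complex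
    \<Rightarrow> (nat \<times> complex \<times> real) list \<Rightarrow> bool" where
  "geodesic_segment n V sig d L \<longleftrightarrow> L \<noteq> []
     \<and> (\<forall>(i, z, l) \<in> set L. i < n \<and> l \<ge> 0
          \<and> closed_segment z (z + complex_of_real l * d) \<subseteq> face_region (V i))
     \<and> (\<forall>k. Suc k < length L \<longrightarrow>
          same_point n V sig (piece_end d (L ! k)) (fst (L ! Suc k), fst (snd (L ! Suc k))))"

definition seg_length :: "(nat \<times> complex \<times> real) list \<Rightarrow> real" where
  "seg_length L = sum_list (map (\<lambda>(i, z, l). l) L)"

definition piece_offset :: "(nat \<times> complex \<times> real) list \<Rightarrow> nat \<Rightarrow> real" where
  "piece_offset L k = seg_length (take k L)"

definition saddle_connection ::
  "nat \<Rightarrow> (nat \<Rightarrow> complex list) \<Rightarrow> (nat \<times> nat \<Rightarrow> nat \<times> nat) \<Rightarrow> complex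
    \<Rightarrow> (nat \<times> complex \<times> real) list \<Rightarrow> bool" where
  "saddle_connection n V sig d L \<longleftrightarrow> geodesic_segment n V sig d L
     \<and> seg_length L > 0
     \<and> is_vertex n V (fst (hd L), fst (snd (hd L)))
     \<and> is_vertex n V (piece_end d (last L))
     \<and> (\<forall>k < length L. \<forall>s. 0 \<le> s \<and> s \<le> snd (snd (L ! k))
          \<and> 0 < piece_offset L k + s \<and> piece_offset L k + s < seg_length L
          \<longrightarrow> \<not> is_vertex n V (fst (L ! k), fst (snd (L ! k)) + complex_of_real s * d))"

definition saddle_slope ::
  "nat \<Rightarrow> (nat \<Rightarrow> complex list) \<Rightarrow> (nat \<times> nat \<Rightarrow> nat \<times> nat) \<Rightarrow> real \<Rightarrow> bool" where
  "saddle_slope n V sig \<alpha> \<longleftrightarrow> (\<exists>d L. slope_dir \<alpha> d \<and> saddle_connection n V sig d L)"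

definition visit_measure ::
  "complex \<Rightarrow> (nat \<times> complex) set \<Rightarrow> (nat \<times> complex \<times> real) list \<Rightarrow> real" where
  "visit_measure d G L = sum_list (map (\<lambda>(i, z, l).
      measure lborel {s::real. 0 \<le> s \<and> s \<le> l \<and> (i, z + complex_of_real s * d) \<in> G}) L)"

end

theory Submission imports Defs begin

text \<open>Fix a unit vector \<open>d\<close> of slope \<open>\<alpha>\<close>. No edge is parallel to \<open>d\<close>, since such an edge would be a
  saddle connection, so the edges through which the flow in direction \<open>d\<close> enters a face form a
  cross-section, and the first return to it is a piecewise translation \<open>T\<close> of finitely many
  intervals. A vertex-free geodesic just follows an orbit of \<open>T\<close>, and a geodesic through a vertex
  has a vertex-free part of proportional length. It therefore suffices that all orbits
  of \<open>T\<close> hit a given subinterval \<open>I\<close> within a bounded number of steps.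

  If this fails, compactness yields a two-sided orbit avoiding \<open>I\<close>; let \<open>K\<close> be the closed invariant set of
  all of them. Suppose that \<open>K\<close> meets the interior of some edge without being dense in it, and let \<open>q\<close> be
  an end of a gap of \<open>K\<close>. As there is no saddle connection, the forward or the backward orbit of
  \<open>q\<close> meets no vertex. It carries the gap along, eventually without cutting it; the images
  are disjoint and of equal length unless \<open>q\<close> is periodic. But a periodic orbit lies in
  a cylinder, whose boundary contains a saddle connection. So \<open>K\<close> is dense in an edge or misses its
  interior; by connectedness the same alternative holds for all edges, and the edge containing \<open>I\<close> is of
  the second kind. Hence \<open>K\<close> is finite and consists of periodic points, which is again impossible.\<close>

section \<open>Simple polygons\<close>

text \<open>The obstacle is that the first return map is undefined on orbits that run into a vertex,
  while a uniform bound on hitting times calls for compactness and a map that is defined everywhere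
  and invertible. Both are restored by splitting each height into two one-sided germs: a germ
  follows the orbits just beside it and so passes a vertex on a definite side. The price is that the
  two germs of a height may separate; without saddle connections this happens in at most one time
  direction for a point inside an edge. The dichotomy for \<open>K\<close> is the argument by which
  Keane's condition implies minimality of an interval exchange map. Faces are arbitrary simple
  polygons, hence their chords have to be derived from the Jordan curve theorem and winding numbers.
  A geodesic in the sense of \<open>geodesic_segment\<close> may leave a vertex in any face that has
  a copy of it, so it need not follow a germ there. This is why geodesics are cut before they are
  compared with orbits.\<close>

lemma polyline_props:
  "xs \<noteq> [] \<Longrightarrow> path (polyline xs) \<and> pathstart (polyline xs) = hd xs \<and> pathfinish (polyline xs) = last xs"
  by (induction xs rule: polyline.induct) (auto)

lemma path_image_polyline:
  "2 \<le> length xs \<Longrightarrow> path_image (polyline xs) = (\<Union>k<length xs - 1. closed_segment (xs ! k) (xs ! Suc k))"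
proof (induction xs rule: polyline.induct)
  case (4 a b c xs)
  have *: "{..<length (a#b#c#xs) - 1} = insert 0 (Suc ` {..<length (b#c#xs) - 1})"
    by (auto simp: lessThan_Suc_eq_insert_0)
  have "path_image (polyline (a#b#c#xs)) = closed_segment a b \<union> path_image (polyline (b#c#xs))"
    using polyline_props[of "b#c#xs"] by (simp add: path_image_join)
  then show ?case unfolding * using 4 by simp
qed auto

lemma arc_polyline_distinct:
  "arc (polyline xs) \<Longrightarrow> Suc k < length xs \<Longrightarrow> xs ! k \<noteq> xs ! Suc k"
proof (induction xs arbitrary: k rule: polyline.induct)
  case (3 a b)
  then show ?case using arc_distinct_ends[of "linepath a b"] by auto
next
  case (4 a b c xs)
  have "arc (linepath a b)" "arc (polyline (b#c#xs))"
    using 4(2) polyline_props[of "b#c#xs"] by (auto simp: arc_join_eq)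
  then show ?case using 4 arc_distinct_ends[of "linepath a b"] by (cases k) auto
qed auto

lemma arc_polyline_segments:
  "arc (polyline xs) \<Longrightarrow> j < k \<Longrightarrow> Suc k < length xs \<Longrightarrow>
   z \<in> closed_segment (xs ! j) (xs ! Suc j) \<Longrightarrow> z \<in> closed_segment (xs ! k) (xs ! Suc k) \<Longrightarrow>
   k = Suc j \<and> z = xs ! k"
proof (induction xs arbitrary: j k rule: polyline.induct)
  case (4 a b c xs)
  let ?p = "polyline (b#c#xs)"
  have arc: "arc ?p" "path_image (linepath a b) \<inter> path_image ?p \<subseteq> {b}"
    using 4(2) polyline_props[of "b#c#xs"] by (auto simp: arc_join_eq)
  obtain k' where k': "k = Suc k'" using 4(3) by (cases k) auto
  have zk: "z \<in> closed_segment ((b#c#xs) ! k') ((b#c#xs) ! Suc k')" "Suc k' < length (b#c#xs)"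
    using 4 k' by auto
  show ?case
  proof (cases j)
    case 0
    have "z \<in> path_image ?p"
      unfolding path_image_polyline[of "b#c#xs", simplified] using zk by (auto simp del: nth_Cons_Suc)
    then have zb: "z = b" using arc(2) 0 4 by auto
    \<comment> \<open>Otherwise the induction hypothesis for the first segment of the tail, which
      starts at \<open>b\<close>, puts \<open>z\<close> at the start of the second one. Then
      \<open>b\<close> is also the end of that first segment, which
      \<open>arc_polyline_distinct\<close> forbids.\<close>
    have "k' = 0"
    proof (rule ccontr)
      assume "k' \<noteq> 0"
      then have "k' = Suc 0 \<and> z = (b#c#xs) ! k'"
        using 4(1)[OF arc(1), of 0 k'] zk zb by auto
      then show False using arc_polyline_distinct[OF arc(1), of 0] zb by auto
    qed
    then show ?thesis using 0 zb k' by auto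
  next
    case (Suc j')
    then show ?thesis using 4(1)[OF arc(1), of j' k'] zk k' 4(3-) by auto
  qed
qed auto

lemma winding_number_polyline:
  "2 \<le> length xs \<Longrightarrow> z \<notin> path_image (polyline xs) \<Longrightarrow>
   winding_number (polyline xs) z = (\<Sum>k<length xs - 1. winding_number (linepath (xs ! k) (xs ! Suc k)) z)"
proof (induction xs rule: polyline.induct)
  case (4 a b c xs)
  have z: "z \<notin> closed_segment a b" "z \<notin> path_image (polyline (b#c#xs))"
    using 4(3) polyline_props[of "b#c#xs"] by (auto simp: path_image_join)
  have "winding_number (polyline (a#b#c#xs)) z = winding_number (linepath a b) z + winding_number (polyline (b#c#xs)) z"
    using z polyline_props[of "b#c#xs"] by (simp add: winding_number_join)
  also have "winding_number (polyline (b#c#xs)) z = (\<Sum>k<Suc (length xs). winding_number (linepath ((b#c#xs) ! k) ((b#c#xs) ! Suc k)) z)"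
    using 4(1) z by simp
  also have "winding_number (linepath a b) z + \<dots> =
      (\<Sum>k<Suc (Suc (length xs)). winding_number (linepath ((a#b#c#xs) ! k) ((a#b#c#xs) ! Suc k)) z)"
    unfolding sum.lessThan_Suc_shift[of _ "Suc (length xs)"] by simp
  finally show ?case by simp
qed auto

definition vert_a :: "complex list \<Rightarrow> nat \<Rightarrow> complex" where "vert_a vs k = vs ! k"
definition vert_b :: "complex list \<Rightarrow> nat \<Rightarrow> complex" where "vert_b vs k = vs ! ((k + 1) mod length vs)"

text \<open>These are the conditions that \<open>translation_surface\<close> imposes on one face.
  The winding number in \<open>wn1\<close> fixes the counterclockwise orientation, which later
  decides which side of an edge is inside.\<close>

locale jordan_polygon =
  fixes vs :: "complex list"
  assumes len3: "3 \<le> length vs"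
    and simple: "simple_path (boundary_path vs)"
    and wn1: "\<And>z. z \<in> inside (path_image (boundary_path vs)) \<Longrightarrow> winding_number (boundary_path vs) z = 1"
begin

abbreviation "N \<equiv> length vs"
abbreviation "A \<equiv> vert_a vs"
abbreviation "B \<equiv> vert_b vs"
abbreviation "seg k \<equiv> closed_segment (A k) (B k)"
abbreviation "bdry \<equiv> path_image (boundary_path vs)"
abbreviation "R \<equiv> inside bdry"
abbreviation "F \<equiv> face_region vs"

lemma xs_nth: "k < N \<Longrightarrow> (vs @ [hd vs]) ! k = A k" "k < N \<Longrightarrow> (vs @ [hd vs]) ! Suc k = B k"
proof -
  assume k: "k < N"
  then show "(vs @ [hd vs]) ! k = A k" by (simp add: vert_a_def nth_append)
  show "(vs @ [hd vs]) ! Suc k = B k"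
  proof (cases "Suc k < N")
    case False
    then have "Suc k = N" using k by simp
    then show ?thesis using len3 by (cases vs) (auto simp: vert_b_def nth_append)
  qed (auto simp: vert_b_def nth_append)
qed

lemma bdry_eq: "bdry = (\<Union>k<N. seg k)"
  using path_image_polyline[of "vs @ [hd vs]"] len3 by (simp add: boundary_path_def xs_nth)

lemma loop: "pathfinish (boundary_path vs) = pathstart (boundary_path vs)" "path (boundary_path vs)"
  using polyline_props[of "vs @ [hd vs]"] len3 unfolding boundary_path_def by (cases vs; force)+

lemmas jordan = Jordan_inside_outside[OF simple loop(1)]

text \<open>The closed boundary is not an arc, so edge 0 is split off: the other edges form an arc,
  on which only consecutive edges meet, and edge 0 meets that arc in its own two ends only.\<close>

lemma
  shows seg_nondeg: "k < N \<Longrightarrow> A k \<noteq> B k"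
    and seg_meet: "j < N \<Longrightarrow> k < N \<Longrightarrow> j \<noteq> k \<Longrightarrow> z \<in> seg j \<Longrightarrow> z \<in> seg k \<Longrightarrow> z \<in> {A j, B j}"
proof -
  obtain a b c rest where vs: "vs = a # b # c # rest"
    using len3 by (auto simp: numeral_eq_Suc Suc_le_length_iff)
  let ?ys = "b # c # (rest @ [a])"
  have bp: "boundary_path vs = linepath a b +++ polyline ?ys"
    by (simp add: boundary_path_def vs)
  have P: "arc (linepath a b)" "arc (polyline ?ys)"
    "path_image (linepath a b) \<inter> path_image (polyline ?ys) \<subseteq> {a, b}"
    using simple polyline_props[of ?ys] unfolding bp
    by (auto simp: simple_path_join_loop_eq)
  have ab: "a \<noteq> b" using arc_distinct_ends[OF P(1)] by simp
  have Nl: "N = length ?ys" by (simp add: vs)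
  have ysA: "?ys ! k = A (Suc k)" if "Suc k < N" for k
    using xs_nth(1)[of "Suc k"] that by (simp add: vs)
  have ysB: "?ys ! Suc k = B (Suc k)" if "Suc k < N" for k
    using xs_nth(2)[of "Suc k"] that by (simp add: vs)
  have A0: "A 0 = a" "B 0 = b" by (simp_all add: vert_a_def vert_b_def vs)
  have AS: "A (Suc k) = B k" if "Suc k < N" for k
    using that by (simp add: vert_a_def vert_b_def)
  have BN: "B (N - 1) = a" by (simp add: vert_b_def vs)
  show nd: "A k \<noteq> B k" if k: "k < N" for k
  proof (cases k)
    case (Suc k')
    then show ?thesis using arc_polyline_distinct[OF P(2), of k'] k ysA ysB Nl by auto
  qed (use ab A0 in auto)
  have meet: "z = B j \<and> k = Suc j" if "0 < j" "j < k" "k < N" "z \<in> seg j" "z \<in> seg k" for j k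
  proof -
    obtain j' k' where jk: "j = Suc j'" "k = Suc k'" using \<open>0 < j\<close> \<open>j < k\<close> by (cases j; cases k) auto
    have "k' = Suc j' \<and> z = ?ys ! k'"
      using arc_polyline_segments[OF P(2), of j' k' z] that jk Nl ysA[of j'] ysB[of j'] ysA[of k'] ysB[of k']
      by (simp del: nth_Cons_Suc)
    then show ?thesis using ysB[of j'] that jk by auto
  qed
  have meet0: "z \<in> {a, b}" if "0 < k" "k < N" "z \<in> seg 0" "z \<in> seg k" for k
  proof -
    obtain k' where "k = Suc k'" using \<open>0 < k\<close> by (cases k) auto
    then have "z \<in> path_image (polyline ?ys)"
      using that Nl ysA[of k'] ysB[of k']
      by (subst path_image_polyline) (auto intro!: bexI[of _ k'] simp: xs_nth)
    then show ?thesis using P(3) that A0 by auto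
  qed
  show "z \<in> {A j, B j}" if "j < N" "k < N" "j \<noteq> k" "z \<in> seg j" "z \<in> seg k"
  proof -
    consider "j = 0" | "0 < j" "j < k" | "k = 0" "0 < j" | "0 < k" "k < j" using \<open>j \<noteq> k\<close> by linarith
    then show ?thesis
    proof cases
      case 1 then show ?thesis using meet0[of k] that A0 by auto
    next
      case 2 then show ?thesis using meet[of j k] that by auto
    next
      case 4 then show ?thesis using meet[of k j] that AS[of k] by auto
    next
      \<comment> \<open>Here the common point is an end of edge 0 and has to be recognised as an end
        of edge \<open>j\<close>. The vertex \<open>a\<close> also lies on the last edge and
        \<open>b\<close> on edge 1, so \<open>j\<close> can be compared with these.\<close>
      case 3
      then consider "z = a" | "z = b" using meet0[of j] 3 \<open>j < N\<close> \<open>z \<in> seg j\<close> \<open>z \<in> seg k\<close> by auto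
      then show ?thesis
      proof cases
        case 1
        have zl: "z \<in> seg (N - 1)" using 1 BN by auto
        show ?thesis
        proof (cases "j = N - 1")
          case False
          then show ?thesis using meet[of j "N - 1"] zl that 3 len3 by auto
        qed (use 1 BN in auto)
      next
        case 2
        have b1: "A 1 = b" using AS[of 0] A0 len3 by auto
        show ?thesis
        proof (cases "j = 1")
          case False
          then have "z = B 1 \<and> j = 2" using meet[of 1 j] 3 that 2 b1 by auto
          then show ?thesis using AS[of 1] that by (auto simp: numeral_2_eq_2)
        qed (use 2 b1 in auto)
      qed
    qed
  qed
qed

lemma vertex_iff: "z \<in> set vs \<longleftrightarrow> (\<exists>k<N. z = A k)"
  by (auto simp: vert_a_def in_set_conv_nth)

lemma B_vertex: "k < N \<Longrightarrow> B k \<in> set vs" and A_vertex: "k < N \<Longrightarrow> A k \<in> set vs"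
  using len3 by (auto simp: vert_b_def vert_a_def intro!: nth_mem mod_less_divisor)

lemma vertex_on_seg: "v \<in> set vs \<Longrightarrow> k < N \<Longrightarrow> v \<in> seg k \<Longrightarrow> v \<in> {A k, B k}"
proof -
  assume v: "v \<in> set vs" "k < N" "v \<in> seg k"
  then obtain j where j: "j < N" "v = A j" by (auto simp: vertex_iff)
  show ?thesis
  proof (cases "j = k")
    case False
    then show ?thesis using seg_meet[of k j v] v j by auto
  qed (use j in auto)
qed

text \<open>Near \<open>p\<close> the winding number is the contribution of edge \<open>k\<close>, positive on its left and
  negative on its right, plus a continuous term. By the Jordan curve theorem exactly one side of
  the edge is inside, where the total is 1; hence it is the left one.\<close>

lemma boundary_sides:
  assumes k: "k < N" and p: "p \<in> seg k" "p \<notin> {A k, B k}"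
    and w: "0 < Im (cnj (B k - A k) * w)"
  shows "\<exists>e>0. \<forall>s. 0 < s \<and> s < e \<longrightarrow> p + of_real s * w \<in> R \<and> p - of_real s * w \<in> outside bdry"
proof -
  define g where "g z = (\<Sum>j\<in>{..<N} - {k}. winding_number (linepath (A j) (B j)) z)" for z
  have pj: "p \<notin> seg j" if "j \<in> {..<N} - {k}" for j
    using seg_meet[of k j p] that k p by auto
  have "continuous (at p) g"
    unfolding g_def using pj by (intro continuous_sum continuous_at_winding_number) auto
  then obtain e1 where e1: "e1 > 0" "\<And>z. dist z p < e1 \<Longrightarrow> dist (g z) (g p) < 1/4"
    unfolding continuous_at_eps_delta by (metis zero_less_divide_1_iff zero_less_numeral)
  define Oj where "Oj = (\<Union>j\<in>{..<N} - {k}. seg j)"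
  have "closed Oj" "p \<notin> Oj" unfolding Oj_def using pj by auto
  then obtain e2 where e2: "e2 > 0" "ball p e2 \<subseteq> - Oj"
    using open_contains_ball[of "- Oj"] by auto
  define e where "e = min e1 e2"
  have e: "e > 0" using e1 e2 by (simp add: e_def)
  \<comment> \<open>Up to a positive factor, \<open>m\<close> is the signed distance from the line
    through edge \<open>k\<close>; \<open>U\<close> and \<open>L\<close> are the two open half discs
    that it separates.\<close>
  define m where "m z = Im (cnj (B k - A k) * (z - p))" for z
  define U where "U = {z \<in> ball p e. m z > 0}"
  define L where "L = {z \<in> ball p e. m z < 0}"
  obtain t where t: "p = (1 - of_real t) * A k + of_real t * B k"
    using p unfolding closed_segment_def scaleR_conv_of_real by auto
  have pA: "p - A k = of_real t * (B k - A k)" and pB: "B k - p = of_real (1 - t) * (B k - A k)"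
    by (simp_all add: t algebra_simps)
  define D where "D = B k - A k"
  have im1: "Im (D * cnj (of_real c * D - q)) = Im (cnj D * q)" for c q
    by (simp add: algebra_simps)
  have im2: "Im ((- D) * cnj (- (of_real c * D) - q)) = - Im (cnj D * q)" for c q
    by (simp add: algebra_simps)
  have im3: "Im (cnj D * (of_real c * D)) = 0" for c
    by (simp add: algebra_simps)
  have mpos: "m z = Im ((B k - A k) * cnj (B k - z))" for z
  proof -
    have "B k - z = of_real (1 - t) * D - (z - p)"
      using pB by (simp add: D_def algebra_simps)
    then show ?thesis using im1[of "1 - t" "z - p"] by (simp only: m_def D_def)
  qed
  have mneg: "- m z = Im ((A k - B k) * cnj (A k - z))" for z
  proof -
    have "A k - z = - (of_real t * D) - (z - p)" "A k - B k = - D"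
      using pA by (simp_all add: D_def algebra_simps)
    then show ?thesis using im2[of t "z - p"] by (simp only: m_def D_def)
  qed
  have seg0: "m z = 0" if "z \<in> seg k" for z
  proof -
    obtain t' where t': "z = (1 - of_real t') * A k + of_real t' * B k"
      using \<open>z \<in> seg k\<close> unfolding closed_segment_def scaleR_conv_of_real by auto
    have "z - p = of_real (t' - t) * D" by (simp add: t' t D_def algebra_simps)
    then show ?thesis using im3 by (simp only: m_def D_def)
  qed
  have conv: "convex {z. m z > 0}" "convex {z. m z < 0}"
  proof -
    define v where "v = Complex (- Im D) (Re D)"
    have "m z = inner v z - inner v p" for z
      by (simp add: m_def v_def D_def inner_complex_def algebra_simps)
    then show "convex {z. m z > 0}" "convex {z. m z < 0}"
      using convex_halfspace_gt[of "inner v p" v] convex_halfspace_lt[of v "inner v p"] by simp_all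
  qed
  have UL: "U = ball p e \<inter> {z. m z > 0}" "L = ball p e \<inter> {z. m z < 0}"
    by (auto simp: U_def L_def)
  have conn: "connected U" "connected L"
    unfolding UL using conv by (auto intro!: convex_connected convex_Int)
  have off: "z \<notin> bdry" if "z \<in> U \<union> L" for z
  proof -
    have "z \<notin> seg k" "z \<notin> Oj" using that seg0 e2 by (force simp: U_def L_def e_def)+
    then show ?thesis by (auto simp: bdry_eq Oj_def)
  qed
  have cc: "connected_component (- bdry) x y" if "x \<in> S" "y \<in> S" "S = U \<or> S = L" for x y S
    using that conn off unfolding connected_component_def by (intro exI[of _ S]) auto
  have wn: "winding_number (boundary_path vs) z = g z + winding_number (linepath (A k) (B k)) z" if "z \<in> U \<union> L" for z
  proof -
    have "z \<notin> path_image (polyline (vs @ [hd vs]))" using off[OF that] by (simp add: boundary_path_def)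
    then have "winding_number (boundary_path vs) z = (\<Sum>j<N. winding_number (linepath (A j) (B j)) z)"
      using winding_number_polyline[of "vs @ [hd vs]" z] len3 by (simp add: boundary_path_def xs_nth)
    also have "\<dots> = g z + winding_number (linepath (A k) (B k)) z"
      using k by (subst sum.remove[of _ k]) (auto simp: g_def)
    finally show ?thesis .
  qed
  have gz: "\<bar>Re (g z) - Re (g p)\<bar> < 1/4" if "z \<in> U \<union> L" for z
  proof -
    have "dist (g z) (g p) < 1/4" using e1(2)[of z] that by (auto simp: U_def L_def e_def dist_commute)
    moreover have "\<bar>Re (g z) - Re (g p)\<bar> \<le> dist (g z) (g p)" using abs_Re_le_cmod[of "g z - g p"] by (simp add: dist_norm)
    ultimately show ?thesis by simp
  qed
  have io: "z \<in> R \<or> z \<in> outside bdry" if "z \<in> U \<union> L" for z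
    using off[OF that] jordan by blast
  have out0: "winding_number (boundary_path vs) z = 0" if "z \<in> outside bdry" for z
    using winding_number_zero_in_outside[OF loop(2,1) that] .
  \<comment> \<open>An open set that accumulates at \<open>p\<close> might be seen only on the line
    of the edge itself; a small push along \<open>w\<close> moves such a point into
    \<open>U\<close>.\<close>
  have hit: "\<exists>z \<in> U \<union> L. z \<in> S" if S: "open S" "p \<in> closure S" for S
  proof -
    obtain q where q: "q \<in> S" "dist q p < e" using S(2) e unfolding closure_approachable by auto
    then have "q \<in> S \<inter> ball p e" by (auto simp: dist_commute)
    then obtain r where r: "r > 0" "ball q r \<subseteq> S \<inter> ball p e"
      using open_contains_ball_eq[of "S \<inter> ball p e" q] S(1) by (auto simp: open_Int)
    show ?thesis
    proof (cases "m q = 0")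
      case False
      then show ?thesis using q by (auto simp: U_def L_def dist_commute intro!: bexI[of _ q])
    next
      case True
      have w0: "w \<noteq> 0" using w by auto
      define q' where "q' = q + of_real (r / (2 * norm w)) * w"
      have "dist q q' = r / 2" using w0 r by (simp add: q'_def dist_norm norm_mult norm_divide)
      then have "q' \<in> ball q r" using r(1) by simp
      then have q': "q' \<in> S \<inter> ball p e" using r(2) by blast
      have "m q' = m q + (r / (2 * norm w)) * Im (cnj (B k - A k) * w)"
        by (simp add: m_def q'_def algebra_simps flip: of_real_divide)
      then have "m q' > 0" using True w r w0 by simp
      then show ?thesis using q' by (auto simp: U_def)
    qed
  qed
  have pb: "p \<in> bdry" using p k by (auto simp: bdry_eq)
  have clR: "p \<in> closure R" "p \<in> closure (outside bdry)"
    using jordan pb by (auto simp: frontier_def)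
  have iz: "\<exists>z \<in> U \<union> L. z \<in> R" "\<exists>z \<in> U \<union> L. z \<in> outside bdry"
    using hit[of R] hit[of "outside bdry"] clR jordan by auto
  have allR: "S \<subseteq> R" if "z \<in> S" "z \<in> R" "S = U \<or> S = L" for z S
    using cc[of z S] that inside_same_component[of bdry z] by blast
  have allO: "S \<subseteq> outside bdry" if "z \<in> S" "z \<in> outside bdry" "S = U \<or> S = L" for z S
    using cc[of z S] that outside_same_component[of bdry z] by blast
  have disj: "R \<inter> outside bdry = {}" using jordan by blast
  \<comment> \<open>In the wrong configuration the real part of \<open>g\<close> would be negative
    at \<open>zu\<close> and greater than 1 at \<open>zl\<close>, while both values lie within 1/4
    of its value at \<open>p\<close>.\<close>
  have bad: "\<not> (zu \<in> U \<and> zl \<in> L \<and> zu \<in> outside bdry \<and> zl \<in> R)" for zu zl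
  proof
    assume a: "zu \<in> U \<and> zl \<in> L \<and> zu \<in> outside bdry \<and> zl \<in> R"
    have 1: "0 < Re (winding_number (linepath (A k) (B k)) zu)"
      using a mpos by (intro winding_number_linepath_pos_lt) (auto simp: U_def)
    have 2: "Re (winding_number (linepath (A k) (B k)) zl) < 0"
      using a mneg[of zl] by (intro winding_number_linepath_neg_lt) (auto simp: L_def)
    have "0 = Re (g zu) + Re (winding_number (linepath (A k) (B k)) zu)"
      using wn[of zu] a out0[of zu] by (metis UnI1 plus_complex.sel(1) zero_complex.sel(1))
    moreover have "1 = Re (g zl) + Re (winding_number (linepath (A k) (B k)) zl)"
      using wn[of zl] a wn1[of zl] by (metis UnI2 plus_complex.sel(1) one_complex.sel(1))
    moreover have "\<bar>Re (g zu) - Re (g p)\<bar> < 1/4" "\<bar>Re (g zl) - Re (g p)\<bar> < 1/4" using gz a by auto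
    ultimately show False using 1 2 unfolding abs_less_iff by linarith
  qed
  have fin: "U \<subseteq> R \<and> L \<subseteq> outside bdry"
  proof -
    obtain z1 z2 where z: "z1 \<in> U \<union> L" "z1 \<in> R" "z2 \<in> U \<union> L" "z2 \<in> outside bdry" using iz by auto
    show ?thesis
    proof (cases "z1 \<in> U")
      case True
      then have "U \<subseteq> R" using allR z by blast
      moreover have "z2 \<in> L" using calculation z disj by blast
      ultimately show ?thesis using allO z by blast
    next
      case False
      then have "z1 \<in> L" "L \<subseteq> R" using allR z by blast+
      then have "z2 \<in> U" using z disj by blast
      then show ?thesis using bad z \<open>z1 \<in> L\<close> by blast
    qed
  qed
  have w0: "norm w > 0" using w by auto
  show ?thesis
  proof (intro exI[of _ "e / norm w"] conjI allI impI)
    show "0 < e / norm w" using e w0 by simp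
    fix s assume s: "0 < s \<and> s < e / norm w"
    then have "s * norm w < e" using w0 by (simp add: field_simps)
    then have b: "p + of_real s * w \<in> ball p e" "p - of_real s * w \<in> ball p e"
      using s by (auto simp: dist_norm norm_mult)
    have "m (p + of_real s * w) = s * Im (cnj (B k - A k) * w)" "m (p - of_real s * w) = - s * Im (cnj (B k - A k) * w)"
      by (simp_all add: m_def algebra_simps)
    then have "m (p + of_real s * w) > 0" "m (p - of_real s * w) < 0" using s w by auto
    then show "p + of_real s * w \<in> R" "p - of_real s * w \<in> outside bdry" using b fin by (auto simp: U_def L_def)
  qed
qed

end

section \<open>Coordinates adapted to a direction\<close>

text \<open>In the coordinates \<open>z = (x + \<i> h) d\<close> the flow in direction \<open>d\<close> fixes the height \<open>h\<close> and
  increases \<open>x\<close> at unit speed. Edge \<open>k\<close> is the graph of the affine function \<open>ef d vs k\<close> over the heights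
  from \<open>elo d vs k\<close> to \<open>ehi d vs k\<close>, and \<open>ent d vs k\<close> says that \<open>d\<close> points to its left, that is, into the
  polygon.\<close>

definition hgt :: "complex \<Rightarrow> complex \<Rightarrow> real" where "hgt d z = Im (z * cnj d)"
definition xco :: "complex \<Rightarrow> complex \<Rightarrow> real" where "xco d z = Re (z * cnj d)"
definition pnt :: "complex \<Rightarrow> real \<Rightarrow> real \<Rightarrow> complex" where "pnt d x u = Complex x u * d"

definition elo :: "complex \<Rightarrow> complex list \<Rightarrow> nat \<Rightarrow> real" where
  "elo d vs k = min (hgt d (vert_a vs k)) (hgt d (vert_b vs k))"
definition ehi :: "complex \<Rightarrow> complex list \<Rightarrow> nat \<Rightarrow> real" where
  "ehi d vs k = max (hgt d (vert_a vs k)) (hgt d (vert_b vs k))"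
definition esl :: "complex \<Rightarrow> complex list \<Rightarrow> nat \<Rightarrow> real" where
  "esl d vs k = xco d (vert_b vs k - vert_a vs k) / hgt d (vert_b vs k - vert_a vs k)"
definition ef :: "complex \<Rightarrow> complex list \<Rightarrow> nat \<Rightarrow> real \<Rightarrow> real" where
  "ef d vs k u = xco d (vert_a vs k) + (u - hgt d (vert_a vs k)) * esl d vs k"
definition ent :: "complex \<Rightarrow> complex list \<Rightarrow> nat \<Rightarrow> bool" where
  "ent d vs k \<longleftrightarrow> hgt d (vert_b vs k) < hgt d (vert_a vs k)"

lemma hgt_diff: "hgt d (a - b) = hgt d a - hgt d b" and xco_diff: "xco d (a - b) = xco d a - xco d b"
  and hgt_add: "hgt d (a + b) = hgt d a + hgt d b" and xco_add: "xco d (a + b) = xco d a + xco d b"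
  and hgt_scale: "hgt d (of_real t * a) = t * hgt d a" and xco_scale: "xco d (of_real t * a) = t * xco d a"
  and hgt_minus: "hgt d (- a) = - hgt d a" and xco_minus: "xco d (- a) = - xco d a"
  by (simp_all add: hgt_def xco_def algebra_simps)

locale direction =
  fixes d :: complex
  assumes d1: "cmod d = 1"
begin

lemma dcnj: "d * cnj d = 1"
  using d1 by (simp add: complex_norm_square[symmetric])

lemma hgt_pnt [simp]: "hgt d (pnt d x u) = u" and xco_pnt [simp]: "xco d (pnt d x u) = x"
  using dcnj by (simp_all add: hgt_def xco_def pnt_def mult.assoc)

lemma pnt_coords: "pnt d (xco d z) (hgt d z) = z"
proof -
  have "Complex (xco d z) (hgt d z) = z * cnj d" unfolding hgt_def xco_def by (rule complex_surj)
  then show ?thesis using dcnj by (simp add: pnt_def mult.assoc) (metis mult.commute mult.right_neutral)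
qed

lemma pnt_inj: "pnt d x u = pnt d x' u' \<longleftrightarrow> x = x' \<and> u = u'"
  using hgt_pnt xco_pnt by metis

lemma pnt_add_d: "pnt d x u + of_real s * d = pnt d (x + s) u"
  and pnt_diff_d: "pnt d x u - of_real s * d = pnt d (x - s) u"
  by (simp_all add: pnt_def complex_eq_iff algebra_simps)

lemma dist_pnt: "dist (pnt d x u) (pnt d x' u') \<le> \<bar>x - x'\<bar> + \<bar>u - u'\<bar>"
proof -
  have "pnt d x u - pnt d x' u' = Complex (x - x') (u - u') * d"
    by (simp add: pnt_def complex_eq_iff algebra_simps)
  then have "dist (pnt d x u) (pnt d x' u') = cmod (Complex (x - x') (u - u'))"
    using d1 by (simp add: dist_norm norm_mult)
  then show ?thesis using cmod_le[of "Complex (x - x') (u - u')"] by simp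
qed

lemma continuous_on_pnt [continuous_intros]:
  assumes "continuous_on S f" "continuous_on S g" shows "continuous_on S (\<lambda>s. pnt d (f s) (g s))"
proof -
  have "pnt d (f s) (g s) = (of_real (f s) + \<i> * of_real (g s)) * d" for s
    by (simp add: pnt_def complex_eq_iff)
  then show ?thesis using assms by (simp add: continuous_intros)
qed

lemma xco_le: "\<bar>xco d z\<bar> \<le> cmod z" and hgt_le: "\<bar>hgt d z\<bar> \<le> cmod z"
  using abs_Re_le_cmod[of "z * cnj d"] abs_Im_le_cmod[of "z * cnj d"] d1
  by (simp_all add: xco_def hgt_def norm_mult)

lemma tendsto_pnt:
  assumes "(f \<longlongrightarrow> a) G" "(g \<longlongrightarrow> b) G" shows "((\<lambda>s. pnt d (f s) (g s)) \<longlongrightarrow> pnt d a b) G"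
proof -
  have eq: "pnt d x y = (of_real x + \<i> * of_real y) * d" for x y
    by (simp add: pnt_def complex_eq_iff)
  show ?thesis unfolding eq by (intro tendsto_intros assms)
qed

lemma closed_segment_d:
  assumes "0 \<le> l"
  shows "closed_segment (pnt d x u) (pnt d x u + of_real l * d) = {pnt d y u |y. x \<le> y \<and> y \<le> x + l}"
proof -
  have "(1 - t) *\<^sub>R pnt d x u + t *\<^sub>R (pnt d x u + of_real l * d) = pnt d (x + t * l) u" for t
    by (simp add: pnt_def complex_eq_iff algebra_simps)
  then have "closed_segment (pnt d x u) (pnt d x u + of_real l * d) = {pnt d (x + t * l) u |t. 0 \<le> t \<and> t \<le> 1}"
    unfolding closed_segment_def by auto
  also have "\<dots> = {pnt d y u |y. x \<le> y \<and> y \<le> x + l}"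
  proof (intro set_eqI iffI; clarsimp)
    fix t :: real assume t: "0 \<le> t" "t \<le> 1"
    have "x \<le> x + t * l" "x + t * l \<le> x + l" using t assms mult_right_mono[of t 1 l] by auto
    then show "\<exists>y. pnt d (x + t * l) u = pnt d y u \<and> x \<le> y \<and> y \<le> x + l" by blast
  next
    fix y assume y: "x \<le> y" "y \<le> x + l"
    show "\<exists>t. pnt d y u = pnt d (x + t * l) u \<and> 0 \<le> t \<and> t \<le> 1"
    proof (cases "l = 0")
      case True then show ?thesis using y by (intro exI[of _ 0]) auto
    next
      case False
      then show ?thesis using y assms by (intro exI[of _ "(y - x) / l"]) (auto simp: field_simps)
    qed
  qed
  finally show ?thesis .
qed

end

section \<open>Edges of a transversal polygon as graphs over the height\<close>

locale dir_polygon = jordan_polygon vs + direction d for vs d +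
  assumes transversal: "\<And>k. k < length vs \<Longrightarrow> hgt d (vert_a vs k) \<noteq> hgt d (vert_b vs k)"
begin

abbreviation "lo \<equiv> elo d vs"
abbreviation "hi \<equiv> ehi d vs"
abbreviation "f \<equiv> ef d vs"
abbreviation "P \<equiv> pnt d"
abbreviation "entering \<equiv> ent d vs"

lemma lo_less_hi: "k < N \<Longrightarrow> lo k < hi k"
  using transversal[of k] by (auto simp: elo_def ehi_def)

lemma seg_iff:
  assumes k: "k < N"
  shows "P x u \<in> seg k \<longleftrightarrow> lo k \<le> u \<and> u \<le> hi k \<and> x = f k u"
proof -
  let ?ha = "hgt d (A k)" and ?hb = "hgt d (B k)" and ?xa = "xco d (A k)" and ?xb = "xco d (B k)"
  have ne: "?hb - ?ha \<noteq> 0" using transversal[OF k] by simp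
  have "P x u \<in> seg k \<longleftrightarrow> (\<exists>t. 0 \<le> t \<and> t \<le> 1 \<and> x = (1 - t) * ?xa + t * ?xb \<and> u = (1 - t) * ?ha + t * ?hb)"
  proof -
    have "P x u = (1 - t) *\<^sub>R A k + t *\<^sub>R B k \<longleftrightarrow> x = (1 - t) * ?xa + t * ?xb \<and> u = (1 - t) * ?ha + t * ?hb" for t
    proof -
      have 1: "xco d ((1 - t) *\<^sub>R A k + t *\<^sub>R B k) = (1 - t) * ?xa + t * ?xb"
        "hgt d ((1 - t) *\<^sub>R A k + t *\<^sub>R B k) = (1 - t) * ?ha + t * ?hb"
        unfolding scaleR_conv_of_real by (simp_all only: xco_add xco_scale hgt_add hgt_scale)
      show ?thesis by (metis 1 pnt_coords pnt_inj)
    qed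
    then show ?thesis unfolding closed_segment_def by auto
  qed
  also have "\<dots> \<longleftrightarrow> lo k \<le> u \<and> u \<le> hi k \<and> x = f k u"
  proof
    assume "\<exists>t. 0 \<le> t \<and> t \<le> 1 \<and> x = (1 - t) * ?xa + t * ?xb \<and> u = (1 - t) * ?ha + t * ?hb"
    then obtain t where t: "0 \<le> t" "t \<le> 1" "x = (1 - t) * ?xa + t * ?xb" "u = (1 - t) * ?ha + t * ?hb" by blast
    have 1: "u - ?ha = t * (?hb - ?ha)" "x - ?xa = t * (?xb - ?xa)" using t by (simp_all add: algebra_simps)
    have "f k u = ?xa + (u - ?ha) * ((?xb - ?xa) / (?hb - ?ha))"
      by (simp add: ef_def esl_def hgt_diff xco_diff)
    also have "\<dots> = ?xa + t * (?xb - ?xa)" using ne unfolding 1(1) by simp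
    finally have "x = f k u" using 1(2) by simp
    moreover have "u \<in> closed_segment ?ha ?hb" using t unfolding closed_segment_def by auto
    ultimately show "lo k \<le> u \<and> u \<le> hi k \<and> x = f k u"
      by (auto simp: closed_segment_eq_real_ivl elo_def ehi_def split: if_splits)
  next
    assume a: "lo k \<le> u \<and> u \<le> hi k \<and> x = f k u"
    define t where "t = (u - ?ha) / (?hb - ?ha)"
    have th: "t * (?hb - ?ha) = u - ?ha" using ne by (simp add: t_def)
    have "x = ?xa + t * (?xb - ?xa)"
      using a by (simp add: t_def ef_def esl_def hgt_diff xco_diff)
    moreover have "0 \<le> t \<and> t \<le> 1"
      using a ne by (auto simp: t_def elo_def ehi_def field_simps divide_simps)
    ultimately show "\<exists>t. 0 \<le> t \<and> t \<le> 1 \<and> x = (1 - t) * ?xa + t * ?xb \<and> u = (1 - t) * ?ha + t * ?hb"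
      using th by (intro exI[of _ t]) (auto simp: algebra_simps)
  qed
  finally show ?thesis .
qed

lemma f_affine: "f k u = f k t + (u - t) * esl d vs k"
  by (simp add: ef_def algebra_simps)

lemma continuous_f [continuous_intros]: "continuous_on S (f k)"
  unfolding ef_def by (intro continuous_intros)

lemma tendsto_f: "(g \<longlongrightarrow> t) G \<Longrightarrow> ((\<lambda>x. f k (g x)) \<longlongrightarrow> f k t) G"
  unfolding ef_def by (intro tendsto_intros)

lemma f_mem_seg: "k < N \<Longrightarrow> lo k \<le> u \<Longrightarrow> u \<le> hi k \<Longrightarrow> P (f k u) u \<in> seg k"
  by (simp add: seg_iff)

lemma edges_disjoint:
  assumes "k < N" "j < N" "k \<noteq> j" "lo k \<le> u" "u \<le> hi k" "lo j < u" "u < hi j"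
  shows "f k u \<noteq> f j u"
proof
  assume "f k u = f j u"
  then have "P (f j u) u \<in> {A j, B j}"
    using seg_meet[of j k "P (f j u) u"] assms f_mem_seg[of k u] f_mem_seg[of j u] by auto
  then have "u \<in> {hgt d (A j), hgt d (B j)}" by (metis hgt_pnt insert_iff empty_iff)
  then show False using assms by (auto simp: elo_def ehi_def)
qed

lemma end_vertex:
  assumes "k < N" "lo k \<le> u" "u \<le> hi k" "\<not> (lo k < u \<and> u < hi k)"
  shows "P (f k u) u \<in> set vs"
proof -
  have u: "u = lo k \<or> u = hi k" using assms by auto
  have "A k = P (xco d (A k)) (hgt d (A k))" "B k = P (xco d (B k)) (hgt d (B k))" by (simp_all add: pnt_coords)
  then have "xco d (A k) = f k (hgt d (A k))" "xco d (B k) = f k (hgt d (B k))"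
    using seg_iff[OF assms(1)] by (metis ends_in_segment)+
  then have "P (f k (hgt d (A k))) (hgt d (A k)) = A k" "P (f k (hgt d (B k))) (hgt d (B k)) = B k"
    by (metis pnt_coords)+
  moreover have "u = hgt d (A k) \<or> u = hgt d (B k)" using u by (auto simp: elo_def ehi_def min_def max_def split: if_splits)
  ultimately show ?thesis using A_vertex B_vertex assms(1) by auto
qed

lemma interior_not_vertex:
  assumes "k < N" "lo k < u" "u < hi k" shows "P (f k u) u \<notin> set vs"
proof
  assume "P (f k u) u \<in> set vs"
  then have "P (f k u) u \<in> {A k, B k}" using vertex_on_seg f_mem_seg[of k u] assms by auto
  then have "u \<in> {hgt d (A k), hgt d (B k)}" by (metis hgt_pnt insert_iff empty_iff)
  then show False using assms by (auto simp: elo_def ehi_def)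
qed

lemma bdry_iff: "P x u \<in> bdry \<longleftrightarrow> (\<exists>k<N. lo k \<le> u \<and> u \<le> hi k \<and> x = f k u)"
  by (auto simp: bdry_eq seg_iff)

text \<open>This is \<open>boundary_sides\<close> with \<open>w = d\<close> for an entering edge and
  \<open>w = - d\<close> for a leaving one, the vectors that point to the left of the edge.\<close>

lemma sides:
  assumes k: "k < N" "lo k < u" "u < hi k"
  shows "\<exists>e>0. \<forall>s. 0 < s \<and> s < e \<longrightarrow>
     (if entering k then P (f k u + s) u \<in> R \<and> P (f k u - s) u \<in> outside bdry
      else P (f k u - s) u \<in> R \<and> P (f k u + s) u \<in> outside bdry)"
proof -
  have p: "P (f k u) u \<in> seg k" "P (f k u) u \<notin> {A k, B k}"
    using f_mem_seg[of k u] interior_not_vertex[OF k] k A_vertex[of k] B_vertex[of k] by auto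
  have im: "Im (cnj (B k - A k) * d) = - hgt d (B k - A k)" by (simp add: hgt_def algebra_simps)
  show ?thesis
  proof (cases "entering k")
    case True
    then have "0 < Im (cnj (B k - A k) * d)" using im by (simp add: ent_def hgt_diff)
    from boundary_sides[OF k(1) p this] show ?thesis using True by (simp add: pnt_add_d pnt_diff_d)
  next
    case False
    then have "0 < Im (cnj (B k - A k) * (- d))" using im transversal[OF k(1)] by (simp add: ent_def hgt_diff)
    from boundary_sides[OF k(1) p this] show ?thesis using False by (simp add: pnt_add_d pnt_diff_d)
  qed
qed

lemma out_not_F: "z \<in> outside bdry \<Longrightarrow> z \<notin> F"
  using inside_Int_outside[of bdry] outside_no_overlap[of bdry] unfolding face_region_def by blast

lemma F_eq: "F = bdry \<union> R" by (simp add: face_region_def)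

lemma closed_F: "closed F"
proof -
  have "F = - outside bdry" using inside_Un_outside[of bdry] out_not_F unfolding F_eq by blast
  then show ?thesis using jordan by (metis closed_Compl)
qed

lemma bounded_F: "bounded F"
  using jordan bounded_path_image[OF loop(2)] by (simp add: F_eq)

lemma F_closure: "F \<subseteq> closure R"
  using jordan by (auto simp: F_eq frontier_def closure_def)

section \<open>Chords at generic heights\<close>

lemma R_segment:
  assumes "P x0 u \<in> R" "x0 \<in> {a<..<b}" "\<And>x. x \<in> {a<..<b} \<Longrightarrow> P x u \<notin> bdry" "x \<in> {a<..<b}"
  shows "P x u \<in> R"
proof -
  have "connected ((\<lambda>x. P x u) ` {a<..<b})"
    by (intro connected_continuous_image continuous_intros) auto
  moreover have "(\<lambda>x. P x u) ` {a<..<b} \<subseteq> - bdry" using assms(3) by auto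
  ultimately have "connected_component (- bdry) (P x0 u) (P x u)"
    unfolding connected_component_def using assms by (intro exI[of _ "(\<lambda>x. P x u) ` {a<..<b}"]) auto
  then show ?thesis using inside_same_component assms(1) by blast
qed

text \<open>The exceptional heights. At any other height a line in direction \<open>d\<close>
  crosses the boundary only at interior points of edges, so its chords are determined by the order
  of the crossings.\<close>

definition vh :: "real set" where "vh = hgt d ` set vs"

lemma finite_vh: "finite vh" by (simp add: vh_def)

lemma lo_hi_vh: "k < N \<Longrightarrow> lo k \<in> vh" "k < N \<Longrightarrow> hi k \<in> vh"
  using A_vertex[of k] B_vertex[of k] by (auto simp: vh_def elo_def ehi_def min_def max_def)

definition spn :: "nat \<Rightarrow> real \<Rightarrow> bool" where "spn k u \<longleftrightarrow> k < N \<and> lo k < u \<and> u < hi k"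

text \<open>Only the order of the crossings at height \<open>u\<close> is recorded. That the
  interval between them lies inside the polygon is a separate fact, which holds at generic heights
  if \<open>k\<close> is entering.\<close>

definition nxt :: "nat \<Rightarrow> real \<Rightarrow> nat \<Rightarrow> bool" where
  "nxt k u j \<longleftrightarrow> spn k u \<and> spn j u \<and> f k u < f j u \<and> (\<forall>m. spn m u \<longrightarrow> \<not> (f k u < f m u \<and> f m u < f j u))"

lemma spn_inj: "spn k u \<Longrightarrow> spn j u \<Longrightarrow> f k u = f j u \<Longrightarrow> k = j"
  using edges_disjoint[of k j u] by (auto simp: spn_def)

lemma bdry_generic: "u \<notin> vh \<Longrightarrow> P x u \<in> bdry \<longleftrightarrow> (\<exists>k. spn k u \<and> x = f k u)"
  unfolding bdry_iff spn_def using lo_hi_vh by (metis less_imp_le order.order_iff_strict)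

lemma finite_spn: "finite {k. spn k u}"
  by (rule finite_subset[of _ "{..<N}"]) (auto simp: spn_def)

text \<open>The chord ends at the nearest crossings on either side of \<open>x\<close>. They exist
  because otherwise a whole ray would lie in the bounded region \<open>R\<close>. Their types are
  forced because the wrong type would put points of the chord outside.\<close>

lemma generic_chord:
  assumes z: "P x u \<in> R" and u: "u \<notin> vh"
  obtains k j where "nxt k u j" "entering k" "\<not> entering j" "f k u < x" "x < f j u"
    "\<And>y. f k u < y \<Longrightarrow> y < f j u \<Longrightarrow> P y u \<in> R"
proof -
  obtain M where M: "\<And>z. z \<in> F \<Longrightarrow> cmod z \<le> M" using bounded_F by (auto simp: bounded_iff)
  have notb: "x \<noteq> f k u" if "spn k u" for k
    using z that bdry_generic[OF u, of x] inside_no_overlap[of bdry] by blast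
  let ?S = "{k. spn k u \<and> x < f k u}" and ?T = "{k. spn k u \<and> f k u < x}"
  have fin: "finite ?S" "finite ?T" using finite_subset[OF _ finite_spn[of u]] by auto
  have big: "P y u \<notin> R" if "\<bar>y\<bar> > M" for y
    using M[of "P y u"] xco_le[of "P y u"] that by (auto simp: F_eq)
  have "?S \<noteq> {}"
  proof
    assume e: "?S = {}"
    \<comment> \<open>\<open>l\<close> separates \<open>x\<close> from all crossings before it, so
      the interval from \<open>l\<close> to \<open>b\<close> contains no crossing, while
      \<open>b\<close> lies beyond the bound \<open>M\<close>.\<close>
    obtain l where l: "l < x" "\<forall>k\<in>?T. f k u < l"
    proof (cases "?T = {}")
      case True then show ?thesis using that[of "x - 1"] by auto
    next
      case False
      define l where "l = (Max ((\<lambda>k. f k u) ` ?T) + x) / 2"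
      have "Max ((\<lambda>k. f k u) ` ?T) < x" using False fin by auto
      then have "l < x" "Max ((\<lambda>k. f k u) ` ?T) < l" by (auto simp: l_def)
      moreover have "f k u \<le> Max ((\<lambda>k. f k u) ` ?T)" if "k \<in> ?T" for k using that fin by (intro Max_ge) auto
      ultimately have "\<forall>k\<in>?T. f k u < l" by (meson le_less_trans)
      then show ?thesis using that[of l] \<open>l < x\<close> by blast
    qed
    define b where "b = max (x + 1) (M + 2)"
    have "P (max (x + 1/2) (M + 1)) u \<in> R"
    proof (rule R_segment[OF z, of l b])
      fix y assume y: "y \<in> {l<..<b}"
      show "P y u \<notin> bdry"
      proof
        assume "P y u \<in> bdry"
        then obtain k where "spn k u" "y = f k u" using bdry_generic[OF u] by auto
        then show False using e notb[of k] y l(2) by fastforce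
      qed
    qed (use l(1) in \<open>auto simp: b_def max_def\<close>)
    moreover have "\<bar>max (x + 1/2) (M + 1)\<bar> > M" by linarith
    ultimately show False using big by blast
  qed
  then obtain j where j: "j \<in> ?S" "\<forall>m\<in>?S. f j u \<le> f m u"
    using ex_min_if_finite[of "(\<lambda>k. f k u) ` ?S"] fin by (auto simp: not_less) (meson not_less)
  have "?T \<noteq> {}"
  proof
    assume e: "?T = {}"
    define l where "l = min (x - 1) (- M - 2)"
    have "P (min (x - 1/2) (- M - 1)) u \<in> R"
    proof (rule R_segment[OF z, of l "f j u"])
      fix y assume y: "y \<in> {l<..<f j u}"
      show "P y u \<notin> bdry"
      proof
        assume "P y u \<in> bdry"
        then obtain k where "spn k u" "y = f k u" using bdry_generic[OF u] by auto
        then show False using e notb[of k] y j by fastforce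
      qed
    qed (use j in \<open>auto simp: l_def min_def\<close>)
    moreover have "\<bar>min (x - 1/2) (- M - 1)\<bar> > M" by linarith
    ultimately show False using big by blast
  qed
  then obtain k where k: "k \<in> ?T" "\<forall>m\<in>?T. f m u \<le> f k u"
    using ex_min_if_finite[of "(\<lambda>k. - f k u) ` ?T"] fin by (auto simp: not_less) (meson not_less)
  have free: "P y u \<notin> bdry" if "f k u < y" "y < f j u" for y
  proof
    assume "P y u \<in> bdry"
    then obtain m where "spn m u" "y = f m u" using bdry_generic[OF u] by auto
    then show False using notb[of m] that k j by fastforce
  qed
  have inR: "P y u \<in> R" if "f k u < y" "y < f j u" for y
    by (rule R_segment[OF z, of "f k u" "f j u"]) (use free k j that in auto)
  have nx: "nxt k u j" unfolding nxt_def
  proof (intro conjI allI impI notI)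
    fix m assume m: "spn m u" "f k u < f m u \<and> f m u < f j u"
    then show False using free[of "f m u"] bdry_generic[OF u] by auto
  qed (use k j in auto)
  have disj: "R \<inter> outside bdry = {}" using jordan by blast
  have "entering k"
  proof (rule ccontr)
    assume ne: "\<not> entering k"
    obtain e where e: "e > 0" "\<forall>s. 0 < s \<and> s < e \<longrightarrow> P (f k u + s) u \<in> outside bdry"
      using sides[of k u] ne k by (auto simp: spn_def)
    define s where "s = min (e/2) ((x - f k u)/2)"
    have s: "0 < s" "s < e" "f k u + s < f j u" using e k j by (auto simp: s_def min_def field_simps)
    then have "P (f k u + s) u \<in> R" "P (f k u + s) u \<in> outside bdry" using e(2) inR[of "f k u + s"] by auto
    then show False using disj by blast
  qed
  moreover have "\<not> entering j"
  proof
    assume ne: "entering j"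
    obtain e where e: "e > 0" "\<forall>s. 0 < s \<and> s < e \<longrightarrow> P (f j u - s) u \<in> outside bdry"
      using sides[of j u] ne j by (auto simp: spn_def)
    define s where "s = min (e/2) ((f j u - x)/2)"
    have s: "0 < s" "s < e" "f k u < f j u - s" using e k j by (auto simp: s_def min_def field_simps)
    then have "P (f j u - s) u \<in> R" "P (f j u - s) u \<in> outside bdry" using e(2) inR[of "f j u - s"] by auto
    then show False using disj by blast
  qed
  ultimately show ?thesis using that nx inR k j by auto
qed

lemma nxt_unique: "nxt k u j \<Longrightarrow> nxt k u j' \<Longrightarrow> j = j'" and nxt_unique': "nxt k u j \<Longrightarrow> nxt k' u j \<Longrightarrow> k = k'"
  using spn_inj unfolding nxt_def by (metis linorder_neqE_linordered_idom)+

lemma nxt_between: "nxt k u j \<Longrightarrow> nxt k' u j' \<Longrightarrow> f k u < x \<Longrightarrow> x < f j u \<Longrightarrow> f k' u < x \<Longrightarrow> x < f j' u \<Longrightarrow> k = k' \<and> j = j'"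
proof
  assume a: "nxt k u j" "nxt k' u j'" "f k u < x" "x < f j u" "f k' u < x" "x < f j' u"
  have "\<not> (f k u < f k' u)" "\<not> (f k' u < f k u)" "\<not> (f j u < f j' u)" "\<not> (f j' u < f j u)"
    using a unfolding nxt_def by (meson less_trans)+
  then have "f k u = f k' u" "f j u = f j' u" by auto
  then show "k = k'" "j = j'" using spn_inj a unfolding nxt_def by auto
qed

text \<open>Take the chord through a point just past edge \<open>k\<close>. If it started at another
  edge, then either that edge would lie in the inner neighbourhood of \<open>k\<close>, or
  \<open>k\<close> itself would separate the two ends of the chord.\<close>

lemma entering_nxt:
  assumes k: "spn k u" "entering k" "u \<notin> vh"
  obtains j where "nxt k u j" "\<not> entering j" "\<And>y. f k u < y \<Longrightarrow> y < f j u \<Longrightarrow> P y u \<in> R"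
proof -
  obtain e where e: "e > 0" "\<forall>s. 0 < s \<and> s < e \<longrightarrow> P (f k u + s) u \<in> R"
    using sides[of k u] k by (auto simp: spn_def)
  have "P (f k u + e/2) u \<in> R" using e by auto
  then obtain k' j where kj: "nxt k' u j" "entering k'" "\<not> entering j" "f k' u < f k u + e/2" "f k u + e/2 < f j u"
    "\<And>y. f k' u < y \<Longrightarrow> y < f j u \<Longrightarrow> P y u \<in> R" by (rule generic_chord[OF _ k(3)]) blast
  have "k' = k"
  proof (rule ccontr)
    assume ne: "k' \<noteq> k"
    have "\<not> f k u < f k' u"
    proof
      assume l: "f k u < f k' u"
      then have "P (f k' u) u \<in> R" using e(2)[rule_format, of "f k' u - f k u"] kj e(1) by auto
      moreover have "P (f k' u) u \<in> bdry" using kj(1) bdry_generic[OF k(3)] by (auto simp: nxt_def)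
      ultimately show False using inside_no_overlap by blast
    qed
    moreover have "f k u \<noteq> f k' u" using spn_inj[of k u k'] k kj ne by (auto simp: nxt_def)
    ultimately have "f k' u < f k u" by simp
    moreover have "f k u < f j u" using kj(5) e(1) by simp
    ultimately show False using kj(1) k(1) unfolding nxt_def by blast
  qed
  then show ?thesis using that kj by auto
qed

lemma leaving_nxt:
  assumes j: "spn j u" "\<not> entering j" "u \<notin> vh"
  obtains k where "nxt k u j" "entering k" "\<And>y. f k u < y \<Longrightarrow> y < f j u \<Longrightarrow> P y u \<in> R"
proof -
  obtain e where e: "e > 0" "\<forall>s. 0 < s \<and> s < e \<longrightarrow> P (f j u - s) u \<in> R"
    using sides[of j u] j by (auto simp: spn_def)
  have "P (f j u - e/2) u \<in> R" using e by auto
  then obtain k j' where kj: "nxt k u j'" "entering k" "\<not> entering j'" "f k u < f j u - e/2" "f j u - e/2 < f j' u"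
    "\<And>y. f k u < y \<Longrightarrow> y < f j' u \<Longrightarrow> P y u \<in> R" by (rule generic_chord[OF _ j(3)]) blast
  have "j' = j"
  proof (rule ccontr)
    assume ne: "j' \<noteq> j"
    have "\<not> f j' u < f j u"
    proof
      assume l: "f j' u < f j u"
      then have "P (f j' u) u \<in> R" using e(2)[rule_format, of "f j u - f j' u"] kj e(1) by auto
      moreover have "P (f j' u) u \<in> bdry" using kj(1) bdry_generic[OF j(3)] by (auto simp: nxt_def)
      ultimately show False using inside_no_overlap by blast
    qed
    moreover have "f j u \<noteq> f j' u" using spn_inj[of j u j'] j kj ne by (auto simp: nxt_def)
    ultimately have "f j u < f j' u" by simp
    moreover have "f k u < f j u" using kj(4) e(1) by simp
    ultimately show False using kj(1) j(1) unfolding nxt_def by blast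
  qed
  then show ?thesis using that kj by auto
qed

section \<open>Strips without vertex heights\<close>

lemma nonzero_same_sign:
  fixes g :: "real \<Rightarrow> real"
  assumes c: "continuous_on {p<..<q} g" and nz: "\<And>w. p < w \<Longrightarrow> w < q \<Longrightarrow> g w \<noteq> 0"
    and u: "p < u" "u < q" "p < u'" "u' < q" and g: "0 < g u"
  shows "0 < g u'"
proof (rule ccontr)
  assume "\<not> 0 < g u'"
  then have neg: "g u' < 0" using nz[of u'] u by auto
  have "connected (g ` {p<..<q})" by (intro connected_continuous_image c) auto
  then have "0 \<in> g ` {p<..<q}"
    using connectedD_interval[of "g ` {p<..<q}" "g u'" "g u" 0] u g neg by auto
  then show False using nz by auto
qed

lemma spn_strip:
  assumes "\<And>w. p < w \<Longrightarrow> w < q \<Longrightarrow> w \<notin> vh" "p < u" "u < q" "p < u'" "u' < q" "spn k u"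
  shows "spn k u'"
proof -
  have "lo k \<le> p" "q \<le> hi k" using assms lo_hi_vh[of k] unfolding spn_def by (meson not_less order.strict_trans2 less_trans)+
  then show ?thesis using assms by (auto simp: spn_def)
qed

lemma order_strip:
  assumes st: "\<And>w. p < w \<Longrightarrow> w < q \<Longrightarrow> w \<notin> vh" and u: "p < u" "u < q" "p < u'" "u' < q"
    and s: "spn k u" "spn j u" "f k u < f j u"
  shows "f k u' < f j u'"
proof -
  have "0 < f j u' - f k u'"
  proof (rule nonzero_same_sign[of p q "\<lambda>w. f j w - f k w" u])
    fix w assume w: "p < w" "w < q"
    have "spn k w" "spn j w" using spn_strip[OF st u(1,2) w] s by auto
    moreover have "k \<noteq> j" using s by auto
    ultimately show "f j w - f k w \<noteq> 0" using spn_inj[of k w j] by auto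
  qed (use u s in \<open>auto intro!: continuous_intros\<close>)
  then show ?thesis by simp
qed

text \<open>An edge that spans one height of such a strip spans all of them, and two such edges
  never meet inside it. By the intermediate value theorem the order of the crossings is therefore
  the same at all heights of the strip.\<close>

lemma nxt_strip:
  assumes st: "\<And>w. p < w \<Longrightarrow> w < q \<Longrightarrow> w \<notin> vh" and u: "p < u" "u < q" "p < u'" "u' < q" and n: "nxt k u j"
  shows "nxt k u' j"
  unfolding nxt_def
proof (intro conjI allI impI)
  show "spn k u'" "spn j u'" "f k u' < f j u'"
    using n spn_strip[OF st u] order_strip[OF st u] by (auto simp: nxt_def)
  fix m assume m: "spn m u'"
  show "\<not> (f k u' < f m u' \<and> f m u' < f j u')"
  proof
    assume a: "f k u' < f m u' \<and> f m u' < f j u'"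
    have sp: "spn m u" "spn k u" "spn j u" using spn_strip[OF st u(3,4,1,2) m] n by (auto simp: nxt_def)
    have "f k u < f m u" "f m u < f j u"
      using order_strip[OF st u(3,4,1,2)] a m \<open>spn k u'\<close> \<open>spn j u'\<close> by auto
    then show False using n sp by (auto simp: nxt_def)
  qed
qed

end

section \<open>One-sided chords of a polygon\<close>

definition side :: "real \<Rightarrow> bool" where "side s \<longleftrightarrow> s = 1 \<or> s = -1"

lemma side_minus [simp]: "side (- s) \<longleftrightarrow> side s" by (auto simp: side_def)

lemma side_1 [simp]: "side 1" and side_m1 [simp]: "side (-1)" by (auto simp: side_def)

context dir_polygon begin

text \<open>The germ \<open>(k, t, s)\<close> stands for the points of edge \<open>k\<close> at heights \<open>t + s h\<close> with \<open>h > 0\<close> small.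
  Almost all heights avoid the vertices, so a germ always has a next edge (\<open>gn\<close>), even if the ray from
  its base point runs into a vertex. Likewise \<open>thru\<close> gives the ends of the chords just beside a point.\<close>

definition germ_on :: "nat \<Rightarrow> real \<Rightarrow> real \<Rightarrow> bool" where
  "germ_on k t s \<longleftrightarrow> k < N \<and> (s = 1 \<and> lo k \<le> t \<and> t < hi k \<or> s = -1 \<and> lo k < t \<and> t \<le> hi k)"

definition gn :: "nat \<Rightarrow> real \<Rightarrow> real \<Rightarrow> nat \<Rightarrow> bool" where
  "gn k t s j \<longleftrightarrow> (\<forall>\<^sub>F h in at_right 0. nxt k (t + s * h) j)"

definition thru :: "real \<Rightarrow> real \<Rightarrow> real \<Rightarrow> nat \<Rightarrow> nat \<Rightarrow> bool" where
  "thru x t s k j \<longleftrightarrow>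
     (\<forall>\<^sub>F h in at_right 0. nxt k (t + s * h) j \<and> f k (t + s * h) < x \<and> x < f j (t + s * h))"

lemma ev_small: "0 < c \<Longrightarrow> \<forall>\<^sub>F h in at_right (0::real). 0 < h \<and> h < c"
  unfolding eventually_at_right_field by auto

lemma ev_iff: "(\<forall>\<^sub>F h in at_right (0::real). Q h) \<longleftrightarrow> (\<exists>e>0. \<forall>h. 0 < h \<and> h < e \<longrightarrow> Q h)"
  unfolding eventually_at_right_field by auto

lemma ev_ex: "(\<forall>\<^sub>F h in at_right (0::real). Q h) \<Longrightarrow> \<exists>h>0. Q h"
  unfolding ev_iff by (meson field_lbound_gt_zero)

lemma tendsto_shift: "((\<lambda>h. t + s * h) \<longlongrightarrow> t) (at_right (0::real))"
  by (auto intro!: tendsto_eq_intros)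

lemma ev_less: "a < t \<Longrightarrow> \<forall>\<^sub>F h in at_right 0. a < t + s * h" and ev_greater: "t < a \<Longrightarrow> \<forall>\<^sub>F h in at_right 0. t + s * h < a"
  for a t s :: real
  using order_tendstoD[OF tendsto_shift] by auto

lemma ev_f_less: "f k t < f j t \<Longrightarrow> \<forall>\<^sub>F h in at_right 0. f k (t + s * h) < f j (t + s * h)"
proof -
  assume l: "f k t < f j t"
  have "((\<lambda>h. f j (t + s * h) - f k (t + s * h)) \<longlongrightarrow> f j t - f k t) (at_right 0)"
    by (intro tendsto_diff tendsto_f tendsto_shift)
  then have "\<forall>\<^sub>F h in at_right 0. 0 < f j (t + s * h) - f k (t + s * h)"
    by (rule order_tendstoD) (use l in simp)
  then show ?thesis by eventually_elim simp
qed

lemma ev_f_gr: "x < f j t \<Longrightarrow> \<forall>\<^sub>F h in at_right 0. x < f j (t + s * h)"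
  and ev_f_ls: "f j t < x \<Longrightarrow> \<forall>\<^sub>F h in at_right 0. f j (t + s * h) < x"
  by (auto intro!: order_tendstoD[OF tendsto_f[OF tendsto_shift]])

lemma ev_spn: "spn k t \<Longrightarrow> \<forall>\<^sub>F h in at_right 0. spn k (t + s * h)"
  unfolding spn_def using ev_less[of "lo k" t s] ev_greater[of t "hi k" s]
  by (auto elim: eventually_elim2)

lemma generic_side:
  assumes "side s"
  obtains e where "e > 0" "\<And>h. 0 < h \<Longrightarrow> h < e \<Longrightarrow> t + s * h \<notin> vh"
proof -
  obtain e where e: "e > 0" "\<forall>x\<in>vh. x \<noteq> t \<longrightarrow> e \<le> dist t x" using finite_set_avoid[OF finite_vh] by blast
  have "t + s * h \<notin> vh" if "0 < h" "h < e" for h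
    using e(2)[rule_format, of "t + s * h"] that assms by (auto simp: side_def dist_real_def)
  then show ?thesis using that e by blast
qed

lemma ev_generic: "side s \<Longrightarrow> \<forall>\<^sub>F h in at_right 0. t + s * h \<notin> vh"
  by (rule generic_side[of s t]) (auto simp: ev_iff)

lemma nxt_side:
  assumes s: "side s" and e: "\<And>h. 0 < h \<Longrightarrow> h < e \<Longrightarrow> t + s * h \<notin> vh"
    and h: "0 < h" "h < e" "0 < h'" "h' < e" and n: "nxt k (t + s * h) j"
  shows "nxt k (t + s * h') j"
proof -
  consider "s = 1" | "s = -1" using s by (auto simp: side_def)
  then show ?thesis
  proof cases
    case 1
    show ?thesis by (rule nxt_strip[of t "t + e" "t + s * h"]) (use e[of "w - t" for w] 1 h n in auto)
  next
    case 2
    show ?thesis by (rule nxt_strip[of "t - e" t "t + s * h"]) (use e[of "t - w" for w] 2 h n in auto)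
  qed
qed

lemma gnI:
  assumes s: "side s" and e: "\<And>h. 0 < h \<Longrightarrow> h < e \<Longrightarrow> t + s * h \<notin> vh"
    and h: "0 < h" "h < e" and n: "nxt k (t + s * h) j"
  shows "gn k t s j"
  unfolding gn_def ev_iff using nxt_side[OF s e h _ _ n] h by (intro exI[of _ e]) auto

lemma gn_unique: "gn k t s j \<Longrightarrow> gn k t s j' \<Longrightarrow> j = j'"
  and gn_unique': "gn k t s j \<Longrightarrow> gn k' t s j \<Longrightarrow> k = k'"
proof -
  show "j = j'" if "gn k t s j" "gn k t s j'"
    using ev_ex[OF eventually_conj[OF that[unfolded gn_def]]] nxt_unique by blast
  show "k = k'" if "gn k t s j" "gn k' t s j"
    using ev_ex[OF eventually_conj[OF that[unfolded gn_def]]] nxt_unique' by blast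
qed

lemma germ_on_ev: "side s \<Longrightarrow> germ_on k t s \<longleftrightarrow> (\<forall>\<^sub>F h in at_right 0. spn k (t + s * h))"
proof
  assume s: "side s" and g: "germ_on k t s"
  show "\<forall>\<^sub>F h in at_right 0. spn k (t + s * h)"
  proof (cases "s = 1")
    case True
    then have "0 < hi k - t" using g by (auto simp: germ_on_def)
    from ev_small[OF this] show ?thesis by eventually_elim (use g True in \<open>auto simp: germ_on_def spn_def\<close>)
  next
    case False
    then have "0 < t - lo k" using g by (auto simp: germ_on_def)
    from ev_small[OF this] show ?thesis by eventually_elim (use g False in \<open>auto simp: germ_on_def spn_def\<close>)
  qed
next
  assume s: "side s" and g: "\<forall>\<^sub>F h in at_right 0. spn k (t + s * h)"
  have "\<not> t < lo k"
  proof
    assume "t < lo k"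
    from ev_ex[OF eventually_conj[OF g ev_greater[OF this, of s]]] show False by (auto simp: spn_def)
  qed
  moreover have "\<not> hi k < t"
  proof
    assume "hi k < t"
    from ev_ex[OF eventually_conj[OF g ev_less[OF this, of s]]] show False by (auto simp: spn_def)
  qed
  moreover obtain h where "h > 0" "spn k (t + s * h)" using ev_ex[OF g] by blast
  ultimately show "germ_on k t s" using s by (auto simp: germ_on_def spn_def side_def)
qed

lemma gn_germ: "side s \<Longrightarrow> gn k t s j \<Longrightarrow> germ_on k t s \<and> germ_on j t s"
  unfolding germ_on_ev gn_def by (auto simp: nxt_def eventually_conj_iff)

lemma germ_range: "germ_on k t s \<Longrightarrow> k < N \<and> lo k \<le> t \<and> t \<le> hi k"
  by (auto simp: germ_on_def)

lemma germ_bdry: "germ_on k t s \<Longrightarrow> P (f k t) t \<in> bdry"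
  using germ_range bdry_iff by blast

lemma f_le_limit:
  assumes "\<forall>\<^sub>F h in at_right 0. f k (t + s * h) < f j (t + s * h)"
  shows "f k t \<le> f j t"
  by (rule tendsto_le[OF _ tendsto_f[OF tendsto_shift[of t s]] tendsto_f[OF tendsto_shift[of t s]]])
     (use assms in \<open>auto elim: eventually_mono\<close>)

lemma gn_le: "gn k t s j \<Longrightarrow> f k t \<le> f j t"
  by (rule f_le_limit[where s=s]) (auto simp: gn_def nxt_def eventually_conj_iff)

text \<open>If both edges pass through the same base point, their order at the heights
  \<open>t + s * h\<close> can only come from the slopes. This is what orients the turning of an
  orbit around a vertex.\<close>

lemma gn_slope: assumes "gn k t s j" "f k t = f j t" shows "s * esl d vs k < s * esl d vs j"
proof -
  obtain h where h: "h > 0" "nxt k (t + s * h) j" using assms ev_ex unfolding gn_def by blast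
  then have "f k (t + s * h) < f j (t + s * h)" by (simp add: nxt_def)
  then have "h * (s * esl d vs k) < h * (s * esl d vs j)"
    using f_affine[of k "t + s * h" t] f_affine[of j "t + s * h" t] assms(2) by (simp add: algebra_simps)
  then show ?thesis using h by simp
qed

lemma gn_ne: "gn k t s j \<Longrightarrow> k \<noteq> j"
  unfolding gn_def nxt_def by (auto dest!: ev_ex)

lemma entering_gn:
  assumes s: "side s" and g: "germ_on k t s" and k: "entering k"
  obtains j where "gn k t s j" "\<not> entering j"
proof -
  obtain e where e: "e > 0" "\<And>h. 0 < h \<Longrightarrow> h < e \<Longrightarrow> t + s * h \<notin> vh" using generic_side[OF s] by blast
  obtain h where h: "0 < h" "h < e" "spn k (t + s * h)"
    using ev_ex[OF eventually_conj[OF ev_small[OF e(1)] g[unfolded germ_on_ev[OF s]]]] by blast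
  obtain j where "nxt k (t + s * h) j" "\<not> entering j"
    by (rule entering_nxt[OF h(3) k e(2)[OF h(1,2)]])
  then show ?thesis using that gnI[OF s e(2) h(1,2)] by blast
qed

lemma leaving_gn:
  assumes s: "side s" and g: "germ_on j t s" and j: "\<not> entering j"
  obtains k where "gn k t s j" "entering k"
proof -
  obtain e where e: "e > 0" "\<And>h. 0 < h \<Longrightarrow> h < e \<Longrightarrow> t + s * h \<notin> vh" using generic_side[OF s] by blast
  obtain h where h: "0 < h" "h < e" "spn j (t + s * h)"
    using ev_ex[OF eventually_conj[OF ev_small[OF e(1)] g[unfolded germ_on_ev[OF s]]]] by blast
  obtain k where "nxt k (t + s * h) j" "entering k"
    by (rule leaving_nxt[OF h(3) j e(2)[OF h(1,2)]])
  then show ?thesis using that gnI[OF s e(2) h(1,2)] by blast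
qed

lemma nxt_chord_R:
  assumes "nxt k u j" "entering k" "u \<notin> vh" "f k u < y" "y < f j u" shows "P y u \<in> R"
proof -
  have "spn k u" using assms(1) by (simp add: nxt_def)
  then obtain j' where "nxt k u j'" "\<And>y. f k u < y \<Longrightarrow> y < f j' u \<Longrightarrow> P y u \<in> R"
    using assms(2,3) by (rule entering_nxt) blast
  then show ?thesis using nxt_unique assms by blast
qed

text \<open>At height \<open>t\<close> itself the chord may run through vertices. It is the limit of
  the chords at generic heights beside it, taken at a fixed proportion \<open>l\<close>, and
  \<open>F\<close> is closed.\<close>

lemma gn_chord:
  assumes s: "side s" and g: "gn k t s j" and k: "entering k" and x: "f k t \<le> x" "x \<le> f j t"
  shows "P x t \<in> F"
proof -
  obtain l where l: "0 \<le> l" "l \<le> 1" "x = (1 - l) * f k t + l * f j t"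
  proof (cases "f k t = f j t")
    case True then show ?thesis using that[of 0] x by auto
  next
    case False
    define l where "l = (x - f k t) / (f j t - f k t)"
    have "l * (f j t - f k t) = x - f k t" "0 \<le> l" "l \<le> 1" using False x by (auto simp: l_def divide_simps)
    then show ?thesis using that[of l] by (simp add: algebra_simps)
  qed
  let ?g = "\<lambda>h. P ((1 - l) * f k (t + s * h) + l * f j (t + s * h)) (t + s * h)"
  have "(?g \<longlongrightarrow> P ((1 - l) * f k t + l * f j t) t) (at_right 0)"
    by (intro tendsto_pnt tendsto_add tendsto_mult tendsto_const tendsto_f tendsto_shift)
  moreover have "\<forall>\<^sub>F h in at_right 0. ?g h \<in> F"
    using g[unfolded gn_def] ev_generic[OF s, of t]
  proof eventually_elim
    case (elim h)
    let ?u = "t + s * h"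
    have fl: "f k ?u < f j ?u" using elim by (simp add: nxt_def)
    consider "l = 0" | "l = 1" | "0 < l" "l < 1" using l by linarith
    then show ?case
    proof cases
      case 3
      have "0 < l * (f j ?u - f k ?u)" "l * (f j ?u - f k ?u) < 1 * (f j ?u - f k ?u)"
        using 3 fl by (auto intro: mult_strict_right_mono)
      then have "f k ?u < (1 - l) * f k ?u + l * f j ?u" "(1 - l) * f k ?u + l * f j ?u < f j ?u"
        by (simp_all add: algebra_simps)
      then show ?thesis using nxt_chord_R[of k ?u j] elim k by (auto simp: F_eq)
    qed (use elim bdry_generic[of ?u] in \<open>auto simp: F_eq nxt_def\<close>)
  qed
  ultimately have "P ((1 - l) * f k t + l * f j t) t \<in> F"
    using Lim_in_closed_set[OF closed_F, of ?g "at_right 0"] by simp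
  then show ?thesis using l(3) by simp
qed

lemma no_vertex_spn:
  assumes "k < N" "lo k \<le> t" "t \<le> hi k" "P (f k t) t \<notin> set vs" shows "spn k t"
  using end_vertex[of k t] assms unfolding spn_def by blast

text \<open>Only a vertex can separate the two germs at \<open>t\<close>: an edge that got between
  \<open>k\<close> and \<open>j\<close> on the other side would in the limit touch the closed chord,
  so without a vertex it would span \<open>t\<close> there and hence be \<open>k\<close> or
  \<open>j\<close>.\<close>

lemma no_vertex_nxt:
  assumes s: "side s" and g: "gn k t s j" and nv: "\<And>y. f k t \<le> y \<Longrightarrow> y \<le> f j t \<Longrightarrow> P y t \<notin> set vs"
  shows "spn k t" "spn j t" "f k t < f j t" "nxt k t j" "gn k t (- s) j"
proof -
  have r: "k < N" "lo k \<le> t" "t \<le> hi k" "j < N" "lo j \<le> t" "t \<le> hi j"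
    using gn_germ[OF s g] germ_range by auto
  have le: "f k t \<le> f j t" using gn_le[OF g] .
  show sk: "spn k t" and sj: "spn j t" using no_vertex_spn r nv le by auto
  show less: "f k t < f j t" using le spn_inj[OF sk sj] gn_ne[OF g] by fastforce
  show nx: "nxt k t j" unfolding nxt_def
  proof (intro conjI allI impI notI sk sj less)
    fix m assume m: "spn m t" "f k t < f m t \<and> f m t < f j t"
    have "\<forall>\<^sub>F h in at_right 0. nxt k (t + s * h) j \<and> spn m (t + s * h) \<and> f k (t + s * h) < f m (t + s * h) \<and> f m (t + s * h) < f j (t + s * h)"
      using g ev_spn[OF m(1)] ev_f_less m(2) unfolding gn_def by (intro eventually_conj) auto
    from ev_ex[OF this] show False by (auto simp: nxt_def)
  qed
  have m: "\<forall>\<^sub>F h in at_right 0. \<not> (spn m (t + - s * h) \<and> f k (t + - s * h) < f m (t + - s * h) \<and> f m (t + - s * h) < f j (t + - s * h))"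
    if mN: "m < N" for m
  proof -
    consider "t < lo m" | "hi m < t" | "f m t < f k t" | "f j t < f m t" | "lo m \<le> t" "t \<le> hi m" "f k t \<le> f m t" "f m t \<le> f j t"
      by linarith
    then show ?thesis
    proof cases
      case 1 from ev_greater[OF this, of "- s"] show ?thesis by eventually_elim (auto simp: spn_def)
    next
      case 2 from ev_less[OF this, of "- s"] show ?thesis by eventually_elim (auto simp: spn_def)
    next
      case 3 from ev_f_less[OF this, of "- s"] show ?thesis by eventually_elim auto
    next
      case 4 from ev_f_less[OF this, of "- s"] show ?thesis by eventually_elim auto
    next
      case 5
      then have sm: "spn m t" using no_vertex_spn mN nv by auto
      then have "f m t = f k t \<or> f m t = f j t" using nx 5 by (auto simp: nxt_def)
      then have "m = k \<or> m = j" using spn_inj sm sk sj by auto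
      then show ?thesis by auto
    qed
  qed
  have "\<forall>\<^sub>F h in at_right 0. \<forall>m\<in>{..<N}. \<not> (spn m (t + - s * h) \<and> f k (t + - s * h) < f m (t + - s * h) \<and> f m (t + - s * h) < f j (t + - s * h))"
    using m by (intro eventually_ball_finite) auto
  then show "gn k t (- s) j"
    unfolding gn_def using ev_spn[OF sk, of "- s"] ev_spn[OF sj, of "- s"] ev_f_less[OF less, of "- s"]
    by eventually_elim (auto simp: nxt_def spn_def)
qed

section \<open>One-sided chords through an interior point\<close>

lemma thru_gn: "thru x t s k j \<Longrightarrow> gn k t s j"
  unfolding thru_def gn_def by (auto simp: eventually_conj_iff)

lemma thru_le: "thru x t s k j \<Longrightarrow> f k t \<le> x \<and> x \<le> f j t"
proof -
  assume th: "thru x t s k j"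
  have "f k t \<le> x"
    by (rule tendsto_upperbound[OF tendsto_f[OF tendsto_shift[of t s]]])
       (use th in \<open>auto simp: thru_def elim: eventually_mono\<close>)
  moreover have "x \<le> f j t"
    by (rule tendsto_lowerbound[OF tendsto_f[OF tendsto_shift[of t s]]])
       (use th in \<open>auto simp: thru_def elim: eventually_mono\<close>)
  ultimately show ?thesis ..
qed

lemma thru_less: "side s \<Longrightarrow> thru x t s k j \<Longrightarrow> P x t \<in> R \<Longrightarrow> f k t < x \<and> x < f j t"
proof -
  assume a: "side s" "thru x t s k j" "P x t \<in> R"
  have "P (f k t) t \<in> bdry" "P (f j t) t \<in> bdry" using gn_germ[OF a(1) thru_gn[OF a(2)]] germ_bdry by auto
  then have "f k t \<noteq> x" "f j t \<noteq> x" using a(3) inside_no_overlap[of bdry] by blast+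
  then show ?thesis using thru_le[OF a(2)] by auto
qed

lemma thru_unique: "thru x t s k j \<Longrightarrow> thru x t s k' j' \<Longrightarrow> k = k' \<and> j = j'"
proof -
  assume "thru x t s k j" "thru x t s k' j'"
  then have "\<forall>\<^sub>F h in at_right 0. (nxt k (t + s * h) j \<and> f k (t + s * h) < x \<and> x < f j (t + s * h)) \<and>
    (nxt k' (t + s * h) j' \<and> f k' (t + s * h) < x \<and> x < f j' (t + s * h))"
    unfolding thru_def by (rule eventually_conj)
  from ev_ex[OF this] show ?thesis using nxt_between by blast
qed

lemma R_box:
  assumes "P x t \<in> R"
  obtains e where "e > 0" "\<And>x' t'. \<bar>x' - x\<bar> < e \<Longrightarrow> \<bar>t' - t\<bar> < e \<Longrightarrow> P x' t' \<in> R"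
proof -
  have "open R" using jordan by blast
  then obtain e where e: "e > 0" "ball (P x t) e \<subseteq> R" using assms open_contains_ball by blast
  have "P x' t' \<in> R" if "\<bar>x' - x\<bar> < e/2" "\<bar>t' - t\<bar> < e/2" for x' t'
  proof -
    have "dist (P x t) (P x' t') < e" using dist_pnt[of x t x' t'] that by linarith
    then show ?thesis using e(2) by auto
  qed
  then show ?thesis using that[of "e/2"] e by auto
qed

text \<open>The points with coordinate \<open>x\<close> at nearby heights stay in \<open>R\<close>,
  hence off the boundary. So the two ends of the chord found at one height stay on their sides of
  \<open>x\<close> at all of these heights.\<close>

lemma thru_exists:
  assumes s: "side s" and z: "P x t \<in> R"
  obtains k j where "thru x t s k j" "entering k" "\<not> entering j"
proof -
  obtain e1 where e1: "e1 > 0" "\<And>x' t'. \<bar>x' - x\<bar> < e1 \<Longrightarrow> \<bar>t' - t\<bar> < e1 \<Longrightarrow> P x' t' \<in> R"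
    using R_box[OF z] by blast
  obtain e2 where e2: "e2 > 0" "\<And>h. 0 < h \<Longrightarrow> h < e2 \<Longrightarrow> t + s * h \<notin> vh" using generic_side[OF s] by blast
  define e where "e = min e1 e2"
  have e: "e > 0" "\<And>h. 0 < h \<Longrightarrow> h < e \<Longrightarrow> t + s * h \<notin> vh" "\<And>h. 0 < h \<Longrightarrow> h < e \<Longrightarrow> P x (t + s * h) \<in> R"
    using e1 e2 s by (auto simp: e_def side_def)
  define h0 where "h0 = e / 2"
  have h0: "0 < h0" "h0 < e" using e by (auto simp: h0_def)
  obtain k j where kj: "nxt k (t + s * h0) j" "entering k" "\<not> entering j" "f k (t + s * h0) < x" "x < f j (t + s * h0)"
    using generic_chord[OF e(3)[OF h0] e(2)[OF h0]] by metis
  have nx: "nxt k (t + s * h) j" if "0 < h" "h < e" for h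
    using nxt_side[OF s e(2) h0 that kj(1)] .
  have nb: "f m (t + s * h) \<noteq> x" if "0 < h" "h < e" "spn m (t + s * h)" for h m
    using bdry_generic[OF e(2)[OF that(1,2)], of x] e(3)[OF that(1,2)] that(3) inside_no_overlap[of bdry] by blast
  have ck: "continuous_on {0<..<e} (\<lambda>h. x - f k (t + s * h))" "continuous_on {0<..<e} (\<lambda>h. f j (t + s * h) - x)"
    unfolding ef_def by (auto intro!: continuous_intros)
  have nz1: "x - f k (t + s * h) \<noteq> 0" if "0 < h" "h < e" for h using nb[OF that, of k] nx[OF that] unfolding nxt_def by auto
  have nz2: "f j (t + s * h) - x \<noteq> 0" if "0 < h" "h < e" for h using nb[OF that, of j] nx[OF that] unfolding nxt_def by auto
  have l1: "0 < x - f k (t + s * h)" if "0 < h" "h < e" for h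
    using nonzero_same_sign[OF ck(1) nz1 h0 that] kj by auto
  have l2: "0 < f j (t + s * h) - x" if "0 < h" "h < e" for h
    using nonzero_same_sign[OF ck(2) nz2 h0 that] kj by auto
  have "thru x t s k j" unfolding thru_def ev_iff using e(1) nx l1 l2 by (intro exI[of _ e]) auto
  then show ?thesis using that kj by blast
qed

text \<open>If the two one-sided chords began at different edges, the one nearer to \<open>x\<close>
  at height \<open>t\<close> would cross that height away from its ends, as no vertex lies there,
  and would thus cut the other chord as well.\<close>

lemma thru_backward:
  assumes s: "side s" and z: "P x t \<in> R" and th: "thru x t s k j" and th': "thru x t (- s) k' j'"
    and nv: "\<And>y. f k t \<le> y \<Longrightarrow> y \<le> x \<Longrightarrow> P y t \<notin> set vs"
  shows "k' = k"
proof -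
  have s': "side (- s)" using s by simp
  have r: "k < N" "lo k \<le> t" "t \<le> hi k" "k' < N" "lo k' \<le> t" "t \<le> hi k'"
    using gn_germ[OF s thru_gn[OF th]] gn_germ[OF s' thru_gn[OF th']] germ_range by auto
  have l: "f k t < x" "f k' t < x" using thru_less[OF s th z] thru_less[OF s' th' z] by auto
  have sk: "spn k t" using no_vertex_spn r nv l by auto
  have 1: "\<not> f k t < f k' t"
  proof
    assume a: "f k t < f k' t"
    then have "spn k' t" using no_vertex_spn r nv l by auto
    from eventually_conj[OF ev_spn[OF this, of s] eventually_conj[OF ev_f_less[OF a, of s] eventually_conj[OF ev_f_ls[OF l(2), of s] th[unfolded thru_def]]]]
    show False by (auto dest!: ev_ex simp: nxt_def)
  qed
  have 2: "\<not> f k' t < f k t"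
  proof
    assume a: "f k' t < f k t"
    from eventually_conj[OF ev_spn[OF sk, of "- s"] eventually_conj[OF ev_f_less[OF a, of "- s"] eventually_conj[OF ev_f_ls[OF l(1), of "- s"] th'[unfolded thru_def]]]]
    show False by (auto dest!: ev_ex simp: nxt_def)
  qed
  show ?thesis using edges_disjoint[of k' k t] r sk 1 2 by (force simp: spn_def)
qed

lemma thru_forward:
  assumes s: "side s" and z: "P x t \<in> R" and th: "thru x t s k j" and th': "thru x t (- s) k' j'"
    and nv: "\<And>y. x \<le> y \<Longrightarrow> y \<le> f j t \<Longrightarrow> P y t \<notin> set vs"
  shows "j' = j"
proof -
  have s': "side (- s)" using s by simp
  have r: "j < N" "lo j \<le> t" "t \<le> hi j" "j' < N" "lo j' \<le> t" "t \<le> hi j'"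
    using gn_germ[OF s thru_gn[OF th]] gn_germ[OF s' thru_gn[OF th']] germ_range by auto
  have l: "x < f j t" "x < f j' t" using thru_less[OF s th z] thru_less[OF s' th' z] by auto
  have sj: "spn j t" using no_vertex_spn r nv l by auto
  have 1: "\<not> f j' t < f j t"
  proof
    assume a: "f j' t < f j t"
    then have "spn j' t" using no_vertex_spn r nv l by auto
    from eventually_conj[OF ev_spn[OF this, of s] eventually_conj[OF ev_f_less[OF a, of s] eventually_conj[OF ev_f_gr[OF l(2), of s] th[unfolded thru_def]]]]
    show False by (auto dest!: ev_ex simp: nxt_def)
  qed
  have 2: "\<not> f j t < f j' t"
  proof
    assume a: "f j t < f j' t"
    from eventually_conj[OF ev_spn[OF sj, of "- s"] eventually_conj[OF ev_f_less[OF a, of "- s"] eventually_conj[OF ev_f_gr[OF l(1), of "- s"] th'[unfolded thru_def]]]]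
    show False by (auto dest!: ev_ex simp: nxt_def)
  qed
  show ?thesis using edges_disjoint[of j' j t] r sj 1 2 by (force simp: spn_def)
qed

text \<open>Around the point there is a box inside \<open>R\<close>. At a generic height within it
  the boundary cannot separate \<open>x'\<close> from \<open>x\<close>, so both lie on the same
  chord, and this is one of the two one-sided chords at \<open>t\<close>.\<close>

lemma thru_close:
  assumes z: "P x t \<in> R"
  obtains e where "e > 0"
    "\<And>x' t' s' k' j'. \<bar>x' - x\<bar> < e \<Longrightarrow> \<bar>t' - t\<bar> < e \<Longrightarrow> side s' \<Longrightarrow> thru x' t' s' k' j' \<Longrightarrow> \<exists>s. side s \<and> thru x t s k' j'"
proof -
  obtain e0 where e0: "e0 > 0" "\<And>x' t'. \<bar>x' - x\<bar> < e0 \<Longrightarrow> \<bar>t' - t\<bar> < e0 \<Longrightarrow> P x' t' \<in> R"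
    using R_box[OF z] by blast
  have "\<exists>k j e. e > 0 \<and> thru x t s k j \<and> (\<forall>h. 0 < h \<and> h < e \<longrightarrow> nxt k (t + s * h) j \<and> f k (t + s * h) < x \<and> x < f j (t + s * h))"
    if "side s" for s
  proof -
    obtain k j where th: "thru x t s k j" using thru_exists[OF \<open>side s\<close> z] by blast
    then show ?thesis unfolding thru_def ev_iff by blast
  qed
  then obtain k j e1 where 
    T: "\<And>s. side s \<Longrightarrow> e1 s > 0" "\<And>s. side s \<Longrightarrow> thru x t s (k s) (j s)"
     "\<And>s h. side s \<Longrightarrow> 0 < h \<Longrightarrow> h < e1 s \<Longrightarrow> nxt (k s) (t + s * h) (j s) \<and> f (k s) (t + s * h) < x \<and> x < f (j s) (t + s * h)"
    by metis
  define e where "e = min e0 (min (e1 1) (e1 (-1)))"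
  have e: "e > 0" "e \<le> e0" "\<And>s. side s \<Longrightarrow> e \<le> e1 s" using e0 T(1)[of 1] T(1)[of "-1"] by (auto simp: e_def side_def)
  show ?thesis
  proof (rule that[OF e(1)])
    fix x' t' s' k' j'
    assume a: "\<bar>x' - x\<bar> < e" "\<bar>t' - t\<bar> < e" "side s'" "thru x' t' s' k' j'"
    have "\<forall>\<^sub>F h in at_right 0. (t' + s' * h < t + e \<and> t - e < t' + s' * h) \<and> (t' + s' * h \<notin> vh \<and> t' + s' * h \<noteq> t) \<and>
       (nxt k' (t' + s' * h) j' \<and> f k' (t' + s' * h) < x' \<and> x' < f j' (t' + s' * h))"
    proof (intro eventually_conj a(4)[unfolded thru_def eventually_conj_iff, THEN conjunct1] ev_generic[OF a(3)])
      show "\<forall>\<^sub>F h in at_right 0. t' + s' * h < t + e" "\<forall>\<^sub>F h in at_right 0. t - e < t' + s' * h"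
        using a(2) by (auto intro!: ev_less ev_greater)
      show "\<forall>\<^sub>F h in at_right 0. t' + s' * h \<noteq> t"
      proof (cases "t' = t")
        case True
        from ev_small[OF zero_less_one] show ?thesis by eventually_elim (use True a(3) in \<open>auto simp: side_def\<close>)
      next
        case False
        then consider "t' < t" | "t < t'" by linarith
        then show ?thesis
        proof cases
          case 1 from ev_greater[OF this, of s'] show ?thesis by eventually_elim auto
        next
          case 2 from ev_less[OF this, of s'] show ?thesis by eventually_elim auto
        qed
      qed
    qed (use a(4) in \<open>auto simp: thru_def eventually_conj_iff\<close>)
    then obtain u where u: "u < t + e" "t - e < u" "u \<notin> vh" "u \<noteq> t" "nxt k' u j'" "f k' u < x'" "x' < f j' u"
      using ev_ex by blast
    define s where "s = (if t < u then 1 else -1 :: real)"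
    define h where "h = \<bar>u - t\<bar>"
    have sh: "side s" "0 < h" "h < e" "u = t + s * h" using u by (auto simp: s_def h_def side_def)
    have n: "nxt (k s) u (j s)" "f (k s) u < x" "x < f (j s) u"
      using T(3)[OF sh(1,2)] sh e(3)[OF sh(1)] by auto
    \<comment> \<open>At height \<open>u\<close> the boundary keeps distance \<open>e\<close> from
      \<open>x\<close>, so the inequalities that hold for \<open>x\<close> carry over to
      \<open>x'\<close>.\<close>
    have far: "\<bar>f m u - x\<bar> \<ge> e" if "spn m u" for m
    proof (rule ccontr)
      assume "\<not> ?thesis"
      then have "P (f m u) u \<in> R" using e0(2)[of "f m u" u] e u by auto
      then show False using bdry_generic[OF u(3)] that inside_no_overlap[of bdry] by blast
    qed
    have "spn (k s) u" "spn (j s) u" using n by (auto simp: nxt_def)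
    from far[OF this(1)] far[OF this(2)] have "f (k s) u < x'" "x' < f (j s) u" using n a(1) by auto
    then have "k' = k s \<and> j' = j s" using nxt_between[OF u(5) n(1) u(6,7)] by blast
    then show "\<exists>s. side s \<and> thru x t s k' j'" using T(2)[OF sh(1)] sh(1) by blast
  qed
qed

text \<open>The colour of an interior point is the colour of the chord through it; on a chord through a
  vertex the two one-sided chords still share an end, because only one end of it is obstructed.\<close>

lemma edge_colour_constant:
  assumes col: "\<And>k j u. u \<notin> vh \<Longrightarrow> nxt k u j \<Longrightarrow> entering k \<Longrightarrow> col k = col j"
    and ns: "\<And>x y t. x < y \<Longrightarrow> P x t \<in> set vs \<Longrightarrow> P y t \<in> set vs \<Longrightarrow> (\<And>w. x \<le> w \<Longrightarrow> w \<le> y \<Longrightarrow> P w t \<in> F) \<Longrightarrow> False"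
    and kj: "k < N" "j < N"
  shows "(col k :: bool) = col j"
proof -
  have gcol: "col k = col j" if "side s" "gn k t s j" "entering k" for k t s j
    using ev_ex[OF eventually_conj[OF that(2)[unfolded gn_def] ev_generic[OF that(1), of t]]] col that(3) by blast
  have ent: "entering k" if "side s" "thru x t s k j" "P x t \<in> R" for s x t k j
    using thru_exists[OF that(1,3)] thru_unique[OF that(2)] by metis
  have wd: "col k = col k'" if z: "P x t \<in> R" and th: "thru x t 1 k j" "thru x t (-1) k' j'" for x t k j k' j'
  proof -
    have s: "side 1" "side (-1)" by (auto simp: side_def)
    have e: "entering k" "entering k'" using ent s th z by blast+
    have l: "f k t < x" "x < f j t" using thru_less[OF s(1) th(1) z] by auto
    have "(\<forall>y. f k t \<le> y \<and> y \<le> x \<longrightarrow> P y t \<notin> set vs) \<or> (\<forall>y. x \<le> y \<and> y \<le> f j t \<longrightarrow> P y t \<notin> set vs)"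
    proof (rule ccontr)
      assume "\<not> ?thesis"
      then obtain y y' where y: "f k t \<le> y" "y \<le> x" "P y t \<in> set vs" "x \<le> y'" "y' \<le> f j t" "P y' t \<in> set vs"
        by blast
      have "P x t \<notin> set vs"
      proof
        assume "P x t \<in> set vs"
        then obtain k where "k < N" "P x t = A k" using vertex_iff by blast
        then have "P x t \<in> bdry" by (auto simp: bdry_eq)
        then show False using z inside_no_overlap[of bdry] by blast
      qed
      then have "y < y'" using y by (metis order.antisym le_less order.trans)
      then show False using ns[of y y' t] y gn_chord[OF s(1) thru_gn[OF th(1)] e(1)] by auto
    qed
    then show ?thesis
    proof
      assume "\<forall>y. f k t \<le> y \<and> y \<le> x \<longrightarrow> P y t \<notin> set vs"
      then show ?thesis using thru_backward[OF s(1) z th] by auto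
    next
      assume "\<forall>y. x \<le> y \<and> y \<le> f j t \<longrightarrow> P y t \<notin> set vs"
      then have "j' = j" using thru_forward[OF s(1) z th] by auto
      then show ?thesis using gcol[OF s(1) thru_gn[OF th(1)] e(1)] gcol[OF s(2) thru_gn[OF th(2)] e(2)] by simp
    qed
  qed
  \<comment> \<open>Reading the colour from side 1 is a convention; by \<open>wd\<close> the other
    side gives the same.\<close>
  define C where "C z \<longleftrightarrow> (\<exists>k j. thru (xco d z) (hgt d z) 1 k j \<and> col k)" for z
  have C: "C (P x t) = col k" if z: "P x t \<in> R" and s: "side s" and th: "thru x t s k j" for x t s k j
  proof -
    obtain k1 j1 where 1: "thru x t 1 k1 j1" using thru_exists[OF side_1 z] by blast
    obtain k2 j2 where 2: "thru x t (-1) k2 j2" using thru_exists[OF side_m1 z] by blast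
    have "C (P x t) = col k1" unfolding C_def hgt_pnt xco_pnt using thru_unique 1 by metis
    moreover have "col k1 = col k2" using wd[OF z 1 2] .
    moreover have "k = k1 \<or> k = k2" using s[unfolded side_def] th thru_unique 1 2 by metis
    ultimately show ?thesis by auto
  qed
  have const: "C z = C w" if "z \<in> R" "w \<in> R" for z w
  proof (rule connected_local_const[OF _ that])
    show "connected R" using jordan by blast
    show "\<forall>a\<in>R. \<forall>\<^sub>F b in at a within R. C a = C b"
    proof
      fix a assume a: "a \<in> R"
      let ?x = "xco d a" and ?t = "hgt d a"
      have z: "P ?x ?t \<in> R" using a by (simp add: pnt_coords)
      obtain e where e: "e > 0" "\<And>x' t' s' k' j'. \<bar>x' - ?x\<bar> < e \<Longrightarrow> \<bar>t' - ?t\<bar> < e \<Longrightarrow> side s' \<Longrightarrow> thru x' t' s' k' j' \<Longrightarrow> \<exists>s. side s \<and> thru ?x ?t s k' j'"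
        using thru_close[OF z] by blast
      have "C a = C b" if b: "b \<in> R" "dist b a < e" for b
      proof -
        let ?x' = "xco d b" and ?t' = "hgt d b"
        have z': "P ?x' ?t' \<in> R" using b by (simp add: pnt_coords)
        obtain k j where th: "thru ?x' ?t' 1 k j" using thru_exists[OF side_1 z'] by blast
        have "\<bar>?x' - ?x\<bar> < e" "\<bar>?t' - ?t\<bar> < e"
          using b(2) xco_le[of "b - a"] hgt_le[of "b - a"] by (auto simp: xco_diff hgt_diff dist_norm)
        then obtain s where s: "side s" "thru ?x ?t s k j" using e(2)[OF _ _ _ th] by (auto simp: side_def)
        have "C (P ?x ?t) = col k" using C[OF z s] .
        moreover have "C (P ?x' ?t') = col k" using C[OF z' _ th] by (auto simp: side_def)
        ultimately show ?thesis by (simp add: pnt_coords)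
      qed
      then show "\<forall>\<^sub>F b in at a within R. C a = C b" unfolding eventually_at using e(1) by blast
    qed
  qed
  have ex: "\<exists>z\<in>R. C z = col k" if k: "k < N" for k
  proof -
    \<comment> \<open>Any germ of edge \<open>k\<close> would serve, and the one at the lower end
      with side 1 exists for every edge. The midpoint of a generic chord beside it is an interior
      point with the colour of \<open>k\<close>.\<close>
    define t where "t = lo k"
    have g: "germ_on k t 1" using lo_less_hi[OF k] k by (auto simp: germ_on_def t_def)
    have s: "side 1" by (simp add: side_def)
    have "\<exists>k' j. gn k' t 1 j \<and> entering k' \<and> col k' = col k"
    proof (cases "entering k")
      case True
      then show ?thesis using entering_gn[OF s g] by metis
    next
      case False
      then obtain k' where "gn k' t 1 k" "entering k'" using leaving_gn[OF s g] by metis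
      then show ?thesis using gcol[OF s] by metis
    qed
    then obtain k' j where kj: "gn k' t 1 j" "entering k'" "col k' = col k" by blast
    obtain e where e: "e > 0" "\<And>h. 0 < h \<Longrightarrow> h < e \<Longrightarrow> t + 1 * h \<notin> vh \<and> nxt k' (t + 1 * h) j"
      using eventually_conj[OF ev_generic[OF s, of t] kj(1)[unfolded gn_def]] unfolding ev_iff by blast
    define u where "u = t + e / 2"
    have gen: "w \<notin> vh \<and> nxt k' w j" if "t < w" "w < t + e" for w using e(2)[of "w - t"] that by auto
    have u: "u \<notin> vh" "nxt k' u j" using gen[of u] e by (auto simp: u_def)
    define x where "x = (f k' u + f j u) / 2"
    have x: "f k' u < x" "x < f j u" using u by (auto simp: x_def nxt_def)
    have z: "P x u \<in> R" using nxt_chord_R[OF u(2) kj(2) u(1) x] .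
    have "thru x u 1 k' j" unfolding thru_def
    proof (intro eventually_conj)
      show "\<forall>\<^sub>F h in at_right 0. nxt k' (u + 1 * h) j"
        using ev_small[of "e/2"] e(1) by (auto elim!: eventually_mono intro!: gen[THEN conjunct2] simp: u_def)
    qed (use x in \<open>auto intro: ev_f_gr[of x j u 1, simplified] ev_f_ls[of k' u x 1, simplified]\<close>)
    then show ?thesis using C[OF z s] kj(3) z by metis
  qed
  show ?thesis using ex[OF kj(1)] ex[OF kj(2)] const by metis
qed

end

section \<open>Uniform hitting times for piecewise translations\<close>

locale intervals =
  fixes E :: "'e set" and lo hi :: "'e \<Rightarrow> real"
  assumes finE: "finite E" and lohi: "\<And>e. e \<in> E \<Longrightarrow> lo e < hi e"
begin

text \<open>A germ must point into its interval, hence the different conditions at the two ends. In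
  this way one-sided limits of germs are again germs.\<close>

definition valid :: "'e \<times> real \<times> real \<Rightarrow> bool" where
  "valid x \<longleftrightarrow> (case x of (e, t, s) \<Rightarrow> e \<in> E \<and> (s = 1 \<and> lo e \<le> t \<and> t < hi e \<or> s = -1 \<and> lo e < t \<and> t \<le> hi e))"

lemma valid_iff: "valid (e, t, s) \<longleftrightarrow> e \<in> E \<and> (s = 1 \<and> lo e \<le> t \<and> t < hi e \<or> s = -1 \<and> lo e < t \<and> t \<le> hi e)"
  by (simp add: valid_def)

lemma valid_side: "valid (e, t, s) \<Longrightarrow> side s" by (auto simp: valid_iff side_def)

lemma valid_interior: "e \<in> E \<Longrightarrow> lo e < t \<Longrightarrow> t < hi e \<Longrightarrow> side s \<Longrightarrow> valid (e, t, s)"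
  by (auto simp: valid_iff side_def)

end

text \<open>A piecewise translation in which a cut point may have two images, one for each side: by
  \<open>nx_const\<close> an interval whose interior avoids \<open>D\<close> moves as a whole, its
  ends being read from inside. The shift \<open>sh\<close> sees both edges because it will be
  attached to the target for the forward map and to the source for the inverse.\<close>

locale germ_map = intervals E lo hi for E :: "'e set" and lo hi +
  fixes nx :: "'e \<Rightarrow> real \<Rightarrow> real \<Rightarrow> 'e" and sh :: "'e \<Rightarrow> 'e \<Rightarrow> real" and D :: "('e \<times> real) set"
  assumes finD: "finite D"
    and nx_valid: "\<And>e t s. valid (e, t, s) \<Longrightarrow> valid (nx e t s, t + sh e (nx e t s), s)"
    and nx_const: "\<And>e p q. e \<in> E \<Longrightarrow> lo e \<le> p \<Longrightarrow> p < q \<Longrightarrow> q \<le> hi e \<Longrightarrow> (\<And>u. p < u \<Longrightarrow> u < q \<Longrightarrow> (e, u) \<notin> D) \<Longrightarrow>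
       \<exists>j. nx e p 1 = j \<and> nx e q (-1) = j \<and> (\<forall>u s. p < u \<and> u < q \<and> side s \<longrightarrow> nx e u s = j)"
begin

definition T :: "'e \<times> real \<times> real \<Rightarrow> 'e \<times> real \<times> real" where
  "T x = (case x of (e, t, s) \<Rightarrow> (nx e t s, t + sh e (nx e t s), s))"

lemma T_eq: "T (e, t, s) = (nx e t s, t + sh e (nx e t s), s)" by (simp add: T_def)

lemma T_valid: "valid x \<Longrightarrow> valid (T x)"
  using nx_valid by (cases x) (auto simp: T_eq)

lemma iter_valid: "valid x \<Longrightarrow> valid ((T ^^ k) x)"
  by (induction k) (auto intro: T_valid)

lemma iter_side: "snd (snd ((T ^^ k) x)) = snd (snd x)"
  by (induction k) (auto simp: T_def split: prod.splits)

lemma D_avoid: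
  obtains \<delta> where "\<delta> > 0" "\<And>u. u \<noteq> t \<Longrightarrow> \<bar>u - t\<bar> < \<delta> \<Longrightarrow> (e, u) \<notin> D"
proof -
  have "finite {u. (e, u) \<in> D}" using finite_imageI[OF finD, of snd] by (rule finite_subset[rotated]) force
  then obtain \<delta> where "\<delta> > 0" "\<forall>x\<in>{u. (e, u) \<in> D}. x \<noteq> t \<longrightarrow> \<delta> \<le> dist t x"
    using finite_set_avoid by blast
  then show ?thesis using that[of \<delta>] by (force simp: dist_real_def)
qed

lemma nx_side:
  assumes e: "e \<in> E" and s: "side s" and r: "lo e \<le> t" "t \<le> hi e" "lo e \<le> t + s * g" "t + s * g \<le> hi e" "0 < g"
    and D: "\<And>u. 0 < s * (u - t) \<Longrightarrow> s * (u - t) < g \<Longrightarrow> (e, u) \<notin> D"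
    and u: "0 < s * (u - t)" "s * (u - t) < g" "side s'"
  shows "nx e u s' = nx e t s"
proof -
  consider "s = 1" | "s = -1" using s by (auto simp: side_def)
  then show ?thesis
  proof cases
    case 1
    have "\<exists>j. nx e t 1 = j \<and> nx e (t + g) (-1) = j \<and> (\<forall>u s. t < u \<and> u < t + g \<and> side s \<longrightarrow> nx e u s = j)"
      by (rule nx_const) (use e r D 1 in auto)
    then show ?thesis using u 1 by auto
  next
    case 2
    have "\<exists>j. nx e (t - g) 1 = j \<and> nx e t (-1) = j \<and> (\<forall>u s. t - g < u \<and> u < t \<and> side s \<longrightarrow> nx e u s = j)"
      by (rule nx_const) (use e r D 2 in auto)
    then show ?thesis using u 2 by auto
  qed
qed

lemma nx_locally_constant:
  assumes v: "valid (e, t, s)"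
  obtains \<delta> where "\<delta> > 0"
    "\<And>u s'. 0 < s * (u - t) \<Longrightarrow> s * (u - t) < \<delta> \<Longrightarrow> side s' \<Longrightarrow> lo e < u \<and> u < hi e \<and> nx e u s' = nx e t s"
proof -
  obtain d1 where d1: "d1 > 0" "\<And>u. u \<noteq> t \<Longrightarrow> \<bar>u - t\<bar> < d1 \<Longrightarrow> (e, u) \<notin> D" using D_avoid by blast
  define g where "g = min d1 (if s = 1 then hi e - t else t - lo e)"
  have s: "side s" using valid_side[OF v] .
  have g: "g > 0" using d1 v by (auto simp: g_def valid_iff)
  have "lo e < u \<and> u < hi e \<and> nx e u s' = nx e t s"
    if u: "0 < s * (u - t)" "s * (u - t) < g" "side s'" for u s'
  proof
    show "lo e < u" using u v by (auto simp: g_def valid_iff)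
    have "nx e u s' = nx e t s"
    proof (rule nx_side[of e s t g])
      fix w assume "0 < s * (w - t)" "s * (w - t) < g"
      then show "(e, w) \<notin> D" using s by (intro d1(2)) (auto simp: g_def side_def)
    qed (use v s g u in \<open>auto simp: valid_iff g_def\<close>)
    then show "u < hi e \<and> nx e u s' = nx e t s" using u v by (auto simp: g_def valid_iff)
  qed
  then show ?thesis using that g by blast
qed

text \<open>The interval of constancy has to be shrunk at each step, so \<open>\<delta>\<close>
  depends on \<open>k\<close>. Neighbours are followed for both sides \<open>s'\<close>, since
  strictly inside this interval nothing separates the two germs of a height.\<close>

lemma iter_local:
  assumes v: "valid (e, t, s)"
  obtains \<delta> e' c where "\<delta> > 0" "(T ^^ k) (e, t, s) = (e', t + c, s)"
    "\<And>u s'. 0 < s * (u - t) \<Longrightarrow> s * (u - t) < \<delta> \<Longrightarrow> side s' \<Longrightarrow> valid (e, u, s') \<and> (T ^^ k) (e, u, s') = (e', u + c, s')"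
proof -
  have "\<exists>\<delta> e' c. \<delta> > 0 \<and> (T ^^ k) (e, t, s) = (e', t + c, s) \<and>
    (\<forall>u s'. 0 < s * (u - t) \<and> s * (u - t) < \<delta> \<and> side s' \<longrightarrow> valid (e, u, s') \<and> (T ^^ k) (e, u, s') = (e', u + c, s'))"
  proof (induction k)
    case 0
    obtain \<delta> where "\<delta> > 0" "\<And>u s'. 0 < s * (u - t) \<Longrightarrow> s * (u - t) < \<delta> \<Longrightarrow> side s' \<Longrightarrow> lo e < u \<and> u < hi e \<and> nx e u s' = nx e t s"
      using nx_locally_constant[OF v] by blast
    moreover have "e \<in> E" using v by (simp add: valid_iff)
    ultimately show ?case
      by (intro exI[of _ \<delta>] exI[of _ e] exI[of _ 0]) (auto intro!: valid_interior)
  next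
    case (Suc k)
    then obtain \<delta> e' c where 1: "\<delta> > 0" "(T ^^ k) (e, t, s) = (e', t + c, s)"
      "\<And>u s'. 0 < s * (u - t) \<Longrightarrow> s * (u - t) < \<delta> \<Longrightarrow> side s' \<Longrightarrow> valid (e, u, s') \<and> (T ^^ k) (e, u, s') = (e', u + c, s')" by blast
    have v': "valid (e', t + c, s)" using iter_valid[OF v, of k] 1 by simp
    obtain d2 where 2: "d2 > 0" "\<And>u s'. 0 < s * (u - (t + c)) \<Longrightarrow> s * (u - (t + c)) < d2 \<Longrightarrow> side s' \<Longrightarrow> lo e' < u \<and> u < hi e' \<and> nx e' u s' = nx e' (t + c) s"
      using nx_locally_constant[OF v'] by blast
    let ?j = "nx e' (t + c) s"
    show ?case
    proof (rule exI[of _ "min \<delta> d2"], rule exI[of _ ?j], rule exI[of _ "c + sh e' ?j"], intro conjI allI impI)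
      show "0 < min \<delta> d2" using 1 2 by simp
      show "(T ^^ Suc k) (e, t, s) = (?j, t + (c + sh e' ?j), s)" using 1 by (simp add: T_eq)
      fix u s' assume u: "0 < s * (u - t) \<and> s * (u - t) < min \<delta> d2 \<and> side s'"
      then show "valid (e, u, s')" using 1 by auto
      have "nx e' (u + c) s' = ?j" using 2(2)[of "u + c" s'] u by auto
      then show "(T ^^ Suc k) (e, u, s') = (?j, u + (c + sh e' ?j), s')" using 1(3)[of u s'] u by (simp add: T_eq)
    qed
  qed
  then show ?thesis using that by blast
qed

text \<open>By \<open>iter_local\<close> the iterate is a translation on one side of the germ, so a
  visit to an open interval persists there. This later makes the set of germs without visits
  closed.\<close>

lemma iter_open:
  assumes v: "valid (e, t, s)" and h: "(T ^^ k) (e, t, s) = (e0, w, s)" "a < w" "w < b"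
  obtains \<delta> where "\<delta> > 0" "\<And>u s'. 0 < s * (u - t) \<Longrightarrow> s * (u - t) < \<delta> \<Longrightarrow> side s' \<Longrightarrow>
     \<exists>w'. (T ^^ k) (e, u, s') = (e0, w', s') \<and> a < w' \<and> w' < b"
proof -
  obtain \<delta> e' c where 1: "\<delta> > 0" "(T ^^ k) (e, t, s) = (e', t + c, s)"
      "\<And>u s'. 0 < s * (u - t) \<Longrightarrow> s * (u - t) < \<delta> \<Longrightarrow> side s' \<Longrightarrow> valid (e, u, s') \<and> (T ^^ k) (e, u, s') = (e', u + c, s')"
    using iter_local[OF v] by metis
  have s: "side s" using valid_side[OF v] .
  show ?thesis
  proof (rule that[of "min \<delta> (min (w - a) (b - w))"])
    show "0 < min \<delta> (min (w - a) (b - w))" using 1 h by auto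
    fix u s' assume u: "0 < s * (u - t)" "s * (u - t) < min \<delta> (min (w - a) (b - w))" "side s'"
    have "e' = e0" "w = t + c" using 1(2) h by auto
    then show "\<exists>w'. (T ^^ k) (e, u, s') = (e0, w', s') \<and> a < w' \<and> w' < b"
      using 1(3)[of u s'] u s by (auto simp: side_def)
  qed
qed

text \<open>One-sided gaps of an invariant set are carried along a nonsingular orbit; disjoint gaps
  contain only finitely many discontinuities, so eventually they keep their length.\<close>

lemma gap_follow:
  fixes K :: "('e \<times> real \<times> real) set" and e :: 'e and q s :: real
  defines "x0 \<equiv> (e, q, s)"
  assumes inv: "\<And>x. valid x \<Longrightarrow> T x \<in> K \<longleftrightarrow> x \<in> K"
    and x0: "valid x0" "x0 \<in> K"
    and int: "\<And>k e t. (T ^^ k) x0 = (e, t, s) \<Longrightarrow> lo e < t \<and> t < hi e \<and> nx e t (- s) = nx e t s"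
    and \<sigma>: "side \<sigma>" and g: "0 < g"
    and gap: "\<And>u s'. 0 < \<sigma> * (u - q) \<Longrightarrow> \<sigma> * (u - q) < g \<Longrightarrow> side s' \<Longrightarrow> lo e < u \<and> u < hi e \<and> (e, u, s') \<notin> K"
  shows "\<exists>j k. j < k \<and> (T ^^ j) x0 = (T ^^ k) x0"
proof (rule ccontr)
  assume "\<not> ?thesis"
  then have inj: "(T ^^ j) x0 \<noteq> (T ^^ k) x0" if "j \<noteq> k" for j k
    using that by (metis linorder_neqE_nat)
  have s: "side s" using x0 valid_side unfolding x0_def by blast
  define ek where "ek k = fst ((T ^^ k) x0)" for k
  define qk where "qk k = fst (snd ((T ^^ k) x0))" for k
  have X: "(T ^^ k) x0 = (ek k, qk k, s)" for k
    using iter_side[of k x0] by (simp add: ek_def qk_def x0_def prod_eq_iff)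
  have XK: "(ek k, qk k, s) \<in> K" for k
  proof -
    have "(T ^^ k) x0 \<in> K" using x0 inv iter_valid by (induction k) auto
    then show ?thesis by (simp add: X)
  qed
  have V: "valid (ek k, qk k, s)" for k using iter_valid[OF x0(1), of k] X by simp
  have E: "ek k \<in> E" for k using V[of k] by (simp add: valid_iff)
  have I: "lo (ek k) < qk k" "qk k < hi (ek k)" "nx (ek k) (qk k) (- s) = nx (ek k) (qk k) s" for k
    using int[OF X] by auto
  have next_X: "ek (Suc k) = nx (ek k) (qk k) s" "qk (Suc k) = qk k + sh (ek k) (ek (Suc k))" for k
    using X[of "Suc k"] X[of k] by (auto simp: T_eq)
  define KF where "KF k h \<longleftrightarrow> (\<forall>u s'. 0 < \<sigma> * (u - qk k) \<and> \<sigma> * (u - qk k) < h \<and> side s' \<longrightarrow>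
      lo (ek k) < u \<and> u < hi (ek k) \<and> (ek k, u, s') \<notin> K)" for k h
  define DF where "DF k h \<longleftrightarrow> (\<forall>u. 0 < \<sigma> * (u - qk k) \<and> \<sigma> * (u - qk k) < h \<longrightarrow> (ek k, u) \<notin> D)" for k h
  have \<sigma>s: "\<sigma> = s \<or> \<sigma> = - s" using \<sigma> s by (auto simp: side_def)
  have step: "KF (Suc k) h" if h: "h > 0" and KF: "KF k h" and DF: "DF k h" for k h
    unfolding KF_def
  proof (intro allI impI; elim conjE)
    fix u s' assume u: "0 < \<sigma> * (u - qk (Suc k))" "\<sigma> * (u - qk (Suc k)) < h" "side s'"
    define c where "c = sh (ek k) (ek (Suc k))"
    define w where "w = u - c"
    have w: "0 < \<sigma> * (w - qk k)" "\<sigma> * (w - qk k) < h" using u next_X by (auto simp: w_def c_def algebra_simps)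
    \<comment> \<open>A gap that stuck out of the edge would contain the point \<open>v\<close>,
      which is an end of the edge or lies beyond it; this contradicts \<open>KF\<close>.\<close>
    have end_in: "lo (ek k) \<le> qk k + \<sigma> * h \<and> qk k + \<sigma> * h \<le> hi (ek k)"
    proof (rule ccontr)
      assume n: "\<not> ?thesis"
      define v where "v = (if \<sigma> = 1 then max (hi (ek k)) (qk k + h / 2) else min (lo (ek k)) (qk k - h / 2))"
      have "0 < \<sigma> * (v - qk k) \<and> \<sigma> * (v - qk k) < h" using n \<sigma> h I[of k] by (auto simp: v_def side_def max_def min_def)
      then have "lo (ek k) < v \<and> v < hi (ek k)" using KF u(3) unfolding KF_def by blast
      then show False by (auto simp: v_def split: if_splits)
    qed
    \<comment> \<open>The gap may lie on the side opposite to that of the germ itself; by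
      \<open>I(3)\<close> the same edge is reached from both sides.\<close>
    have nxs: "nx (ek k) w s'' = ek (Suc k)" if "side s''" for s''
    proof -
      have "nx (ek k) w s'' = nx (ek k) (qk k) \<sigma>"
        by (rule nx_side[of _ \<sigma> _ h]) (use E \<sigma> I[of k] end_in h DF w that in \<open>auto simp: DF_def\<close>)
      also have "\<dots> = ek (Suc k)" using next_X \<sigma>s I(3)[of k] by auto
      finally show ?thesis .
    qed
    have wi: "lo (ek k) < w" "w < hi (ek k)" "(ek k, w, s') \<notin> K" using KF w u(3) unfolding KF_def by blast+
    have TT: "T (ek k, w, s'') = (ek (Suc k), u, s'')" if "side s''" for s''
      using nxs[OF that] by (simp add: T_eq w_def c_def)
    have vv: "valid (ek k, w, s'')" if "side s''" for s'' using valid_interior[OF E wi(1,2) that] .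
    have "valid (ek (Suc k), u, 1)" "valid (ek (Suc k), u, -1)"
      using T_valid[OF vv[of 1]] T_valid[OF vv[of "-1"]] TT[of 1] TT[of "-1"] by simp_all
    moreover have "(ek (Suc k), u, s') \<notin> K" using inv[OF vv[OF u(3)]] TT[OF u(3)] wi by simp
    ultimately show "lo (ek (Suc k)) < u \<and> u < hi (ek (Suc k)) \<and> (ek (Suc k), u, s') \<notin> K"
      by (auto simp: valid_iff)
  qed
  have "\<exists>G. \<forall>k. (G k > 0 \<and> KF k (G k)) \<and> (DF k (G k) \<longrightarrow> G (Suc k) = G k)"
  proof (rule dependent_nat_choice[where P="\<lambda>k h. h > 0 \<and> KF k h" and Q="\<lambda>k h h'. DF k h \<longrightarrow> h' = h"])
    show "\<exists>h. h > 0 \<and> KF 0 h"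
      using g gap by (intro exI[of _ g]) (auto simp: KF_def ek_def qk_def x0_def)
    fix h k assume h: "h > 0 \<and> KF k h"
    show "\<exists>h'. (h' > 0 \<and> KF (Suc k) h') \<and> (DF k h \<longrightarrow> h' = h)"
    proof (cases "DF k h")
      case True
      then show ?thesis using step h by blast
    next
      case False
      obtain d1 where d1: "d1 > 0" "\<And>u. u \<noteq> qk k \<Longrightarrow> \<bar>u - qk k\<bar> < d1 \<Longrightarrow> (ek k, u) \<notin> D" using D_avoid by blast
      \<comment> \<open>A gap that contains a discontinuity is shortened to a part next to the base
        point that contains none. All other gaps keep their length.\<close>
      define h' where "h' = min h d1"
      have "h' > 0" using h d1 by (simp add: h'_def)
      moreover have "KF k h'" using h by (auto simp: KF_def h'_def)
      moreover have "DF k h'" unfolding DF_def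
      proof (intro allI impI)
        fix u assume "0 < \<sigma> * (u - qk k) \<and> \<sigma> * (u - qk k) < h'"
        then show "(ek k, u) \<notin> D" using \<sigma> by (intro d1(2)) (auto simp: h'_def side_def)
      qed
      ultimately show ?thesis using step False by blast
    qed
  qed
  then obtain G where G: "\<And>k. G k > 0" "\<And>k. KF k (G k)" "\<And>k. DF k (G k) \<Longrightarrow> G (Suc k) = G k" by blast
  have sep: "\<sigma> * (qk k - qk j) \<le> 0 \<or> G j \<le> \<sigma> * (qk k - qk j)" if "ek j = ek k" for j k
    using G(2)[of j] XK[of k] that s unfolding KF_def by (metis not_le)
  have ne: "qk j \<noteq> qk k" if "ek j = ek k" "j \<noteq> k" for j k using inj[OF that(2)] that(1) X by auto
  define Z where "Z = {k. \<not> DF k (G k)}"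
  have "\<forall>k\<in>Z. \<exists>u. 0 < \<sigma> * (u - qk k) \<and> \<sigma> * (u - qk k) < G k \<and> (ek k, u) \<in> D" by (auto simp: Z_def DF_def)
  then obtain U where U: "\<And>k. k \<in> Z \<Longrightarrow> 0 < \<sigma> * (U k - qk k) \<and> \<sigma> * (U k - qk k) < G k \<and> (ek k, U k) \<in> D" by metis
  \<comment> \<open>Gaps on one edge are disjoint, since their base points are distinct members of
    \<open>K\<close> and so none of them lies in another gap. Hence each discontinuity shortens at
    most one gap.\<close>
  have "inj_on (\<lambda>k. (ek k, U k)) Z"
  proof (rule inj_onI, rule ccontr)
    fix j k assume a: "j \<in> Z" "k \<in> Z" "(ek j, U j) = (ek k, U k)" "j \<noteq> k"
    have n: "\<sigma> * qk j \<noteq> \<sigma> * qk k" using ne[of j k] a \<sigma> by (auto simp: side_def)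
    have u: "\<sigma> * (U k - qk k) > 0" "\<sigma> * (U k - qk k) < G k" "\<sigma> * (U k - qk j) > 0" "\<sigma> * (U k - qk j) < G j"
      using U[OF a(1)] U[OF a(2)] a(3) by auto
    have "\<sigma> * qk k - \<sigma> * qk j \<le> 0 \<or> G j \<le> \<sigma> * qk k - \<sigma> * qk j" "\<sigma> * qk j - \<sigma> * qk k \<le> 0 \<or> G k \<le> \<sigma> * qk j - \<sigma> * qk k"
      using sep[of j k] sep[of k j] a(3) by (auto simp: right_diff_distrib)
    then show False using n u by (auto simp: right_diff_distrib)
  qed
  moreover have "(\<lambda>k. (ek k, U k)) ` Z \<subseteq> D" using U by auto
  ultimately have "finite Z" using finD finite_subset finite_imageD by blast
  then obtain k0 where k0: "\<And>k. k \<in> Z \<Longrightarrow> k < k0" using finite_nat_set_iff_bounded by auto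
  define \<gamma> where "\<gamma> = G k0"
  have G\<gamma>: "G (k0 + k) = \<gamma>" for k
  proof (induction k)
    case (Suc k)
    have "k0 + k \<notin> Z" using k0[of "k0 + k"] by auto
    then show ?case using G(3)[of "k0 + k"] Suc by (simp add: Z_def)
  qed (simp add: \<gamma>_def)
  have \<gamma>: "\<gamma> > 0" using G(1) by (simp add: \<gamma>_def)
  \<comment> \<open>From \<open>k0\<close> on all gaps have length \<open>\<gamma>\<close>, so base
    points on one edge are at least \<open>\<gamma>\<close> apart. They fall into different cells of
    a grid of that width, and there are only finitely many cells.\<close>
  let ?h = "\<lambda>k. (ek k, \<lfloor>qk k / \<gamma>\<rfloor>)"
  have "inj_on ?h {k0..}"
  proof (rule inj_onI, rule ccontr)
    fix j k assume a: "j \<in> {k0..}" "k \<in> {k0..}" "?h j = ?h k" "j \<noteq> k"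
    have Gs: "G j = \<gamma>" "G k = \<gamma>" using G\<gamma>[of "j - k0"] G\<gamma>[of "k - k0"] a by auto
    have ek: "ek j = ek k" and fl: "\<lfloor>qk j / \<gamma>\<rfloor> = \<lfloor>qk k / \<gamma>\<rfloor>" using a(3) by simp_all
    have "\<bar>qk j / \<gamma> - qk k / \<gamma>\<bar> < 1" using fl by linarith
    then have "\<bar>qk j - qk k\<bar> < \<gamma>" using \<gamma> by (simp add: abs_less_iff field_simps)
    moreover have "qk j \<noteq> qk k" using ne[OF ek a(4)] .
    moreover have "\<sigma> * (qk k - qk j) \<le> 0 \<or> \<gamma> \<le> \<sigma> * (qk k - qk j)" "\<sigma> * (qk j - qk k) \<le> 0 \<or> \<gamma> \<le> \<sigma> * (qk j - qk k)"
      using sep[OF ek] sep[OF ek[symmetric]] Gs by simp_all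
    ultimately show False using \<sigma> unfolding side_def by fastforce
  qed
  moreover have "?h ` {k0..} \<subseteq> (SIGMA e:E. {\<lfloor>lo e / \<gamma>\<rfloor>..\<lfloor>hi e / \<gamma>\<rfloor>})"
  proof (rule image_subsetI)
    fix k
    have "lo (ek k) / \<gamma> \<le> qk k / \<gamma>" "qk k / \<gamma> \<le> hi (ek k) / \<gamma>"
      using I[of k] \<gamma> by (simp_all add: divide_right_mono less_imp_le)
    then show "?h k \<in> (SIGMA e:E. {\<lfloor>lo e / \<gamma>\<rfloor>..\<lfloor>hi e / \<gamma>\<rfloor>})" using E[of k] by (simp add: floor_mono)
  qed
  moreover have "finite (SIGMA e:E. {\<lfloor>lo e / \<gamma>\<rfloor>..\<lfloor>hi e / \<gamma>\<rfloor>})" using finE by auto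
  ultimately have "finite {k0..}" using finite_subset finite_imageD by blast
  then show False by (simp add: infinite_Ici)
qed

end

text \<open>In the application \<open>crit x\<close> means that the piece of orbit beginning at
  \<open>x\<close> meets a vertex. In \<open>crit_two_sided\<close> the backward index starts at one
  step, so that two different pieces are compared, and the base point is interior, because at an end
  of an edge one and the same vertex could lie on both pieces. \<open>conn\<close> expresses the
  connectedness of the surface in terms of edges.\<close>

locale germ_sys = F: germ_map E lo hi nx sh D + B: germ_map E lo hi nx' sh' D'
  for E :: "'e set" and lo hi nx sh D nx' sh' D' +
  fixes crit :: "'e \<times> real \<times> real \<Rightarrow> bool"
  assumes BF: "\<And>x. F.valid x \<Longrightarrow> B.T (F.T x) = x" and FB: "\<And>x. F.valid x \<Longrightarrow> F.T (B.T x) = x"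
    and crit_two_sided: "\<And>e t s j k. F.valid (e, t, s) \<Longrightarrow> lo e < t \<Longrightarrow> t < hi e \<Longrightarrow>
        crit ((F.T ^^ j) (e, t, s)) \<Longrightarrow> crit ((B.T ^^ Suc k) (e, t, s)) \<Longrightarrow> False"
    and crit_periodic: "\<And>x m. F.valid x \<Longrightarrow> (F.T ^^ Suc m) x = x \<Longrightarrow> crit x \<Longrightarrow> False"
    and noncrit: "\<And>e t s. F.valid (e, t, s) \<Longrightarrow> \<not> crit (e, t, s) \<Longrightarrow> lo e < t \<and> t < hi e \<and> nx e t (- s) = nx e t s"
    and conn: "\<And>A. A \<subseteq> E \<Longrightarrow> A \<noteq> {} \<Longrightarrow> (\<And>x. F.valid x \<Longrightarrow> fst x \<in> A \<longleftrightarrow> fst (F.T x) \<in> A) \<Longrightarrow> A = E"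
begin

lemma iter_BF: "F.valid x \<Longrightarrow> (B.T ^^ k) ((F.T ^^ k) x) = x"
proof (induction k arbitrary: x)
  case (Suc k)
  then show ?case using BF[OF F.iter_valid[OF Suc.prems, of k]] by (simp add: funpow_swap1 del: funpow.simps) (simp add: funpow_swap1)
qed auto

lemma iter_FB: "F.valid x \<Longrightarrow> (F.T ^^ k) ((B.T ^^ k) x) = x"
proof (induction k arbitrary: x)
  case (Suc k)
  then show ?case using FB[OF B.iter_valid[OF Suc.prems, of k]] by (simp add: funpow_swap1 del: funpow.simps) (simp add: funpow_swap1)
qed auto

text \<open>The periodic points in an edge form a set that is open and closed in the edge but
  misses its ends.\<close>

lemma no_periodic:
  assumes v: "F.valid x" and p: "(F.T ^^ Suc m) x = x"
  shows False
proof -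
  obtain e t s where x: "x = (e, t, s)" by (cases x)
  \<comment> \<open>Along a periodic orbit no piece is critical, so both germs of the base point are
    carried through the same edges, and the opposite germ is periodic too.\<close>
  have per: "lo e < t \<and> t < hi e \<and> (F.T ^^ Suc m) (e, t, - s) = (e, t, - s)"
    if v: "F.valid (e, t, s)" and p: "(F.T ^^ Suc m) (e, t, s) = (e, t, s)" for e t s
  proof -
    let ?x = "(e, t, s)"
    have nc: "\<not> crit ((F.T ^^ k) ?x)" for k
    proof -
      have "(F.T ^^ Suc m) ((F.T ^^ k) ?x) = (F.T ^^ k) ?x"
        by (metis p add.commute funpow_add comp_apply)
      then show ?thesis using crit_periodic F.iter_valid[OF v] by blast
    qed
    have op: "\<exists>e' t'. (F.T ^^ k) ?x = (e', t', s) \<and> (F.T ^^ k) (e, t, - s) = (e', t', - s)" for k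
    proof (induction k)
      case (Suc k)
      then obtain e' t' where k: "(F.T ^^ k) ?x = (e', t', s)" "(F.T ^^ k) (e, t, - s) = (e', t', - s)" by blast
      have "nx e' t' (- s) = nx e' t' s" using noncrit[of e' t' s] F.iter_valid[OF v, of k] nc[of k] k by simp
      then show ?case using k by (simp add: F.T_eq)
    qed simp
    show ?thesis using noncrit[of e t s] v nc[of 0] op[of "Suc m"] p by (auto simp del: funpow.simps)
  qed
  define Pe where "Pe = {t. \<exists>s. F.valid (e, t, s) \<and> (F.T ^^ Suc m) (e, t, s) = (e, t, s)}"
  have tP: "t \<in> Pe" using v p x unfolding Pe_def by blast
  have PI: "lo e < t" "t < hi e" if "t \<in> Pe" for t using that per unfolding Pe_def by blast+
  have Ps: "(F.T ^^ Suc m) (e, t, s) = (e, t, s)" if "t \<in> Pe" "side s" for t s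
  proof -
    obtain s' where s': "F.valid (e, t, s')" "(F.T ^^ Suc m) (e, t, s') = (e, t, s')" using \<open>t \<in> Pe\<close> unfolding Pe_def by blast
    then have "s = s' \<or> s = - s'" using that(2) F.valid_side[OF s'(1)] by (auto simp: side_def)
    then show ?thesis using s' per[OF s'] by (auto simp del: funpow.simps)
  qed
  have eE: "e \<in> E" using v x by (simp add: F.valid_iff)
  have bdd: "bdd_above Pe" using PI by (meson bdd_above.I less_imp_le)
  define w where "w = Sup Pe"
  have tw: "u \<le> w" if "u \<in> Pe" for u using cSup_upper[OF that bdd] by (simp add: w_def)
  have wh: "w \<le> hi e" using cSup_least[of Pe "hi e"] tP PI by (force simp: w_def)
  have wl: "lo e < w" using tw[OF tP] PI[OF tP] by simp
  \<comment> \<open>Periodic points just below \<open>w\<close> are moved by the same translation as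
    the lower germ of \<open>w\<close>. As it fixes them, it is trivial, and so it fixes that
    germ.\<close>
  have wP: "w \<in> Pe"
  proof (rule ccontr)
    assume nw: "w \<notin> Pe"
    have vw: "F.valid (e, w, -1)" using eE wh wl by (simp add: F.valid_iff)
    obtain \<delta> e' c where L: "\<delta> > 0" "(F.T ^^ Suc m) (e, w, -1) = (e', w + c, -1)"
      "\<And>u s'. 0 < -1 * (u - w) \<Longrightarrow> -1 * (u - w) < \<delta> \<Longrightarrow> side s' \<Longrightarrow> F.valid (e, u, s') \<and> (F.T ^^ Suc m) (e, u, s') = (e', u + c, s')"
      using F.iter_local[OF vw, of "Suc m"] by metis
    obtain u where u: "u \<in> Pe" "w - \<delta> < u" using less_cSupD[of Pe "w - \<delta>"] tP L(1) by (auto simp: w_def)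
    have "u < w" using tw[OF u(1)] nw u(1) by (metis le_less)
    then have "(F.T ^^ Suc m) (e, u, 1) = (e', u + c, 1)" using L(3)[of u 1] u by auto
    then have "e' = e" "c = 0" using Ps[OF u(1), of 1] by auto
    then have "w \<in> Pe" using vw L(2) unfolding Pe_def by (auto simp del: funpow.simps)
    then show False using nw by simp
  qed
  \<comment> \<open>On the upper side the same argument produces periodic points beyond the
    supremum.\<close>
  have vw: "F.valid (e, w, 1)" using eE PI[OF wP] by (simp add: F.valid_iff)
  obtain \<delta> e' c where L: "\<delta> > 0" "(F.T ^^ Suc m) (e, w, 1) = (e', w + c, 1)"
    "\<And>u s'. 0 < 1 * (u - w) \<Longrightarrow> 1 * (u - w) < \<delta> \<Longrightarrow> side s' \<Longrightarrow> F.valid (e, u, s') \<and> (F.T ^^ Suc m) (e, u, s') = (e', u + c, s')"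
    using F.iter_local[OF vw, of "Suc m"] by metis
  have "e' = e" "c = 0" using L(2) Ps[OF wP, of 1] by auto
  then have "w + \<delta> / 2 \<in> Pe" using L(3)[of "w + \<delta> / 2" 1] L(1) unfolding Pe_def by (auto simp del: funpow.simps)
  then show False using tw[of "w + \<delta> / 2"] L(1) by simp
qed

lemma no_F_recurrence:
  assumes v: "F.valid x" and jk: "j < k" "(F.T ^^ j) x = (F.T ^^ k) x"
  shows False
proof -
  obtain m where k: "k = Suc m + j" using jk(1) by (metis add.commute add_Suc_right less_imp_Suc_add)
  have "(F.T ^^ Suc m) ((F.T ^^ j) x) = (F.T ^^ j) x"
    using jk(2) unfolding k funpow_add by simp
  then show False using no_periodic[OF F.iter_valid[OF v]] by blast
qed

lemma no_B_recurrence: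
  assumes v: "F.valid x" and jk: "j < k" "(B.T ^^ j) x = (B.T ^^ k) x"
  shows False
proof -
  obtain m where k: "k = Suc m + j" using jk(1) by (metis add.commute add_Suc_right less_imp_Suc_add)
  let ?y = "(B.T ^^ j) x"
  have vy: "F.valid ?y" using B.iter_valid[OF v] .
  have "(B.T ^^ Suc m) ?y = ?y"
    using jk(2) unfolding k funpow_add by simp
  then have "(F.T ^^ Suc m) ?y = ?y" using iter_FB[OF vy, of "Suc m"] by simp
  then show False using no_periodic[OF vy] by blast
qed

theorem uniform_hitting:
  assumes e0: "e0 \<in> E" and ab: "lo e0 \<le> a" "a < b" "b \<le> hi e0"
  shows "\<exists>n. \<forall>x. F.valid x \<longrightarrow> (\<exists>k<n. \<exists>w s. (F.T ^^ k) x = (e0, w, s) \<and> a < w \<and> w < b)"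
proof (rule ccontr)
  assume no_bound: "\<not> ?thesis"
  define I where "I x \<longleftrightarrow> (\<exists>w s. x = (e0, w, s) \<and> a < w \<and> w < b)" for x :: "'e \<times> real \<times> real"
  have no_bound': "\<not> (\<forall>x. F.valid x \<longrightarrow> (\<exists>k<n. I ((F.T ^^ k) x)))" for n
    using no_bound unfolding I_def by simp
  define K where "K = {x. F.valid x \<and> (\<forall>k. \<not> I ((F.T ^^ k) x) \<and> \<not> I ((B.T ^^ k) x))}"
  have Fopen: "\<exists>\<delta>>0. \<forall>u s'. 0 < s * (u - t) \<and> s * (u - t) < \<delta> \<and> side s' \<longrightarrow> I ((F.T ^^ k) (e, u, s'))"
    if v: "F.valid (e, t, s)" and h: "I ((F.T ^^ k) (e, t, s))" for e t s k
  proof -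
    obtain w where "(F.T ^^ k) (e, t, s) = (e0, w, s)" "a < w" "w < b"
      using h F.iter_side[of k "(e, t, s)"] unfolding I_def by auto
    from F.iter_open[OF v this] show ?thesis unfolding I_def by metis
  qed
  have Bopen: "\<exists>\<delta>>0. \<forall>u s'. 0 < s * (u - t) \<and> s * (u - t) < \<delta> \<and> side s' \<longrightarrow> I ((B.T ^^ k) (e, u, s'))"
    if v: "F.valid (e, t, s)" and h: "I ((B.T ^^ k) (e, t, s))" for e t s k
  proof -
    obtain w where "(B.T ^^ k) (e, t, s) = (e0, w, s)" "a < w" "w < b"
      using h B.iter_side[of k "(e, t, s)"] unfolding I_def by auto
    from B.iter_open[OF v this] show ?thesis unfolding I_def by metis
  qed
  have Kval: "F.valid x" if "x \<in> K" for x using that by (simp add: K_def)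
  have Kinv: "F.T x \<in> K \<longleftrightarrow> x \<in> K" if v: "F.valid x" for x
  proof
    assume k: "F.T x \<in> K"
    have f: "\<not> I ((F.T ^^ n) (F.T x))" "\<not> I ((B.T ^^ n) (F.T x))" for n using k by (auto simp: K_def)
    have "\<not> I ((B.T ^^ n) x)" for n using f(2)[of "Suc n"] BF[OF v] by (simp add: funpow_swap1)
    moreover have "\<not> I ((F.T ^^ n) x)" for n
      using f(1)[of "n - 1"] f(2)[of 1] BF[OF v] by (cases n) (auto simp: funpow_swap1)
    ultimately show "x \<in> K" using v by (simp add: K_def)
  next
    assume k: "x \<in> K"
    have f: "\<not> I ((F.T ^^ n) x)" "\<not> I ((B.T ^^ n) x)" for n using k by (auto simp: K_def)
    have "\<not> I ((F.T ^^ n) (F.T x))" for n using f(1)[of "Suc n"] by (simp add: funpow_swap1)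
    moreover have "\<not> I ((B.T ^^ n) (F.T x))" for n
      using f(2)[of "n - 1"] f(1)[of 1] BF[OF v] by (cases n) (auto simp: funpow_swap1)
    ultimately show "F.T x \<in> K" using F.T_valid[OF v] by (simp add: K_def)
  qed
  have KinvB: "B.T x \<in> K \<longleftrightarrow> x \<in> K" if v: "F.valid x" for x
    using Kinv[OF B.T_valid[OF v]] FB[OF v] by simp
  \<comment> \<open>Accumulation from side \<open>s\<close> yields the germ on that side, whatever
    the sides \<open>s'\<close> of the approximating germs are.\<close>
  have Kclosed: "(e, t, s) \<in> K"
    if v: "F.valid (e, t, s)" and acc: "\<And>\<delta>. \<delta> > 0 \<Longrightarrow> \<exists>u s'. 0 < s * (u - t) \<and> s * (u - t) < \<delta> \<and> (e, u, s') \<in> K" for e t s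
  proof (rule ccontr)
    assume "(e, t, s) \<notin> K"
    then obtain k where "I ((F.T ^^ k) (e, t, s)) \<or> I ((B.T ^^ k) (e, t, s))" using v by (auto simp: K_def)
    then obtain \<delta> where d: "\<delta> > 0" "(\<forall>u s'. 0 < s * (u - t) \<and> s * (u - t) < \<delta> \<and> side s' \<longrightarrow> I ((F.T ^^ k) (e, u, s')))
        \<or> (\<forall>u s'. 0 < s * (u - t) \<and> s * (u - t) < \<delta> \<and> side s' \<longrightarrow> I ((B.T ^^ k) (e, u, s')))"
      using Fopen[OF v] Bopen[OF v] by meson
    obtain u s' where u: "0 < s * (u - t)" "s * (u - t) < \<delta>" "(e, u, s') \<in> K" using acc[OF d(1)] by blast
    have "side s'" using F.valid_side[OF Kval[OF u(3)]] .
    then show False using d(2) u by (auto simp: K_def)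
  qed
  have "K \<noteq> {}"
  proof -
    have "\<exists>y. F.valid y \<and> (\<forall>k\<le>n. \<not> I ((F.T ^^ k) y) \<and> \<not> I ((B.T ^^ k) y))" for n
    proof -
      \<comment> \<open>From an orbit stretch of \<open>2 * n + 1\<close> germs without a visit the
        middle one is taken; it has \<open>n\<close> steps without a visit in either
        direction.\<close>
      obtain x where x: "F.valid x" "\<And>k. k < 2 * n + 1 \<Longrightarrow> \<not> I ((F.T ^^ k) x)" using no_bound' by blast
      have "\<not> I ((F.T ^^ k) ((F.T ^^ n) x))" "\<not> I ((B.T ^^ k) ((F.T ^^ n) x))" if "k \<le> n" for k
      proof -
        show "\<not> I ((F.T ^^ k) ((F.T ^^ n) x))" using x(2)[of "k + n"] that by (simp add: funpow_add)
        have "(F.T ^^ n) x = (F.T ^^ k) ((F.T ^^ (n - k)) x)" using that by (metis comp_apply funpow_add le_add_diff_inverse)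
        then have "(B.T ^^ k) ((F.T ^^ n) x) = (F.T ^^ (n - k)) x" using iter_BF[OF F.iter_valid[OF x(1)]] by simp
        then show "\<not> I ((B.T ^^ k) ((F.T ^^ n) x))" using x(2)[of "n - k"] by simp
      qed
      then show ?thesis using F.iter_valid[OF x(1)] by blast
    qed
    then obtain y where y: "\<And>n. F.valid (y n)" "\<And>n k. k \<le> n \<Longrightarrow> \<not> I ((F.T ^^ k) (y n)) \<and> \<not> I ((B.T ^^ k) (y n))" by metis
    define ey ty sy where "ey n = fst (y n)" and "ty n = fst (snd (y n))" and "sy n = snd (snd (y n))" for n
    have yn: "y n = (ey n, ty n, sy n)" for n by (simp add: ey_def ty_def sy_def)
    have ey: "ey n \<in> E" and sy: "sy n = 1 \<or> sy n = -1" and tyb: "lo (ey n) \<le> ty n" "ty n \<le> hi (ey n)" for n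
      using y(1)[of n] unfolding yn by (auto simp: F.valid_iff)
    obtain e where "infinite {n \<in> UNIV. ey n = e}"
      using pigeonhole_infinite[of UNIV ey] finite_subset[OF _ F.finE, of "range ey"] ey by auto
    then have infe: "infinite {n. ey n = e}" by simp
    have eE: "e \<in> E" using infe ey by (metis (mono_tags, lifting) empty_Collect_eq finite.emptyI)
    define r where "r = enumerate {n. ey n = e}"
    have r: "strict_mono r" "\<And>n. ey (r n) = e"
      using strict_mono_enumerate[OF infe] enumerate_in_set[OF infe] by (auto simp: r_def)
    have "seq_compact {lo e..hi e}" by (rule compact_imp_seq_compact) simp
    moreover have "\<forall>n. ty (r n) \<in> {lo e..hi e}"
    proof
      fix n show "ty (r n) \<in> {lo e..hi e}" using tyb[of "r n"] r(2)[of n] by simp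
    qed
    ultimately obtain t r2 where t: "t \<in> {lo e..hi e}" "strict_mono (r2 :: nat \<Rightarrow> nat)" "((\<lambda>n. ty (r n)) \<circ> r2) \<longlonglongrightarrow> t"
      by (rule seq_compactE)
    define m where "m = r \<circ> r2"
    have m: "strict_mono m" "\<And>n. ey (m n) = e" "(\<lambda>n. ty (m n)) \<longlonglongrightarrow> t"
      using r t strict_mono_o by (auto simp: m_def comp_def)
    have mg: "n \<le> m n" for n using strict_mono_imp_increasing[OF m(1)] .
    \<comment> \<open>A subsequence must also fix how the limit height \<open>t\<close> is
      approached. If this is from side \<open>\<sigma>\<close>, the limit germ is
      \<open>(e, t, \<sigma>)\<close>; if the heights are equal to \<open>t\<close>, it is the
      repeated germ with its own side \<open>s\<close>.\<close>
    define cl where "cl n = (sgn (ty (m n) - t), sy (m n))" for n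
    have "cl n \<in> {-1, 0, 1} \<times> {1, -1}" for n using sy[of "m n"] by (auto simp: cl_def sgn_if)
    then have "range cl \<subseteq> {-1, 0, 1} \<times> {1, -1}" by blast
    then have "finite (range cl)" by (rule finite_subset) auto
    then obtain c0 where "infinite {n \<in> UNIV. cl n = c0}" using pigeonhole_infinite[of UNIV cl] infinite_UNIV_nat by blast
    then have inf: "\<exists>n\<ge>N. cl n = c0" for N by (metis (mono_tags, lifting) infinite_nat_iff_unbounded_le mem_Collect_eq)
    obtain \<sigma> s where c0: "c0 = (\<sigma>, s)" by (cases c0)
    have near: "\<exists>n\<ge>N. sgn (ty (m n) - t) = \<sigma> \<and> sy (m n) = s \<and> \<bar>ty (m n) - t\<bar> < \<delta>" if "\<delta> > 0" for \<delta> N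
    proof -
      obtain N' where N': "\<And>n. n \<ge> N' \<Longrightarrow> dist (ty (m n)) t < \<delta>" using m(3) \<open>\<delta> > 0\<close> unfolding lim_sequentially by blast
      obtain n where "n \<ge> max N N'" "cl n = c0" using inf by blast
      then show ?thesis using N'[of n] c0 by (auto simp: cl_def dist_real_def)
    qed
    show ?thesis
    proof (cases "\<sigma> = 0")
      case True
      have "(e, t, s) \<in> K" unfolding K_def
      proof (intro CollectI conjI allI)
        have *: "\<exists>n\<ge>N. y (m n) = (e, t, s)" for N
          using near[of 1 N] True m(2) yn by (auto simp: sgn_eq_0_iff)
        show "F.valid (e, t, s)" using *[of 0] y(1) by metis
        fix k
        obtain n where n: "n \<ge> k" "y (m n) = (e, t, s)" using * by blast
        then show "\<not> I ((F.T ^^ k) (e, t, s))" "\<not> I ((B.T ^^ k) (e, t, s))"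
          using y(2)[of k "m n"] mg[of n] by auto
      qed
      then show ?thesis by blast
    next
      case False
      obtain n0 where n0: "sgn (ty (m n0) - t) = \<sigma>" using near[of 1 0] by auto
      have \<sigma>: "side \<sigma>" using False n0 by (auto simp: side_def sgn_if split: if_splits)
      have v: "F.valid (e, t, \<sigma>)"
        using eE t(1) n0 \<sigma> tyb[of "m n0"] m(2)[of n0] by (auto simp: F.valid_iff side_def sgn_if split: if_splits)
      have "(e, t, \<sigma>) \<in> K"
      proof (rule ccontr)
        assume "(e, t, \<sigma>) \<notin> K"
        then obtain k where "I ((F.T ^^ k) (e, t, \<sigma>)) \<or> I ((B.T ^^ k) (e, t, \<sigma>))" using v by (auto simp: K_def)
        then obtain \<delta> where d: "\<delta> > 0" "(\<forall>u s'. 0 < \<sigma> * (u - t) \<and> \<sigma> * (u - t) < \<delta> \<and> side s' \<longrightarrow> I ((F.T ^^ k) (e, u, s')))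
            \<or> (\<forall>u s'. 0 < \<sigma> * (u - t) \<and> \<sigma> * (u - t) < \<delta> \<and> side s' \<longrightarrow> I ((B.T ^^ k) (e, u, s')))"
          using Fopen[OF v] Bopen[OF v] by meson
        obtain n where n: "n \<ge> k" "sgn (ty (m n) - t) = \<sigma>" "\<bar>ty (m n) - t\<bar> < \<delta>" using near[OF d(1), of k] by blast
        have "0 < \<sigma> * (ty (m n) - t) \<and> \<sigma> * (ty (m n) - t) < \<delta> \<and> side (sy (m n))"
          using n(2,3) False sy[of "m n"] by (auto simp: sgn_if side_def split: if_splits)
        then have "I ((F.T ^^ k) (y (m n))) \<or> I ((B.T ^^ k) (y (m n)))" using d(2) yn m(2) by metis
        then show False using y(2)[of k "m n"] mg[of n] n(1) by auto
      qed
      then show ?thesis by blast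
    qed
  qed
  have no_gap_end: False
    if x: "(e, q, s) \<in> K" "lo e < q" "q < hi e" and \<sigma>: "side \<sigma>" and g: "0 < g"
      and gap: "\<And>u s'. 0 < \<sigma> * (u - q) \<Longrightarrow> \<sigma> * (u - q) < g \<Longrightarrow> side s' \<Longrightarrow> lo e < u \<and> u < hi e \<and> (e, u, s') \<notin> K"
    for e q s \<sigma> g
  proof -
    let ?x = "(e, q, s)"
    have v: "F.valid ?x" using Kval[OF x(1)] .
    consider "\<And>j. \<not> crit ((F.T ^^ j) ?x)" | "\<And>k. \<not> crit ((B.T ^^ Suc k) ?x)" using crit_two_sided[OF v x(2,3)] by blast
    then show False
    proof cases
      case 1
      have "\<exists>j k. j < k \<and> (F.T ^^ j) ?x = (F.T ^^ k) ?x"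
      proof (rule F.gap_follow[where K=K and \<sigma>=\<sigma> and g=g])
        fix k e' t' assume "(F.T ^^ k) ?x = (e', t', s)"
        then show "lo e' < t' \<and> t' < hi e' \<and> nx e' t' (- s) = nx e' t' s"
          using noncrit[of e' t' s] 1[of k] F.iter_valid[OF v, of k] by simp
      qed (use Kinv v x \<sigma> g gap in auto)
      then show False using no_F_recurrence[OF v] by blast
    next
      case 2
      have "\<exists>j k. j < k \<and> (B.T ^^ j) ?x = (B.T ^^ k) ?x"
      proof (rule B.gap_follow[where K=K and \<sigma>=\<sigma> and g=g])
        fix k e' t' assume k: "(B.T ^^ k) ?x = (e', t', s)"
        have v': "F.valid (e', t', s)" using B.iter_valid[OF v, of k] k by simp
        \<comment> \<open>\<open>noncrit\<close> speaks of the forward map. Inverting that map at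
          the preceding germ shows that the backward map does not separate the two sides
          either.\<close>
        obtain e2 t2 where y: "B.T (e', t', s) = (e2, t2, s)" by (simp add: B.T_eq)
        have vy: "F.valid (e2, t2, s)" using B.T_valid[OF v'] y by simp
        have "\<not> crit (e2, t2, s)" using 2[of k] k y by simp
        then have ny: "lo e2 < t2" "t2 < hi e2" "nx e2 t2 (- s) = nx e2 t2 s" using noncrit[OF vy] by auto
        have ss: "side (- s)" using F.valid_side[OF vy] by simp
        have vo: "F.valid (e2, t2, - s)" using F.valid_interior[of e2 t2 "- s"] vy ny ss by (auto simp: F.valid_iff)
        have "F.T (e2, t2, s) = (e', t', s)" using FB[OF v'] y by simp
        then have "nx e2 t2 s = e'" "t2 + sh e2 e' = t'" by (auto simp: F.T_eq)
        then have "F.T (e2, t2, - s) = (e', t', - s)" using ny(3) by (simp add: F.T_eq)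
        then have "B.T (e', t', - s) = (e2, t2, - s)" using BF[OF vo] by simp
        then have opp: "nx' e' t' (- s) = nx' e' t' s" using y by (simp add: B.T_eq)
        \<comment> \<open>For \<open>k = 0\<close> the germ itself may be critical in this case;
          there the hypothesis that \<open>q\<close> is interior is used.\<close>
        have "lo e' < t' \<and> t' < hi e'"
        proof (cases k)
          case 0 then show ?thesis using k x by simp
        next
          case (Suc k') then show ?thesis using noncrit[OF v'] 2[of k'] k by simp
        qed
        then show "lo e' < t' \<and> t' < hi e' \<and> nx' e' t' (- s) = nx' e' t' s" using opp by simp
      qed (use KinvB v x \<sigma> g gap in auto)
      then show False using no_B_recurrence[OF v] by blast
    qed
  qed
  \<comment> \<open>The point of \<open>K\<close> nearest to the empty interval, on the side where
    \<open>v\<close> lies, is the end of a gap. It lies between \<open>v\<close> and that interval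
    and is therefore interior to the edge.\<close>
  have full_or_empty: "\<exists>u s. p < u \<and> u < q \<and> (e, u, s) \<in> K"
    if e: "e \<in> E" and v: "lo e < v" "v < hi e" "(e, v, s0) \<in> K" and pq: "lo e \<le> p" "p < q" "q \<le> hi e" for e v s0 p q
  proof (rule ccontr)
    assume n: "\<not> ?thesis"
    have nv: "v \<le> p \<or> q \<le> v" using n v by force
    show False
    proof (cases "q \<le> v")
      case True
      define S where "S = {u. q \<le> u \<and> (\<exists>s. (e, u, s) \<in> K)}"
      have S: "v \<in> S" "bdd_below S" using True v by (auto simp: S_def intro: bdd_belowI)
      define w where "w = Inf S"
      have wv: "w \<le> v" and wq: "q \<le> w"
      proof -
        show "w \<le> v" using cInf_lower[OF S] by (simp add: w_def)
        show "q \<le> w" unfolding w_def by (rule cInf_greatest) (use S in \<open>auto simp: S_def\<close>)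
      qed
      have wi: "lo e < w" "w < hi e" using wv wq pq v by auto
      have below: "(e, u, s) \<notin> K" if "p < u" "u < w" for u s
      proof (cases "u < q")
        case True then show ?thesis using n that by blast
      next
        case False
        then have "u \<notin> S" using that cInf_lower[OF _ S(2), of u] by (auto simp: w_def)
        then show ?thesis using False by (auto simp: S_def)
      qed
      have "\<exists>s. (e, w, s) \<in> K"
      proof (rule ccontr)
        assume nK: "\<not> ?thesis"
        have "(e, w, 1) \<in> K"
        proof (rule Kclosed)
          show "F.valid (e, w, 1)" using e wi by (simp add: F.valid_iff)
          fix \<delta> :: real assume "\<delta> > 0"
          then obtain u where u: "u \<in> S" "u < w + \<delta>" using cInf_lessD[of S "w + \<delta>"] S by (auto simp: w_def)
          have "w \<le> u" using cInf_lower[OF u(1) S(2)] by (simp add: w_def)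
          moreover have "u \<noteq> w" using nK u(1) by (auto simp: S_def)
          moreover obtain s' where "(e, u, s') \<in> K" using u(1) by (auto simp: S_def)
          ultimately show "\<exists>u s'. 0 < 1 * (u - w) \<and> 1 * (u - w) < \<delta> \<and> (e, u, s') \<in> K"
            using u by - (rule exI[of _ u], rule exI[of _ s'], auto)
        qed
        then show False using nK by blast
      qed
      then obtain s where "(e, w, s) \<in> K" by blast
      then show False
        by (rule no_gap_end[of e w s "-1" "w - p"]) (use wi wq pq below in auto)
    next
      case False
      then have vp: "v \<le> p" using nv by simp
      define S where "S = {u. u \<le> p \<and> (\<exists>s. (e, u, s) \<in> K)}"
      have S: "v \<in> S" "bdd_above S" using vp v by (auto simp: S_def intro: bdd_aboveI)
      define w where "w = Sup S"
      have wv: "v \<le> w" and wq: "w \<le> p"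
      proof -
        show "v \<le> w" using cSup_upper[OF S] by (simp add: w_def)
        show "w \<le> p" unfolding w_def by (rule cSup_least) (use S in \<open>auto simp: S_def\<close>)
      qed
      have wi: "lo e < w" "w < hi e" using wv wq pq v by auto
      have above: "(e, u, s) \<notin> K" if "w < u" "u < q" for u s
      proof (cases "p < u")
        case True then show ?thesis using n that by blast
      next
        case False
        then have "u \<notin> S" using that cSup_upper[OF _ S(2), of u] by (auto simp: w_def)
        then show ?thesis using False by (auto simp: S_def)
      qed
      have "\<exists>s. (e, w, s) \<in> K"
      proof (rule ccontr)
        assume nK: "\<not> ?thesis"
        have "(e, w, -1) \<in> K"
        proof (rule Kclosed)
          show "F.valid (e, w, -1)" using e wi by (simp add: F.valid_iff)
          fix \<delta> :: real assume "\<delta> > 0"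
          then obtain u where u: "u \<in> S" "w - \<delta> < u" using less_cSupD[of S "w - \<delta>"] S by (auto simp: w_def)
          have "u \<le> w" using cSup_upper[OF u(1) S(2)] by (simp add: w_def)
          moreover have "u \<noteq> w" using nK u(1) by (auto simp: S_def)
          moreover obtain s' where "(e, u, s') \<in> K" using u(1) by (auto simp: S_def)
          ultimately show "\<exists>u s'. 0 < -1 * (u - w) \<and> -1 * (u - w) < \<delta> \<and> (e, u, s') \<in> K"
            using u by - (rule exI[of _ u], rule exI[of _ s'], auto)
        qed
        then show False using nK by blast
      qed
      then obtain s where "(e, w, s) \<in> K" by blast
      then show False
        by (rule no_gap_end[of e w s 1 "q - w"]) (use wi wq pq above in auto)
    qed
  qed
  define A where "A = {e \<in> E. \<exists>v s. lo e < v \<and> v < hi e \<and> (e, v, s) \<in> K}"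
  have "A = {}"
  proof (rule ccontr)
    assume ne: "A \<noteq> {}"
    \<comment> \<open>The return map translates a short interval beside each germ. If one of the two
      edges belongs to \<open>A\<close>, then \<open>K\<close> meets this interval or its image, and
      invariance passes the point on to the other edge.\<close>
    have "A = E"
    proof (rule conn[OF _ ne])
      show "A \<subseteq> E" by (auto simp: A_def)
      fix x assume vx: "F.valid x"
      obtain e t s where x: "x = (e, t, s)" by (cases x)
      have v: "F.valid (e, t, s)" using vx x by simp
      define e' c where "e' = nx e t s" and "c = sh e (nx e t s)"
      obtain \<delta> where \<delta>: "\<delta> > 0"
        "\<And>u s'. 0 < s * (u - t) \<Longrightarrow> s * (u - t) < \<delta> \<Longrightarrow> side s' \<Longrightarrow> lo e < u \<and> u < hi e \<and> nx e u s' = nx e t s"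
        using F.nx_locally_constant[OF v] by blast
      have eE: "e \<in> E" using v by (simp add: F.valid_iff)
      have L: "\<delta> > 0" "F.T (e, t, s) = (e', t + c, s)"
        "\<And>u s'. 0 < s * (u - t) \<Longrightarrow> s * (u - t) < \<delta> \<Longrightarrow> side s' \<Longrightarrow> F.valid (e, u, s') \<and> F.T (e, u, s') = (e', u + c, s')"
        using \<delta> F.valid_interior[OF eE] by (auto simp: F.T_eq e'_def c_def)
      have s: "side s" using F.valid_side[OF v] .
      have e': "e' \<in> E" "e \<in> E" using F.T_valid[OF v] v L(2) by (auto simp: F.valid_iff)
      define p where "p = (if s = 1 then t else t - \<delta>)"
      have pu: "0 < s * (u - t) \<and> s * (u - t) < \<delta>" if "p < u" "u < p + \<delta>" for u
        using that s by (auto simp: p_def side_def split: if_splits)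
      have Ti: "lo e < u" "u < hi e" "lo e' < u + c" "u + c < hi e'" "F.valid (e, u, s')" "F.T (e, u, s') = (e', u + c, s')"
        if "p < u" "u < p + \<delta>" "side s'" for u s'
      proof -
        have a: "F.valid (e, u, s'') \<and> F.T (e, u, s'') = (e', u + c, s'')" if "side s''" for s''
          using L(3) pu[OF \<open>p < u\<close> \<open>u < p + \<delta>\<close>] that by blast
        have "F.valid (e', u + c, 1)" "F.valid (e', u + c, -1)" using F.T_valid[of "(e, u, 1)"] F.T_valid[of "(e, u, -1)"] a[of 1] a[of "-1"] by auto
        then show "lo e' < u + c" "u + c < hi e'" by (auto simp: F.valid_iff)
        show "lo e < u" "u < hi e" using a[of 1] a[of "-1"] by (auto simp: F.valid_iff)
        show "F.valid (e, u, s')" "F.T (e, u, s') = (e', u + c, s')" using a[OF that(3)] by auto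
      qed
      \<comment> \<open>With the middle third even the closed interval and its image lie within
        their edges, as \<open>full_or_empty\<close> requires.\<close>
      define p1 q1 where "p1 = p + \<delta> / 3" and "q1 = p + 2 * \<delta> / 3"
      have pq: "p < p1" "p1 < q1" "q1 < p + \<delta>" using L(1) by (auto simp: p1_def q1_def)
      have b1: "lo e \<le> p1" "q1 \<le> hi e" "lo e' \<le> p1 + c" "q1 + c \<le> hi e'"
        using Ti(1)[of p1 1] Ti(2)[of q1 1] Ti(3)[of p1 1] Ti(4)[of q1 1] pq by auto
      show "fst x \<in> A \<longleftrightarrow> fst (F.T x) \<in> A"
      proof
        assume "fst x \<in> A"
        then obtain v0 s0 where "lo e < v0" "v0 < hi e" "(e, v0, s0) \<in> K" using x by (auto simp: A_def)
        from full_or_empty[OF eE this b1(1) pq(2) b1(2)]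
        obtain u s' where u: "p1 < u" "u < q1" "(e, u, s') \<in> K" by blast
        have s': "side s'" using F.valid_side[OF Kval[OF u(3)]] .
        have up: "p < u" "u < p + \<delta>" using u pq by auto
        have "(e', u + c, s') \<in> K" using Kinv[OF Ti(5)[OF up s']] Ti(6)[OF up s'] u(3) by simp
        then show "fst (F.T x) \<in> A" using Ti(3,4)[OF up s'] e' L(2) x by (auto simp: A_def)
      next
        assume "fst (F.T x) \<in> A"
        then obtain v0 s0 where "lo e' < v0" "v0 < hi e'" "(e', v0, s0) \<in> K" using x L(2) by (auto simp: A_def)
        from full_or_empty[OF e'(1) this b1(3) _ b1(4)] pq(2)
        obtain u' s' where u': "p1 + c < u'" "u' < q1 + c" "(e', u', s') \<in> K" by auto
        define u where "u = u' - c"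
        have s': "side s'" using F.valid_side[OF Kval[OF u'(3)]] .
        have up: "p < u" "u < p + \<delta>" using u' pq by (auto simp: u_def)
        have "(e, u, s') \<in> K" using Kinv[OF Ti(5)[OF up s']] Ti(6)[OF up s'] u'(3) by (simp add: u_def)
        then show "fst x \<in> A" using Ti(1,2)[OF up s'] e' x by (auto simp: A_def)
      qed
    qed
    then have "e0 \<in> A" using e0 by simp
    then obtain v0 s0 where "lo e0 < v0" "v0 < hi e0" "(e0, v0, s0) \<in> K" by (auto simp: A_def)
    from full_or_empty[OF e0 this ab] obtain u s where u: "a < u" "u < b" "(e0, u, s) \<in> K" by blast
    then have "\<not> I ((F.T ^^ 0) (e0, u, s))" unfolding K_def by blast
    then show False using u by (auto simp: I_def)
  qed
  have "K \<subseteq> (\<Union>e\<in>E. {e} \<times> {lo e, hi e} \<times> {1, -1})"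
  proof
    fix x assume x: "x \<in> K"
    obtain e t s where xe: "x = (e, t, s)" by (cases x)
    have v: "F.valid (e, t, s)" using Kval x xe by blast
    then have "\<not> (lo e < t \<and> t < hi e)" using \<open>A = {}\<close> x xe by (auto simp: A_def F.valid_iff)
    then show "x \<in> (\<Union>e\<in>E. {e} \<times> {lo e, hi e} \<times> {1, -1})" using v xe by (auto simp: F.valid_iff)
  qed
  then have finK: "finite K" using finite_subset F.finE by (metis (no_types, lifting) finite.emptyI finite.insertI finite_SigmaI finite_UN)
  obtain x where x: "x \<in> K" using \<open>K \<noteq> {}\<close> by blast
  have xk: "(F.T ^^ k) x \<in> K" for k using x Kinv Kval by (induction k) auto
  have "\<not> inj (\<lambda>k. (F.T ^^ k) x)"
    using finite_subset[OF _ finK, of "range (\<lambda>k. (F.T ^^ k) x)"] xk finite_imageD infinite_UNIV_nat by blast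
  then obtain j k where "j \<noteq> k" "(F.T ^^ j) x = (F.T ^^ k) x" unfolding inj_def by blast
  then show False using no_F_recurrence[OF Kval[OF x]] by (metis linorder_neqE_nat)
qed

end

section \<open>Cutting geodesic segments\<close>

text \<open>Positions in the list are used instead of times, because a junction of pieces or a piece
  of length zero has several positions with the same time.\<close>

definition vertex_at ::
  "nat \<Rightarrow> (nat \<Rightarrow> complex list) \<Rightarrow> complex \<Rightarrow> (nat \<times> complex \<times> real) list \<Rightarrow> nat \<Rightarrow> real \<Rightarrow> bool" where
  "vertex_at n V d L k s \<longleftrightarrow> k < length L \<and> 0 \<le> s \<and> s \<le> snd (snd (L ! k))
     \<and> is_vertex n V (fst (L ! k), fst (snd (L ! k)) + complex_of_real s * d)"

lemma seg_length_simps [simp]: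
  "seg_length [] = 0" "seg_length (p # L) = snd (snd p) + seg_length L" "seg_length (L @ M) = seg_length L + seg_length M"
  by (auto simp: seg_length_def split: prod.splits)

lemma piece_offset_Suc: "k < length L \<Longrightarrow> piece_offset L (Suc k) = piece_offset L k + snd (snd (L ! k))"
  by (simp add: piece_offset_def take_Suc_conv_app_nth)

lemma piece_offset_0 [simp]: "piece_offset L 0 = 0" by (simp add: piece_offset_def)

lemma piece_offset_length: "piece_offset L (length L) = seg_length L" by (simp add: piece_offset_def)

lemma geodesic_piece:
  assumes "geodesic_segment n V sig d L" "k < length L"
  shows "fst (L ! k) < n" "0 \<le> snd (snd (L ! k))"
    "closed_segment (fst (snd (L ! k))) (fst (snd (L ! k)) + complex_of_real (snd (snd (L ! k))) * d) \<subseteq> face_region (V (fst (L ! k)))"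
proof -
  have "\<forall>(i, z, l)\<in>set L. i < n \<and> l \<ge> 0 \<and> closed_segment z (z + complex_of_real l * d) \<subseteq> face_region (V i)"
    using assms(1) unfolding geodesic_segment_def by (elim conjE)
  from bspec[OF this nth_mem[OF assms(2)]] show "fst (L ! k) < n" "0 \<le> snd (snd (L ! k))"
    "closed_segment (fst (snd (L ! k))) (fst (snd (L ! k)) + complex_of_real (snd (snd (L ! k))) * d) \<subseteq> face_region (V (fst (L ! k)))"
    unfolding case_prod_beta by blast+
qed

lemma piece_offset_mono:
  assumes g: "geodesic_segment n V sig d L" and "j \<le> k" "k \<le> length L"
  shows "piece_offset L j \<le> piece_offset L k"
  using assms(2,3)
proof (induction k rule: dec_induct)
  case (step k)
  then show ?case using piece_offset_Suc[of k L] geodesic_piece(2)[OF g, of k] by simp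
qed simp

lemma geodesic_piece_at:
  assumes g: "geodesic_segment n V sig d L" and \<tau>: "0 \<le> \<tau>" "\<tau> \<le> seg_length L"
  shows "\<exists>k<length L. piece_offset L k \<le> \<tau> \<and> \<tau> \<le> piece_offset L (Suc k)"
proof -
  define k where "k = (LEAST k. \<tau> \<le> piece_offset L (Suc k))"
  have ne: "length L > 0" using g by (auto simp: geodesic_segment_def)
  have ex: "\<tau> \<le> piece_offset L (Suc (length L - 1))" using \<tau> ne piece_offset_length[of L] by simp
  have k1: "\<tau> \<le> piece_offset L (Suc k)" unfolding k_def by (rule LeastI) (rule ex)
  have "k \<le> length L - 1" unfolding k_def by (rule Least_le) (rule ex)
  then have k2: "k < length L" using ne by linarith
  have k3: "piece_offset L k \<le> \<tau>"
  proof (cases k)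
    case (Suc k')
    then have "\<not> \<tau> \<le> piece_offset L (Suc k')" using not_less_Least[of k' "\<lambda>k. \<tau> \<le> piece_offset L (Suc k)"] by (simp add: k_def)
    then show ?thesis using Suc by simp
  qed (use \<tau> in simp)
  show ?thesis using k1 k2 k3 by blast
qed

lemma piece_end_alt: "piece_end d p = (fst p, fst (snd p) + complex_of_real (snd (snd p)) * d)"
  by (simp add: piece_end_def split: prod.splits)

lemma geodesicI:
  assumes "L \<noteq> []"
    and "\<And>k. k < length L \<Longrightarrow> fst (L ! k) < n \<and> 0 \<le> snd (snd (L ! k)) \<and>
      closed_segment (fst (snd (L ! k))) (fst (snd (L ! k)) + complex_of_real (snd (snd (L ! k))) * d) \<subseteq> face_region (V (fst (L ! k)))"
    and "\<And>k. Suc k < length L \<Longrightarrow> same_point n V sig (piece_end d (L ! k)) (fst (L ! Suc k), fst (snd (L ! Suc k)))"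
  shows "geodesic_segment n V sig d L"
  unfolding geodesic_segment_def
proof (intro conjI ballI allI impI assms(1) assms(3))
  fix p assume "p \<in> set L"
  then obtain k where "k < length L" "p = L ! k" by (auto simp: in_set_conv_nth)
  then show "case p of (i, z, l) \<Rightarrow> i < n \<and> 0 \<le> l \<and> closed_segment z (z + complex_of_real l * d) \<subseteq> face_region (V i)"
    using assms(2)[of k] by (auto split: prod.splits)
qed

lemma sub_segment:
  assumes "0 \<le> a" "a \<le> b" "b \<le> l"
  shows "closed_segment (z + complex_of_real a * d) (z + complex_of_real b * d) \<subseteq> closed_segment z (z + complex_of_real l * d)"
proof -
  have "z + complex_of_real c * d \<in> closed_segment z (z + complex_of_real l * d)" if "0 \<le> c" "c \<le> l" for c
  proof (cases "l = 0")
    case False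
    then have "z + complex_of_real c * d = (1 - c / l) *\<^sub>R z + (c / l) *\<^sub>R (z + complex_of_real l * d)"
      by (simp add: scaleR_conv_of_real field_simps)
    then show ?thesis unfolding closed_segment_def using that False by (auto intro!: exI[of _ "c / l"])
  qed (use that in auto)
  then show ?thesis using assms by (simp add: subset_closed_segment)
qed

definition cut_before :: "(nat \<times> complex \<times> real) list \<Rightarrow> nat \<Rightarrow> real \<Rightarrow> (nat \<times> complex \<times> real) list" where
  "cut_before L k s = take k L @ [(fst (L ! k), fst (snd (L ! k)), s)]"

definition cut_after :: "complex \<Rightarrow> (nat \<times> complex \<times> real) list \<Rightarrow> nat \<Rightarrow> real \<Rightarrow> (nat \<times> complex \<times> real) list" where
  "cut_after d L k s = (fst (L ! k), fst (snd (L ! k)) + complex_of_real s * d, snd (snd (L ! k)) - s) # drop (Suc k) L"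

lemma cut_before_nth:
  assumes "k < length L"
  shows "length (cut_before L k s) = Suc k" "j < k \<Longrightarrow> cut_before L k s ! j = L ! j"
    "cut_before L k s ! k = (fst (L ! k), fst (snd (L ! k)), s)"
    "j \<le> k \<Longrightarrow> piece_offset (cut_before L k s) j = piece_offset L j"
  using assms by (auto simp: cut_before_def nth_append piece_offset_def min_def)

lemma geodesic_cut_before:
  assumes g: "geodesic_segment n V sig d L" and k: "k < length L" and s: "0 \<le> s" "s \<le> snd (snd (L ! k))"
  shows "geodesic_segment n V sig d (cut_before L k s)"
    "seg_length (cut_before L k s) = piece_offset L k + s"
    "piece_end d (last (cut_before L k s)) = (fst (L ! k), fst (snd (L ! k)) + complex_of_real s * d)"
    "vertex_at n V d (cut_before L k s) j r \<Longrightarrow> j \<le> k \<and> vertex_at n V d L j r"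
proof -
  note nth = cut_before_nth[OF k, where s=s]
  have sub: "closed_segment (fst (snd (L ! k))) (fst (snd (L ! k)) + complex_of_real s * d) \<subseteq> face_region (V (fst (L ! k)))"
    using sub_segment[of 0 s "snd (snd (L ! k))" "fst (snd (L ! k))" d] s geodesic_piece(3)[OF g k] by auto
  show "geodesic_segment n V sig d (cut_before L k s)"
  proof (rule geodesicI)
    show "cut_before L k s \<noteq> []" by (simp add: cut_before_def)
    fix j assume "j < length (cut_before L k s)"
    then consider "j < k" | "j = k" using nth by linarith
    then show "fst (cut_before L k s ! j) < n \<and> 0 \<le> snd (snd (cut_before L k s ! j)) \<and>
      closed_segment (fst (snd (cut_before L k s ! j))) (fst (snd (cut_before L k s ! j)) + complex_of_real (snd (snd (cut_before L k s ! j))) * d) \<subseteq> face_region (V (fst (cut_before L k s ! j)))"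
    proof cases
      case 1 then show ?thesis using geodesic_piece[OF g, of j] k nth by simp
    next
      case 2 then show ?thesis using geodesic_piece[OF g k] s sub nth by simp
    qed
  next
    fix j assume "Suc j < length (cut_before L k s)"
    then have j: "j < k" using nth by simp
    have "same_point n V sig (piece_end d (L ! j)) (fst (L ! Suc j), fst (snd (L ! Suc j)))"
      using g j k unfolding geodesic_segment_def by simp
    then show "same_point n V sig (piece_end d (cut_before L k s ! j)) (fst (cut_before L k s ! Suc j), fst (snd (cut_before L k s ! Suc j)))"
      using j nth by (cases "Suc j = k") auto
  qed
  show "seg_length (cut_before L k s) = piece_offset L k + s" by (simp add: cut_before_def piece_offset_def)
  show "piece_end d (last (cut_before L k s)) = (fst (L ! k), fst (snd (L ! k)) + complex_of_real s * d)"
    by (simp add: cut_before_def piece_end_def)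
  show "j \<le> k \<and> vertex_at n V d L j r" if "vertex_at n V d (cut_before L k s) j r"
    using that nth k s by (cases "j = k") (auto simp: vertex_at_def)
qed

lemma geodesic_cut_after:
  assumes g: "geodesic_segment n V sig d L" and k: "k < length L" and s: "0 \<le> s" "s \<le> snd (snd (L ! k))"
  shows "geodesic_segment n V sig d (cut_after d L k s)"
    "seg_length (cut_after d L k s) = seg_length L - piece_offset L k - s"
    "piece_end d (last (cut_after d L k s)) = piece_end d (last L)"
    "vertex_at n V d (cut_after d L k s) j r \<Longrightarrow>
       \<exists>j' r'. vertex_at n V d L j' r' \<and> piece_offset L j' + r' = piece_offset (cut_after d L k s) j + r + piece_offset L k + s"
proof -
  let ?C = "cut_after d L k s"
  have n0: "?C ! 0 = (fst (L ! k), fst (snd (L ! k)) + complex_of_real s * d, snd (snd (L ! k)) - s)"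
    by (simp add: cut_after_def)
  have nS: "?C ! Suc j = L ! (Suc k + j)" for j using k by (simp add: cut_after_def)
  have len: "length ?C = length L - k" using k by (simp add: cut_after_def)
  have sub: "closed_segment (fst (snd (L ! k)) + complex_of_real s * d) (fst (snd (L ! k)) + complex_of_real (snd (snd (L ! k))) * d) \<subseteq> face_region (V (fst (L ! k)))"
    using sub_segment[of s "snd (snd (L ! k))" "snd (snd (L ! k))" "fst (snd (L ! k))" d] s geodesic_piece(3)[OF g k] by auto
  have e0: "piece_end d (?C ! 0) = piece_end d (L ! k)" by (simp add: n0 piece_end_alt algebra_simps)
  show "geodesic_segment n V sig d ?C"
  proof (rule geodesicI)
    show "?C \<noteq> []" by (simp add: cut_after_def)
    fix j assume j: "j < length ?C"
    show "fst (?C ! j) < n \<and> 0 \<le> snd (snd (?C ! j)) \<and>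
      closed_segment (fst (snd (?C ! j))) (fst (snd (?C ! j)) + complex_of_real (snd (snd (?C ! j))) * d) \<subseteq> face_region (V (fst (?C ! j)))"
    proof (cases j)
      case 0 then show ?thesis using geodesic_piece[OF g k] s sub n0 by (simp add: algebra_simps)
    next
      case (Suc j') then show ?thesis using geodesic_piece[OF g, of "Suc k + j'"] j k len nS by simp
    qed
  next
    fix j assume j: "Suc j < length ?C"
    have "same_point n V sig (piece_end d (L ! (k + j))) (fst (L ! Suc (k + j)), fst (snd (L ! Suc (k + j))))"
      using g j k len unfolding geodesic_segment_def by simp
    then show "same_point n V sig (piece_end d (?C ! j)) (fst (?C ! Suc j), fst (snd (?C ! Suc j)))"
      using e0 nS by (cases j) auto
  qed
  have split: "L = take k L @ L ! k # drop (Suc k) L" using k by (simp add: id_take_nth_drop)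
  have "seg_length L = piece_offset L k + (snd (snd (L ! k)) + seg_length (drop (Suc k) L))"
    by (subst split) (simp only: seg_length_simps piece_offset_def)
  then show "seg_length ?C = seg_length L - piece_offset L k - s" by (simp add: cut_after_def)
  show "piece_end d (last ?C) = piece_end d (last L)"
  proof (cases "Suc k = length L")
    case True
    then have "drop (Suc k) L = []" by simp
    then have "last ?C = ?C ! 0" by (simp add: cut_after_def)
    moreover have "L \<noteq> []" "length L - 1 = k" using True k by auto
    then have "last L = L ! k" by (simp add: last_conv_nth)
    ultimately have "last ?C = ?C ! 0" "last L = L ! k" by auto
    then show ?thesis using e0 by simp
  next
    case False
    then show ?thesis using k by (simp add: cut_after_def last_drop)
  qed
  have off: "piece_offset ?C (Suc j) = piece_offset L (Suc k + j) - piece_offset L k - s" if "Suc k + j \<le> length L" for j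
    using that
  proof (induction j)
    case 0 then show ?case using piece_offset_Suc[OF k] by (simp add: piece_offset_def cut_after_def)
  next
    case (Suc j)
    then show ?case using piece_offset_Suc[of "Suc j" ?C] piece_offset_Suc[of "Suc k + j" L] len nS[of j] by simp
  qed
  show "\<exists>j' r'. vertex_at n V d L j' r' \<and> piece_offset L j' + r' = piece_offset ?C j + r + piece_offset L k + s"
    if v: "vertex_at n V d ?C j r"
  proof (cases j)
    case 0
    then show ?thesis using v n0 k s
      by (intro exI[of _ k] exI[of _ "s + r"]) (auto simp: vertex_at_def algebra_simps)
  next
    case (Suc j')
    have "Suc k + j' < length L" using v Suc len by (auto simp: vertex_at_def)
    then show ?thesis using v nS off[of j'] Suc
      by (intro exI[of _ "Suc k + j'"] exI[of _ r]) (auto simp: vertex_at_def)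
  qed
qed

text \<open>Each piece meets finitely many vertices, so there is a first vertex time after that of
  \<open>(k1, s1)\<close>. Cutting at these two positions leaves no vertex in the open time interval
  between them. All later uses of the absence of saddle connections go through this form.\<close>

lemma saddle_connection_between:
  assumes g: "geodesic_segment n V sig d L" and d: "d \<noteq> 0"
    and v1: "vertex_at n V d L k1 s1" and v2: "vertex_at n V d L k2 s2"
    and less: "piece_offset L k1 + s1 < piece_offset L k2 + s2"
  shows "\<exists>L'. saddle_connection n V sig d L'"
proof -
  define TT where "TT = {piece_offset L k + s |k s. vertex_at n V d L k s}"
  have "finite {s. vertex_at n V d L k s}" for k
  proof (cases "k < length L")
    case True
    have "finite ((\<lambda>s. fst (snd (L ! k)) + complex_of_real s * d) -` set (V (fst (L ! k))))"
      using d by (intro finite_vimageI) (auto simp: inj_def)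
    then show ?thesis by (rule finite_subset[rotated]) (auto simp: vertex_at_def is_vertex_def)
  qed (auto simp: vertex_at_def)
  moreover have "TT = (\<Union>k<length L. (\<lambda>s. piece_offset L k + s) ` {s. vertex_at n V d L k s})"
    by (auto simp: TT_def vertex_at_def)
  ultimately have fin: "finite TT" by simp
  define \<sigma> where "\<sigma> = piece_offset L k1 + s1"
  define TS where "TS = {\<tau> \<in> TT. \<sigma> < \<tau>}"
  have TS: "finite TS" "TS \<noteq> {}" using fin v2 less by (auto simp: TS_def TT_def \<sigma>_def)
  have "Min TS \<in> TS" using Min_in[OF TS] .
  then obtain k s where ks: "vertex_at n V d L k s" "Min TS = piece_offset L k + s" "\<sigma> < piece_offset L k + s"
    by (auto simp: TS_def TT_def)
  have gap: False if "vertex_at n V d L j r" "\<sigma> < piece_offset L j + r" "piece_offset L j + r < piece_offset L k + s" for j r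
  proof -
    have "piece_offset L j + r \<in> TS" using that by (auto simp: TS_def TT_def)
    then show False using Min_le[OF TS(1)] ks(2) that(3) by fastforce
  qed
  have k: "k < length L" "0 \<le> s" "s \<le> snd (snd (L ! k))" and k1: "k1 < length L" "0 \<le> s1" "s1 \<le> snd (snd (L ! k1))"
    using ks v1 by (auto simp: vertex_at_def)
  have le: "k1 \<le> k"
  proof (rule ccontr)
    assume "\<not> k1 \<le> k"
    then have "piece_offset L (Suc k) \<le> piece_offset L k1" using k1 by (intro piece_offset_mono[OF g]) auto
    then show False using ks(3) k k1 piece_offset_Suc[OF k(1)] by (simp add: \<sigma>_def)
  qed
  define P where "P = cut_before L k s"
  note P = geodesic_cut_before[OF g k, folded P_def]
  note Pn = cut_before_nth[OF k(1), where s=s, folded P_def]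
  have k1P: "k1 < length P" "0 \<le> s1" "s1 \<le> snd (snd (P ! k1))"
    using Pn le k1 ks(3) by (cases "k1 = k"; auto simp: \<sigma>_def)+
  define C where "C = cut_after d P k1 s1"
  note C = geodesic_cut_after[OF P(1) k1P, folded C_def]
  have st: "fst (P ! k1) = fst (L ! k1)" "fst (snd (P ! k1)) = fst (snd (L ! k1))"
    using Pn le by (cases "k1 = k"; auto)+
  have oP: "piece_offset P j = piece_offset L j" if "j \<le> k" for j using Pn(4)[OF that] .
  have "saddle_connection n V sig d C"
    unfolding saddle_connection_def
  proof (intro conjI allI impI)
    show "geodesic_segment n V sig d C" by (rule C(1))
    show "0 < seg_length C" using C(2) P(2) oP[OF le] ks(3) by (simp add: \<sigma>_def)
    show "is_vertex n V (fst (hd C), fst (snd (hd C)))" using v1 st by (simp add: C_def cut_after_def vertex_at_def)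
    show "is_vertex n V (piece_end d (last C))" using C(3) P(3) ks(1) by (simp add: vertex_at_def)
    fix j r assume j: "j < length C" and r: "0 \<le> r \<and> r \<le> snd (snd (C ! j)) \<and> 0 < piece_offset C j + r \<and> piece_offset C j + r < seg_length C"
    show "\<not> is_vertex n V (fst (C ! j), fst (snd (C ! j)) + complex_of_real r * d)"
    proof
      assume "is_vertex n V (fst (C ! j), fst (snd (C ! j)) + complex_of_real r * d)"
      then have "vertex_at n V d C j r" using j r by (simp add: vertex_at_def)
      from C(4)[OF this] obtain j' r' where jr: "vertex_at n V d P j' r'"
        "piece_offset P j' + r' = piece_offset C j + r + piece_offset P k1 + s1" by blast
      have "j' \<le> k" "vertex_at n V d L j' r'" using P(4)[OF jr(1)] by auto
      then show False using gap[of j' r'] jr(2) oP[of j'] oP[OF le] r C(2) P(2) by (simp add: \<sigma>_def)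
    qed
  qed
  then show ?thesis by blast
qed

section \<open>Visit measure under cutting\<close>

lemma visit_measure_simps [simp]:
  "visit_measure d G [] = 0"
  "visit_measure d G (p # L) = measure lborel {s. 0 \<le> s \<and> s \<le> snd (snd p) \<and> (fst p, fst (snd p) + complex_of_real s * d) \<in> G} + visit_measure d G L"
  "visit_measure d G (L @ M) = visit_measure d G L + visit_measure d G M"
  by (auto simp: visit_measure_def split: prod.splits)

lemma visit_measure_nonneg: "0 \<le> visit_measure d G L"
  by (induction L) auto

lemma visit_set_measurable:
  assumes "\<And>i. {p. (i, p) \<in> G} \<in> sets borel"
  shows "{s. a \<le> s \<and> s \<le> b \<and> (i, z + complex_of_real s * d) \<in> G} \<in> sets borel" "emeasure lborel {s. a \<le> s \<and> s \<le> b \<and> (i, z + complex_of_real s * d) \<in> G} < \<infinity>"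
proof -
  have "(\<lambda>s. z + complex_of_real s * d) \<in> borel_measurable borel"
    by (intro borel_measurable_continuous_onI continuous_intros)
  from measurable_sets[OF this assms[of i]] have "(\<lambda>s. z + complex_of_real s * d) -` {p. (i, p) \<in> G} \<in> sets borel" by simp
  moreover have eq: "{s. a \<le> s \<and> s \<le> b \<and> (i, z + complex_of_real s * d) \<in> G} = {a..b} \<inter> (\<lambda>s. z + complex_of_real s * d) -` {p. (i, p) \<in> G}" by auto
  ultimately show m: "{s. a \<le> s \<and> s \<le> b \<and> (i, z + complex_of_real s * d) \<in> G} \<in> sets borel" by auto
  have "emeasure lborel {s. a \<le> s \<and> s \<le> b \<and> (i, z + complex_of_real s * d) \<in> G} \<le> emeasure lborel {a..b}"
    by (rule emeasure_mono) auto
  also have "\<dots> < \<infinity>" by (simp add: emeasure_lborel_Icc_eq)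
  finally show "emeasure lborel {s. a \<le> s \<and> s \<le> b \<and> (i, z + complex_of_real s * d) \<in> G} < \<infinity>" .
qed

lemma visit_cut_before:
  assumes G: "\<And>i. {p. (i, p) \<in> G} \<in> sets borel" and k: "k < length L" and s: "s \<le> snd (snd (L ! k))"
  shows "visit_measure d G (cut_before L k s) \<le> visit_measure d G L"
proof -
  have "measure lborel {r. 0 \<le> r \<and> r \<le> s \<and> (fst (L ! k), fst (snd (L ! k)) + complex_of_real r * d) \<in> G}
     \<le> measure lborel {r. 0 \<le> r \<and> r \<le> snd (snd (L ! k)) \<and> (fst (L ! k), fst (snd (L ! k)) + complex_of_real r * d) \<in> G}"
    by (rule measure_mono_fmeasurable) (use s visit_set_measurable[OF G] in \<open>auto simp: fmeasurable_def\<close>)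
  moreover have split: "L = take k L @ L ! k # drop (Suc k) L" using k by (simp add: id_take_nth_drop)
  have "visit_measure d G L = visit_measure d G (take k L) + (measure lborel {r. 0 \<le> r \<and> r \<le> snd (snd (L ! k)) \<and> (fst (L ! k), fst (snd (L ! k)) + complex_of_real r * d) \<in> G} + visit_measure d G (drop (Suc k) L))"
    by (subst split) (simp only: visit_measure_simps)
  ultimately show ?thesis using visit_measure_nonneg[of d G "drop (Suc k) L"] by (simp add: cut_before_def)
qed

text \<open>What remains of the cut piece is parametrised from 0 again. Translation invariance,
  applied to the completed measure, compares it with the original parameters.\<close>

lemma visit_cut_after:
  assumes G: "\<And>i. {p. (i, p) \<in> G} \<in> sets borel" and k: "k < length L" and s: "0 \<le> s"
  shows "visit_measure d G (cut_after d L k s) \<le> visit_measure d G L"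
proof -
  let ?i = "fst (L ! k)" and ?z = "fst (snd (L ! k))" and ?l = "snd (snd (L ! k))"
  let ?A = "{r. s \<le> r \<and> r \<le> ?l \<and> (?i, ?z + complex_of_real r * d) \<in> G}"
  have "{r. 0 \<le> r \<and> r \<le> ?l - s \<and> (?i, ?z + complex_of_real s * d + complex_of_real r * d) \<in> G} = (+) (- s) ` ?A"
  proof (intro set_eqI iffI)
    fix r assume "r \<in> {r. 0 \<le> r \<and> r \<le> ?l - s \<and> (?i, ?z + complex_of_real s * d + complex_of_real r * d) \<in> G}"
    then have "s + r \<in> ?A" by (auto simp: algebra_simps)
    then show "r \<in> (+) (- s) ` ?A" by (rule rev_image_eqI) simp
  qed (auto simp: algebra_simps)
  then have "measure lebesgue {r. 0 \<le> r \<and> r \<le> ?l - s \<and> (?i, ?z + complex_of_real s * d + complex_of_real r * d) \<in> G} = measure lebesgue ?A"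
    by (simp only: measure_translation)
  then have "measure lborel {r. 0 \<le> r \<and> r \<le> ?l - s \<and> (?i, ?z + complex_of_real s * d + complex_of_real r * d) \<in> G} = measure lborel ?A"
    using visit_set_measurable(1)[OF G, of s ?l ?i ?z d] visit_set_measurable(1)[OF G, of 0 "?l - s" ?i "?z + complex_of_real s * d" d]
    by (simp only: measure_completion sets_lborel)
  also have "\<dots> \<le> measure lborel {r. 0 \<le> r \<and> r \<le> ?l \<and> (?i, ?z + complex_of_real r * d) \<in> G}"
    by (rule measure_mono_fmeasurable) (use s visit_set_measurable[OF G] in \<open>auto simp: fmeasurable_def\<close>)
  finally have 1: "measure lborel {r. 0 \<le> r \<and> r \<le> ?l - s \<and> (?i, ?z + complex_of_real s * d + complex_of_real r * d) \<in> G}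
      \<le> measure lborel {r. 0 \<le> r \<and> r \<le> ?l \<and> (?i, ?z + complex_of_real r * d) \<in> G}" .
  have split: "L = take k L @ L ! k # drop (Suc k) L" using k by (simp add: id_take_nth_drop)
  have "visit_measure d G L = visit_measure d G (take k L) + (measure lborel {r. 0 \<le> r \<and> r \<le> ?l \<and> (?i, ?z + complex_of_real r * d) \<in> G} + visit_measure d G (drop (Suc k) L))"
    by (subst split) (simp only: visit_measure_simps)
  then show ?thesis using visit_measure_nonneg[of d G "take k L"] 1 by (simp add: cut_after_def)
qed

text \<open>As long as there is no saddle connection, a geodesic meets at most one vertex, so one of its
  two halves avoids the vertices, after shortening it a little.\<close>

lemma vertex_free_part:
  assumes g: "geodesic_segment n V sig d L" and d: "d \<noteq> 0"
    and G: "\<And>i. {p. (i, p) \<in> G} \<in> sets borel"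
    and nosc: "\<And>L'. \<not> saddle_connection n V sig d L'" and len: "0 < seg_length L"
  obtains L' where "geodesic_segment n V sig d L'" "seg_length L / 3 \<le> seg_length L'"
    "visit_measure d G L' \<le> visit_measure d G L" "\<And>k s. \<not> vertex_at n V d L' k s"
proof (cases "\<exists>k s. vertex_at n V d L k s")
  case False
  then show ?thesis using that g len by auto
next
  case True
  then obtain k0 s0 where v0: "vertex_at n V d L k0 s0" by blast
  define \<sigma> where "\<sigma> = piece_offset L k0 + s0"
  let ?\<Lambda> = "seg_length L"
  have only: "piece_offset L k + s = \<sigma>" if "vertex_at n V d L k s" for k s
    using saddle_connection_between[OF g d v0 that] saddle_connection_between[OF g d that v0] nosc
    unfolding \<sigma>_def by (meson linorder_neqE_linordered_idom)
  have find: "\<exists>k s. k < length L \<and> 0 \<le> s \<and> s \<le> snd (snd (L ! k)) \<and> piece_offset L k + s = \<tau>" if \<tau>: "0 \<le> \<tau>" "\<tau> \<le> ?\<Lambda>" for \<tau>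
  proof -
    obtain k where k: "k < length L" "piece_offset L k \<le> \<tau>" "\<tau> \<le> piece_offset L (Suc k)"
      using geodesic_piece_at[OF g \<tau>] by blast
    show ?thesis using k piece_offset_Suc[OF k(1)] by (intro exI[of _ k] exI[of _ "\<tau> - piece_offset L k"]) auto
  qed
  \<comment> \<open>The outer third on the other side of the vertex is kept. A cut at the middle
    could leave the vertex as an end point.\<close>
  show ?thesis
  proof (cases "\<sigma> < ?\<Lambda> / 2")
    case True
    have s0: "0 \<le> \<sigma>" using v0 piece_offset_mono[OF g, of 0 k0] by (auto simp: \<sigma>_def vertex_at_def)
    obtain k s where ks: "k < length L" "0 \<le> s" "s \<le> snd (snd (L ! k))" "piece_offset L k + s = ?\<Lambda> * 2 / 3"
      using find[of "?\<Lambda> * 2 / 3"] len by auto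
    note C = geodesic_cut_after[OF g ks(1-3)]
    show ?thesis
    proof (rule that[OF C(1)])
      show "?\<Lambda> / 3 \<le> seg_length (cut_after d L k s)" using C(2) ks(4) by simp
      show "visit_measure d G (cut_after d L k s) \<le> visit_measure d G L" using visit_cut_after[OF G ks(1,2)] .
      fix j r show "\<not> vertex_at n V d (cut_after d L k s) j r"
      proof
        assume v: "vertex_at n V d (cut_after d L k s) j r"
        have "0 \<le> piece_offset (cut_after d L k s) j + r"
          using v piece_offset_mono[OF C(1), of 0 j] by (auto simp: vertex_at_def)
        then show False using C(4)[OF v] only ks(4) True len by force
      qed
    qed
  next
    case False
    obtain k s where ks: "k < length L" "0 \<le> s" "s \<le> snd (snd (L ! k))" "piece_offset L k + s = ?\<Lambda> / 3"
      using find[of "?\<Lambda> / 3"] len by auto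
    note C = geodesic_cut_before[OF g ks(1-3)]
    show ?thesis
    proof (rule that[OF C(1)])
      show "?\<Lambda> / 3 \<le> seg_length (cut_before L k s)" using C(2) ks(4) by simp
      show "visit_measure d G (cut_before L k s) \<le> visit_measure d G L" using visit_cut_before[OF G ks(1,3)] .
      fix j r show "\<not> vertex_at n V d (cut_before L k s) j r"
      proof
        assume v: "vertex_at n V d (cut_before L k s) j r"
        have j: "j \<le> k" "vertex_at n V d L j r" using C(4)[OF v] by auto
        have "r \<le> snd (snd (cut_before L k s ! j))" using v by (simp add: vertex_at_def)
        then have "piece_offset L j + r \<le> ?\<Lambda> / 3"
          using cut_before_nth[OF ks(1), where s=s] j(1) ks piece_offset_Suc[of j L] piece_offset_mono[OF g, of "Suc j" k]
          by (cases "j = k") auto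
        then show False using only[OF j(2)] False len by simp
      qed
    qed
  qed
qed

section \<open>The flow on germs of entering edges\<close>

lemma (in dir_polygon) strip_gn:
  assumes st: "\<And>w. p < w \<Longrightarrow> w < q \<Longrightarrow> w \<notin> vh" and m: "p < m" "m < q" and n: "nxt k m j"
  shows "gn k p 1 j" "gn k q (-1) j" "\<And>u s. p < u \<Longrightarrow> u < q \<Longrightarrow> side s \<Longrightarrow> gn k u s j"
proof -
  have nx: "nxt k w j" if "p < w" "w < q" for w using nxt_strip[OF st m that n] .
  have pq: "0 < q - p" using m by simp
  show "gn k p 1 j" unfolding gn_def using ev_small[OF pq] by eventually_elim (use nx in auto)
  show "gn k q (-1) j" unfolding gn_def using ev_small[OF pq] by eventually_elim (use nx in auto)
  fix u s assume u: "p < u" "u < q" and s: "side s"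
  show "gn k u s j" unfolding gn_def using ev_less[OF u(1), of s] ev_greater[OF u(2), of s] by eventually_elim (use nx in auto)
qed

locale flow_surface = direction d for d +
  fixes n :: nat and V :: "nat \<Rightarrow> complex list" and sig :: "nat \<times> nat \<Rightarrow> nat \<times> nat"
  assumes ts: "translation_surface n V sig"
    and no_saddle: "\<And>L. \<not> saddle_connection n V sig d L"
begin

lemma d_nz: "d \<noteq> 0" using d1 by auto

lemma polygon: "i < n \<Longrightarrow> jordan_polygon (V i)"
  using ts by (auto simp: translation_surface_def jordan_polygon_def)

lemma edges_iff: "e \<in> edges n V \<longleftrightarrow> fst e < n \<and> snd e < length (V (fst e))"
  by (auto simp: edges_def split: prod.splits)

lemma edge_start_end: "edge_start V e = vert_a (V (fst e)) (snd e)" "edge_end V e = vert_b (V (fst e)) (snd e)"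
  by (simp_all add: edge_start_def edge_end_def vert_a_def vert_b_def)

lemma sig_props:
  assumes "e \<in> edges n V"
  shows "sig e \<in> edges n V" "sig (sig e) = e" "edge_end V (sig e) - edge_start V (sig e) = - (edge_end V e - edge_start V e)"
proof -
  have "\<forall>e \<in> edges n V. sig e \<in> edges n V \<and> sig e \<noteq> e \<and> sig (sig e) = e
        \<and> edge_end V (sig e) - edge_start V (sig e) = - (edge_end V e - edge_start V e)"
    using ts unfolding translation_surface_def by blast
  then show "sig e \<in> edges n V" "sig (sig e) = e" "edge_end V (sig e) - edge_start V (sig e) = - (edge_end V e - edge_start V e)"
    using assms by blast+
qed

text \<open>A single piece is already a geodesic segment, and the vertices at its ends have
  different times, so \<open>saddle_connection_between\<close> applies.\<close>

lemma no_two_vertices: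
  assumes i: "i < n" and xy: "x < y" and v: "pnt d x t \<in> set (V i)" "pnt d y t \<in> set (V i)"
    and F: "\<And>w. x \<le> w \<Longrightarrow> w \<le> y \<Longrightarrow> pnt d w t \<in> face_region (V i)"
  shows False
proof -
  let ?L = "[(i, pnt d x t, y - x)]"
  have "geodesic_segment n V sig d ?L"
    using i xy closed_segment_d[of "y - x" x t] F by (intro geodesicI) auto
  moreover have "vertex_at n V d ?L 0 0" "vertex_at n V d ?L 0 (y - x)"
    using i xy v pnt_add_d[of x t "y - x"] by (auto simp: vertex_at_def is_vertex_def)
  ultimately have "\<exists>L'. saddle_connection n V sig d L'"
    using saddle_connection_between[of n V sig d ?L 0 0 0 "y - x"] xy d_nz by auto
  then show False using no_saddle by blast
qed

lemma dpolygon: assumes i: "i < n" shows "dir_polygon (V i) d"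
proof -
  interpret jordan_polygon "V i" by (rule polygon[OF i])
  show ?thesis
  proof
    fix k assume k: "k < length (V i)"
    show "hgt d (A k) \<noteq> hgt d (B k)"
    proof
      assume h: "hgt d (A k) = hgt d (B k)"
      let ?t = "hgt d (A k)"
      have eq: "A k = pnt d (xco d (A k)) ?t" "B k = pnt d (xco d (B k)) ?t"
        by (simp only: pnt_coords, simp only: h pnt_coords)
      have F: "pnt d w ?t \<in> face_region (V i)" if "min (xco d (A k)) (xco d (B k)) \<le> w" "w \<le> max (xco d (A k)) (xco d (B k))" for w
      proof -
        have "pnt d w ?t \<in> seg k"
        proof (cases "xco d (A k) \<le> xco d (B k)")
          case True
          have "B k = pnt d (xco d (A k)) ?t + of_real (xco d (B k) - xco d (A k)) * d" unfolding pnt_add_d by (simp, rule eq(2))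
          then show ?thesis using closed_segment_d[of "xco d (B k) - xco d (A k)" "xco d (A k)" ?t] True that eq(1) by auto
        next
          case False
          have "A k = pnt d (xco d (B k)) ?t + of_real (xco d (A k) - xco d (B k)) * d" unfolding pnt_add_d add.commute[of "xco d (B k)"] diff_add_cancel by (rule eq(1))
          then have "pnt d w ?t \<in> closed_segment (B k) (A k)" using closed_segment_d[of "xco d (A k) - xco d (B k)" "xco d (B k)" ?t] False that eq(2) by auto
          then show ?thesis by (simp add: closed_segment_commute)
        qed
        then show ?thesis using bdry_eq k by (auto simp: face_region_def)
      qed
      have ne: "xco d (A k) \<noteq> xco d (B k)" using seg_nondeg[OF k] eq by metis
      have v: "pnt d (xco d (A k)) ?t \<in> set (V i)" "pnt d (xco d (B k)) ?t \<in> set (V i)"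
        using A_vertex[OF k] B_vertex[OF k] eq by auto
      show False
      proof (cases "xco d (A k) < xco d (B k)")
        case True then show ?thesis using no_two_vertices[OF i True v] F by auto
      next
        case False then show ?thesis using no_two_vertices[OF i _ v(2,1)] ne F by auto
      qed
    qed
  qed
qed

section \<open>Edges of the surface and the return map on their germs\<close>

definition lo where "lo e = elo d (V (fst e)) (snd e)"
definition hi where "hi e = ehi d (V (fst e)) (snd e)"
definition f where "f e = ef d (V (fst e)) (snd e)"
definition slope where "slope e = esl d (V (fst e)) (snd e)"
definition entering where "entering e \<longleftrightarrow> ent d (V (fst e)) (snd e)"
definition E where "E = {e \<in> edges n V. entering e}"

lemma E_iff: "e \<in> E \<longleftrightarrow> e \<in> edges n V \<and> entering e" by (simp add: E_def)

text \<open>\<open>hc e\<close> and \<open>xc e\<close> are the coordinates of the translation that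
  carries \<open>sig e\<close> onto \<open>e\<close>. Glued edges run in opposite directions, so it
  takes the start of \<open>sig e\<close> to the end of \<open>e\<close>.\<close>

definition hc where "hc e = hgt d (edge_end V e - edge_start V (sig e))"
definition xc where "xc e = xco d (edge_end V e - edge_start V (sig e))"

lemma sig_edge:
  assumes e: "e \<in> edges n V"
  shows "entering (sig e) \<longleftrightarrow> \<not> entering e" "lo e = lo (sig e) + hc e" "hi e = hi (sig e) + hc e"
    "slope (sig e) = slope e" "f e (u + hc e) = f (sig e) u + xc e"
proof -
  let ?a = "edge_start V e" and ?b = "edge_end V e" and ?a' = "edge_start V (sig e)" and ?b' = "edge_end V (sig e)"
  have r: "?b' - ?a' = - (?b - ?a)" using sig_props[OF e] by simp
  interpret p: dir_polygon "V (fst e)" d by (rule dpolygon) (use e in \<open>simp add: edges_iff\<close>)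
  have ne: "hgt d ?a \<noteq> hgt d ?b" using p.transversal[of "snd e"] e by (simp add: edges_iff edge_start_end)
  have hb: "hgt d ?b' = hgt d ?a' - (hgt d ?b - hgt d ?a)" and xb: "xco d ?b' = xco d ?a' - (xco d ?b - xco d ?a)"
    using arg_cong[OF r, of "hgt d"] arg_cong[OF r, of "xco d"] by (simp_all add: hgt_diff hgt_minus xco_diff xco_minus)
  show "entering (sig e) \<longleftrightarrow> \<not> entering e"
    using hb ne by (auto simp: entering_def ent_def edge_start_end[symmetric])
  show "lo e = lo (sig e) + hc e" "hi e = hi (sig e) + hc e"
    using hb by (auto simp: lo_def hi_def elo_def ehi_def hc_def hgt_diff edge_start_end[symmetric] min_def max_def)
  show sl: "slope (sig e) = slope e"
    unfolding slope_def esl_def edge_start_end[symmetric] r hgt_minus xco_minus by simp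
  have "slope e * (hgt d ?b - hgt d ?a) = xco d ?b - xco d ?a"
    using ne by (simp add: slope_def esl_def edge_start_end[symmetric] hgt_diff xco_diff)
  moreover have fe: "f e w = xco d ?a + (w - hgt d ?a) * slope e" for w
    by (simp add: f_def ef_def slope_def edge_start_end[symmetric])
  moreover have fs: "f (sig e) w = xco d ?a' + (w - hgt d ?a') * slope e" for w
    unfolding sl[symmetric] by (simp add: f_def ef_def slope_def edge_start_end[symmetric])
  ultimately show "f e (u + hc e) = f (sig e) u + xc e"
    unfolding fe fs hc_def xc_def hgt_diff xco_diff by (simp add: algebra_simps)
qed

definition gnE where "gnE i = dir_polygon.gn (V i) d"
definition jx where "jx e t s = (THE j. gnE (fst e) (snd e) t s j)"
definition kx where "kx e t s = (THE k. gnE (fst (sig e)) k (t - hc e) s (snd (sig e)))"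
text \<open>One step forward crosses the face of \<open>e\<close> and then the edge where it is
  left, arriving at an entering edge again. One step backward, \<open>nx'\<close>, first crosses
  \<open>e\<close> into the neighbouring face. Accordingly the height changes by \<open>hc\<close>
  of the new edge or by minus \<open>hc\<close> of the old one.\<close>

definition nx where "nx e t s = sig (fst e, jx e t s)"
definition nx' where "nx' e t s = (fst (sig e), kx e t s)"

lemma finite_edges: "finite (edges n V)"
proof -
  have "edges n V = (SIGMA i:{..<n}. {..<length (V i)})" by (auto simp: edges_def)
  then show ?thesis by simp
qed

sublocale intervals E lo hi
proof
  show "finite E" using finite_edges by (simp add: E_def)
  fix e assume "e \<in> E"
  then have e: "fst e < n" "snd e < length (V (fst e))" by (auto simp: E_iff edges_iff)
  interpret p: dir_polygon "V (fst e)" d by (rule dpolygon[OF e(1)])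
  show "lo e < hi e" using p.lo_less_hi[OF e(2)] by (simp add: lo_def hi_def)
qed

lemma gn_edge:
  assumes i: "i < n" and s: "side s" and g: "gnE i k t s j"
  shows "(i, k) \<in> edges n V" "(i, j) \<in> edges n V" "f (i, k) t \<le> f (i, j) t"
    "f (i, k) t = f (i, j) t \<Longrightarrow> s * slope (i, k) < s * slope (i, j)"
    "(s = 1 \<and> lo (i, k) \<le> t \<and> t < hi (i, k) \<or> s = -1 \<and> lo (i, k) < t \<and> t \<le> hi (i, k))" "(s = 1 \<and> lo (i, j) \<le> t \<and> t < hi (i, j) \<or> s = -1 \<and> lo (i, j) < t \<and> t \<le> hi (i, j))"
proof -
  interpret p: dir_polygon "V i" d by (rule dpolygon[OF i])
  have g': "p.gn k t s j" using g by (simp add: gnE_def)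
  note gg = p.gn_germ[OF s g']
  show "(i, k) \<in> edges n V" "(i, j) \<in> edges n V" using gg i by (auto simp: edges_iff p.germ_on_def)
  show "f (i, k) t \<le> f (i, j) t" using p.gn_le[OF g'] by (simp add: f_def)
  show "f (i, k) t = f (i, j) t \<Longrightarrow> s * slope (i, k) < s * slope (i, j)"
    using p.gn_slope[OF g'] by (simp add: f_def slope_def)
  show "(s = 1 \<and> lo (i, k) \<le> t \<and> t < hi (i, k) \<or> s = -1 \<and> lo (i, k) < t \<and> t \<le> hi (i, k))" "(s = 1 \<and> lo (i, j) \<le> t \<and> t < hi (i, j) \<or> s = -1 \<and> lo (i, j) < t \<and> t \<le> hi (i, j))"
    using gg by (simp_all add: p.germ_on_def lo_def hi_def)
qed

lemma gn_valid:
  assumes i: "i < n" and s: "side s" and g: "gnE i k t s j" and k: "entering (i, k)" and j: "\<not> entering (i, j)"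
  shows "valid ((i, k), t, s)" "valid (sig (i, j), t + hc (sig (i, j)), s)"
proof -
  note gg = gn_edge[OF i s g]
  note gr = gg(5,6)
  show "valid ((i, k), t, s)" using gr gg(1) k by (auto simp: valid_iff E_iff)
  have sj: "sig (i, j) \<in> edges n V" "entering (sig (i, j))" using sig_props[OF gg(2)] sig_edge(1)[OF gg(2)] j by auto
  show "valid (sig (i, j), t + hc (sig (i, j)), s)"
    using gr sj sig_edge(2,3)[OF sj(1)] sig_props(2)[OF gg(2)] by (auto simp: valid_iff E_iff)
qed

lemma gn_unique:
  assumes i: "i < n"
  shows "gnE i k t s j \<Longrightarrow> gnE i k t s j' \<Longrightarrow> j = j'" "gnE i k t s j \<Longrightarrow> gnE i k' t s j \<Longrightarrow> k = k'"
proof -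
  interpret p: dir_polygon "V i" d by (rule dpolygon[OF i])
  show "gnE i k t s j \<Longrightarrow> gnE i k t s j' \<Longrightarrow> j = j'" "gnE i k t s j \<Longrightarrow> gnE i k' t s j \<Longrightarrow> k = k'"
    using p.gn_unique p.gn_unique' by (auto simp: gnE_def)
qed

lemma jx_eq: "fst e < n \<Longrightarrow> gnE (fst e) (snd e) t s j \<Longrightarrow> jx e t s = j"
  unfolding jx_def using gn_unique(1) by blast

lemma kx_eq: "fst (sig e) < n \<Longrightarrow> gnE (fst (sig e)) k (t - hc e) s (snd (sig e)) \<Longrightarrow> kx e t s = k"
  unfolding kx_def using gn_unique(2) by blast

lemma forward:
  assumes v: "valid (e, t, s)"
  shows "fst e < n" "side s" "gnE (fst e) (snd e) t s (jx e t s)" "\<not> entering (fst e, jx e t s)"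
    "valid (nx e t s, t + hc (nx e t s), s)"
proof -
  show i: "fst e < n" and s: "side s" using v by (auto simp: valid_iff E_iff edges_iff side_def)
  interpret p: dir_polygon "V (fst e)" d by (rule dpolygon[OF i])
  have g: "p.germ_on (snd e) t s" using v by (auto simp: valid_iff p.germ_on_def E_iff edges_iff lo_def hi_def)
  have en: "ent d (V (fst e)) (snd e)" using v by (simp add: valid_iff E_iff entering_def)
  obtain j where j: "p.gn (snd e) t s j" "\<not> ent d (V (fst e)) j" using p.entering_gn[OF s g en] .
  have je: "jx e t s = j" using jx_eq[OF i] j(1) by (simp add: gnE_def)
  show 1: "gnE (fst e) (snd e) t s (jx e t s)" using j je by (simp add: gnE_def)
  show 2: "\<not> entering (fst e, jx e t s)" using j je by (simp add: entering_def)
  show "valid (nx e t s, t + hc (nx e t s), s)"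
    using gn_valid(2)[OF i s 1 _ 2] en by (simp add: nx_def entering_def)
qed

lemma backward:
  assumes v: "valid (e, t, s)"
  shows "fst (sig e) < n" "side s" "gnE (fst (sig e)) (kx e t s) (t - hc e) s (snd (sig e))" "entering (nx' e t s)"
    "valid (nx' e t s, t - hc e, s)"
proof -
  have eE: "e \<in> edges n V" "entering e" using v by (auto simp: valid_iff E_iff)
  note se = sig_props[OF eE(1)] sig_edge[OF eE(1)]
  show i: "fst (sig e) < n" and s: "side s" using v se by (auto simp: valid_iff edges_iff side_def)
  interpret p: dir_polygon "V (fst (sig e))" d by (rule dpolygon[OF i])
  have g: "p.germ_on (snd (sig e)) (t - hc e) s"
    using v se by (auto simp: valid_iff p.germ_on_def edges_iff lo_def hi_def)
  have en: "\<not> ent d (V (fst (sig e))) (snd (sig e))" using se eE by (simp add: entering_def)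
  obtain k where k: "p.gn k (t - hc e) s (snd (sig e))" "ent d (V (fst (sig e))) k" using p.leaving_gn[OF s g en] .
  have ke: "kx e t s = k" using kx_eq[OF i] k(1) by (simp add: gnE_def)
  show 1: "gnE (fst (sig e)) (kx e t s) (t - hc e) s (snd (sig e))" using k ke by (simp add: gnE_def)
  show 2: "entering (nx' e t s)" using k ke by (simp add: entering_def nx'_def)
  show "valid (nx' e t s, t - hc e, s)"
    using gn_valid(1)[OF i s 1] 2 en by (simp add: nx'_def entering_def)
qed

text \<open>Discontinuities can only come from vertices of the face that is crossed. For the
  backward step, with \<open>D'\<close>, this is the face of \<open>sig e\<close>, and its vertex
  heights are translated to the heights on \<open>e\<close>.\<close>

definition D where "D = (SIGMA e:E. dir_polygon.vh (V (fst e)) d)"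
definition D' where "D' = (SIGMA e:E. (\<lambda>v. v + hc e) ` dir_polygon.vh (V (fst (sig e))) d)"

sublocale F: germ_map E lo hi nx "\<lambda>e e'. hc e'" D
proof
  have "finite (dir_polygon.vh (V (fst e)) d)" if "e \<in> E" for e
  proof -
    interpret p: dir_polygon "V (fst e)" d by (rule dpolygon) (use that in \<open>auto simp: E_iff edges_iff\<close>)
    show ?thesis by (rule p.finite_vh)
  qed
  then show "finite D" using finE by (auto simp: D_def)
  show "valid (nx e t s, t + hc (nx e t s), s)" if "valid (e, t, s)" for e t s using forward(5)[OF that] .
  fix e p q
  assume a: "e \<in> E" "lo e \<le> p" "p < q" "q \<le> hi e" "\<And>u. p < u \<Longrightarrow> u < q \<Longrightarrow> (e, u) \<notin> D"
  then have i: "fst e < n" "snd e < length (V (fst e))" "ent d (V (fst e)) (snd e)" by (auto simp: E_iff edges_iff entering_def)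
  interpret p: dir_polygon "V (fst e)" d by (rule dpolygon[OF i(1)])
  have st: "w \<notin> p.vh" if "p < w" "w < q" for w using a(5)[OF that] a(1) by (auto simp: D_def)
  define m where "m = (p + q) / 2"
  have m: "p < m" "m < q" using a by (auto simp: m_def)
  have "p.spn (snd e) m" using m a i by (auto simp: p.spn_def lo_def hi_def)
  from p.entering_nxt[OF this i(3) st[OF m]] obtain j where "p.nxt (snd e) m j" by metis
  note S = p.strip_gn[OF st m this]
  have "jx e p 1 = j" "jx e q (-1) = j" "\<And>u s. p < u \<Longrightarrow> u < q \<Longrightarrow> side s \<Longrightarrow> jx e u s = j"
    using S jx_eq[OF i(1)] by (auto simp: gnE_def)
  then show "\<exists>j. nx e p 1 = j \<and> nx e q (- 1) = j \<and> (\<forall>u s. p < u \<and> u < q \<and> side s \<longrightarrow> nx e u s = j)"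
    by (auto simp: nx_def)
qed

sublocale B: germ_map E lo hi nx' "\<lambda>e e'. - hc e" D'
proof
  have "finite (dir_polygon.vh (V (fst (sig e))) d)" if "e \<in> E" for e
  proof -
    interpret p: dir_polygon "V (fst (sig e))" d by (rule dpolygon) (use that sig_props(1)[of e] in \<open>auto simp: E_iff edges_iff\<close>)
    show ?thesis by (rule p.finite_vh)
  qed
  then show "finite D'" using finE by (auto simp: D'_def)
  show "valid (nx' e t s, t + - hc e, s)" if "valid (e, t, s)" for e t s using backward(5)[OF that] by simp
  fix e p q
  assume a: "e \<in> E" "lo e \<le> p" "p < q" "q \<le> hi e" "\<And>u. p < u \<Longrightarrow> u < q \<Longrightarrow> (e, u) \<notin> D'"
  then have eE: "e \<in> edges n V" "entering e" by (auto simp: E_iff)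
  note se = sig_props[OF eE(1)] sig_edge[OF eE(1)]
  have i: "fst (sig e) < n" "snd (sig e) < length (V (fst (sig e)))" "\<not> ent d (V (fst (sig e))) (snd (sig e))"
    using se eE by (auto simp: edges_iff entering_def)
  interpret p: dir_polygon "V (fst (sig e))" d by (rule dpolygon[OF i(1)])
  have st: "w \<notin> p.vh" if "p - hc e < w" "w < q - hc e" for w
  proof
    assume "w \<in> p.vh"
    then have "(e, w + hc e) \<in> D'" using a(1) by (auto simp: D'_def)
    then show False using a(5)[of "w + hc e"] that by auto
  qed
  define m where "m = (p + q) / 2 - hc e"
  have m: "p - hc e < m" "m < q - hc e" using a by (auto simp: m_def)
  have "p.spn (snd (sig e)) m" using m a i se by (auto simp: p.spn_def lo_def hi_def)
  from p.leaving_nxt[OF this i(3) st[OF m]] obtain k where "p.nxt k m (snd (sig e))" by metis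
  note S = p.strip_gn[OF st m this]
  have "kx e p 1 = k" "kx e q (-1) = k" using S kx_eq[OF i(1)] by (auto simp: gnE_def)
  moreover have "kx e u s = k" if "p < u" "u < q" "side s" for u s
    using S(3)[of "u - hc e" s] kx_eq[OF i(1)] that by (auto simp: gnE_def)
  ultimately show "\<exists>j. nx' e p 1 = j \<and> nx' e q (- 1) = j \<and> (\<forall>u s. p < u \<and> u < q \<and> side s \<longrightarrow> nx' e u s = j)"
    by (auto simp: nx'_def)
qed

lemma BF_T: assumes v: "valid x" shows "B.T (F.T x) = x"
proof -
  obtain e t s where x: "x = (e, t, s)" by (cases x)
  note fw = forward[OF v[unfolded x]]
  let ?e = "nx e t s"
  have ej: "(fst e, jx e t s) \<in> edges n V" using gn_edge(2)[OF fw(1-3)] .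
  have se: "sig ?e = (fst e, jx e t s)" using sig_props(2)[OF ej] by (simp add: nx_def)
  have "kx ?e (t + hc ?e) s = snd e" using kx_eq[of ?e "snd e" "t + hc ?e" s] se fw by simp
  then show ?thesis using se by (simp add: x F.T_eq B.T_eq nx'_def)
qed

lemma FB_T: assumes v: "valid x" shows "F.T (B.T x) = x"
proof -
  obtain e t s where x: "x = (e, t, s)" by (cases x)
  note bw = backward[OF v[unfolded x]]
  let ?e = "nx' e t s"
  have "jx ?e (t - hc e) s = snd (sig e)" using jx_eq[of ?e "t - hc e" s "snd (sig e)"] bw by (simp add: nx'_def)
  then have "nx ?e (t - hc e) s = e"
    using sig_props(2)[of e] v x by (simp add: nx_def valid_iff E_iff) (simp add: nx'_def)
  then show ?thesis by (simp add: x F.T_eq B.T_eq)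
qed

section \<open>Orbits of germs as geodesic segments\<close>

definition plen where "plen x = (case x of (e, t, s) \<Rightarrow> f (fst e, jx e t s) t - f e t)"
definition pstart where "pstart x = (case x of (e, t, s) \<Rightarrow> pnt d (f e t) t)"
definition face where "face x = (case x of (e, t, s :: real) \<Rightarrow> fst (e :: nat \<times> nat))"
definition pc where "pc x = (face x, pstart x, plen x)"
text \<open>Both ends of the piece are included, so the vertex may be the base point of the germ.\<close>

definition crit where "crit x \<longleftrightarrow> (\<exists>r. 0 \<le> r \<and> r \<le> plen x \<and> is_vertex n V (face x, pstart x + of_real r * d))"

lemma piece_props:
  assumes v: "valid x"
  shows "face x < n" "0 \<le> plen x" "closed_segment (pstart x) (pstart x + of_real (plen x) * d) \<subseteq> face_region (V (face x))"
proof -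
  obtain e t s where x: "x = (e, t, s)" by (cases x)
  note fw = forward[OF v[unfolded x]]
  show "face x < n" using fw by (simp add: face_def x)
  show l: "0 \<le> plen x" using gn_edge(3)[OF fw(1-3)] by (simp add: plen_def x)
  interpret p: dir_polygon "V (fst e)" d by (rule dpolygon[OF fw(1)])
  have en: "ent d (V (fst e)) (snd e)" using v by (simp add: x valid_iff E_iff entering_def)
  have "pnt d y t \<in> face_region (V (fst e))" if "f e t \<le> y" "y \<le> f (fst e, jx e t s) t" for y
    using p.gn_chord[OF fw(2) fw(3)[unfolded gnE_def] en, of y] that by (simp add: f_def)
  then show "closed_segment (pstart x) (pstart x + of_real (plen x) * d) \<subseteq> face_region (V (face x))"
    using closed_segment_d[OF l, of "f e t" t] by (auto simp: pstart_def face_def plen_def x)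
qed

lemma piece_glue:
  assumes v: "valid x"
  shows "glue n V sig (face x, pstart x + of_real (plen x) * d) (face (F.T x), pstart (F.T x))"
proof -
  obtain e t s where x: "x = (e, t, s)" by (cases x)
  note fw = forward[OF v[unfolded x]]
  let ?j = "(fst e, jx e t s)" and ?e = "nx e t s"
  have ej: "?j \<in> edges n V" using gn_edge(2)[OF fw(1-3)] .
  have se: "sig ?e = ?j" "?e \<in> edges n V" using sig_props[OF ej] by (simp_all add: nx_def)
  interpret p: dir_polygon "V (fst e)" d by (rule dpolygon[OF fw(1)])
  have "pnt d (f ?j t) t \<in> p.seg (jx e t s)"
    using p.germ_range[OF conjunct2[OF p.gn_germ[OF fw(2) fw(3)[unfolded gnE_def]]]] p.f_mem_seg by (simp add: f_def)
  moreover have "pnt d (f ?e (t + hc ?e)) (t + hc ?e) = pnt d (f ?j t) t + (edge_end V (sig ?j) - edge_start V ?j)"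
  proof -
    have "f ?e (t + hc ?e) = f ?j t + xc ?e" using sig_edge(5)[OF se(2)] se(1) by simp
    moreover have "pnt d (xc ?e) (hc ?e) = edge_end V ?e - edge_start V (sig ?e)" by (simp add: xc_def hc_def pnt_coords)
    moreover have "pnt d (a + b) (a' + b') = pnt d a a' + pnt d b b'" for a b a' b'
      by (simp add: pnt_def complex_eq_iff algebra_simps)
    ultimately show ?thesis using se(1) by (simp add: nx_def)
  qed
  ultimately show ?thesis unfolding glue_def
    by (intro bexI[OF _ ej]) (auto simp: x face_def pstart_def plen_def pnt_add_d F.T_eq edge_start_end nx_def simp del: of_real_diff)
qed

lemma glue_sym: assumes "glue n V sig x y" shows "glue n V sig y x"
proof -
  obtain e where e: "e \<in> edges n V" "fst e = fst x" "snd x \<in> closed_segment (edge_start V e) (edge_end V e)"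
    "fst y = fst (sig e)" "snd y = snd x + (edge_end V (sig e) - edge_start V e)"
    using assms by (auto simp: glue_def)
  note se = sig_props[OF e(1)]
  let ?c = "edge_end V (sig e) - edge_start V e"
  have "edge_start V (sig e) = ?c + edge_end V e" using se(3) by (simp add: algebra_simps)
  moreover have "snd y = ?c + snd x" "edge_end V (sig e) = ?c + edge_start V e" using e by simp_all
  moreover have "?c + snd x \<in> closed_segment (?c + edge_end V e) (?c + edge_start V e)"
    using e(3) closed_segment_translation_eq[of ?c "snd x" "edge_end V e" "edge_start V e"]
      by (metis closed_segment_commute)
  ultimately have 1: "snd y \<in> closed_segment (edge_start V (sig e)) (edge_end V (sig e))" by metis
  have 2: "snd x = snd y + (edge_end V (sig (sig e)) - edge_start V (sig e))"
  proof -
    have "edge_end V (sig e) = edge_start V (sig e) - edge_end V e + edge_start V e"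
      using se(3) by (simp add: diff_eq_eq)
    then show ?thesis using e(5) se(2) by simp
  qed
  show ?thesis unfolding glue_def
    by (intro bexI[OF _ se(1)] conjI 1 2 e(4)[symmetric]) (simp add: se(2) e(2))
qed

text \<open>A vertex on an edge is one of its ends, and gluing takes ends to ends.\<close>

lemma glue_vertex: assumes "glue n V sig x y" "is_vertex n V x" shows "is_vertex n V y"
proof -
  obtain e where e: "e \<in> edges n V" "fst e = fst x" "snd x \<in> closed_segment (edge_start V e) (edge_end V e)"
    "fst y = fst (sig e)" "snd y = snd x + (edge_end V (sig e) - edge_start V e)"
    using assms by (auto simp: glue_def)
  note se = sig_props[OF e(1)]
  have l: "fst e < n" "snd e < length (V (fst e))" "fst (sig e) < n" "snd (sig e) < length (V (fst (sig e)))"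
    using e(1) se(1) by (auto simp: edges_iff)
  interpret p: jordan_polygon "V (fst e)" by (rule polygon[OF l(1)])
  interpret q: jordan_polygon "V (fst (sig e))" by (rule polygon[OF l(3)])
  have "snd x \<in> {edge_start V e, edge_end V e}"
    using p.vertex_on_seg[OF _ l(2), of "snd x"] e assms(2) by (auto simp: is_vertex_def edge_start_end)
  then have "snd y \<in> {edge_start V (sig e), edge_end V (sig e)}" using e(5) se(3) by (auto simp: algebra_simps)
  then show ?thesis using q.A_vertex[OF l(4)] q.B_vertex[OF l(4)] e(4) l(3) by (auto simp: is_vertex_def edge_start_end)
qed

definition orbit_list where "orbit_list x m = map (\<lambda>k. pc ((F.T ^^ k) x)) [0..<m]"

lemma orbit_nth: "k < m \<Longrightarrow> orbit_list x m ! k = pc ((F.T ^^ k) x)" and orbit_len: "length (orbit_list x m) = m"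
  by (simp_all add: orbit_list_def)

lemma same_point_glue: "glue n V sig x y \<Longrightarrow> same_point n V sig x y"
  unfolding same_point_def by (simp add: r_into_rtranclp symclp_def)

text \<open>This includes orbits that touch vertices, since \<open>gn_chord\<close> covers chords
  through vertices. It allows vertices met by an orbit to be turned into a saddle
  connection.\<close>

lemma orbit_geodesic:
  assumes v: "valid x" and m: "0 < m" shows "geodesic_segment n V sig d (orbit_list x m)"
proof (rule geodesicI)
  show "orbit_list x m \<noteq> []" using m by (simp add: orbit_list_def)
  fix k assume k: "k < length (orbit_list x m)"
  show "fst (orbit_list x m ! k) < n \<and> 0 \<le> snd (snd (orbit_list x m ! k)) \<and>
      closed_segment (fst (snd (orbit_list x m ! k))) (fst (snd (orbit_list x m ! k)) + complex_of_real (snd (snd (orbit_list x m ! k))) * d) \<subseteq> face_region (V (fst (orbit_list x m ! k)))"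
    using piece_props[OF F.iter_valid[OF v, of k]] k by (simp add: orbit_nth orbit_len pc_def)
next
  fix k assume k: "Suc k < length (orbit_list x m)"
  show "same_point n V sig (piece_end d (orbit_list x m ! k)) (fst (orbit_list x m ! Suc k), fst (snd (orbit_list x m ! Suc k)))"
    using same_point_glue[OF piece_glue[OF F.iter_valid[OF v, of k]]] k
    by (simp add: orbit_nth orbit_len pc_def piece_end_def)
qed

lemma orbit_vertex:
  assumes "crit ((F.T ^^ k) x)" "k < m"
  obtains r where "0 \<le> r" "r \<le> plen ((F.T ^^ k) x)" "vertex_at n V d (orbit_list x m) k r"
  using assms unfolding crit_def by (auto simp: vertex_at_def orbit_nth orbit_len pc_def)

lemma orbit_offset: "k < m \<Longrightarrow> piece_offset (orbit_list x m) (Suc k) = piece_offset (orbit_list x m) k + plen ((F.T ^^ k) x)"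
  by (simp add: piece_offset_Suc orbit_len orbit_nth pc_def)

text \<open>A piece has length zero if its two edges share the vertex at which the germ is based. The germ then
  turns around this vertex, so the slopes increase and the orbit cannot consist of such pieces
  only.\<close>

lemma slope_increases:
  assumes v: "valid x" and l: "plen x = 0"
  shows "snd (snd x) * slope (fst x) < snd (snd x) * slope (fst (F.T x))"
proof -
  obtain e t s where x: "x = (e, t, s)" by (cases x)
  note fw = forward[OF v[unfolded x]]
  have ej: "(fst e, jx e t s) \<in> edges n V" using gn_edge(2)[OF fw(1-3)] .
  have "slope (nx e t s) = slope (fst e, jx e t s)" using sig_edge(4)[OF ej] by (simp add: nx_def)
  then show ?thesis using gn_edge(4)[OF fw(1-3)] l by (simp add: x plen_def F.T_eq)
qed

text \<open>The vertex returns at the same position one period later. The time elapsed is positive,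
  because along a period of pieces of length zero the slopes, signed by the side, would strictly
  increase. Two vertices at different times yield a saddle connection.\<close>

lemma crit_periodic:
  assumes v: "valid x" and p: "(F.T ^^ Suc m) x = x" and c: "crit x"
  shows False
proof -
  \<comment> \<open>The list is one piece longer than the period, so that the initial piece occurs
    twice.\<close>
  let ?L = "orbit_list x (Suc (Suc m))"
  have g: "geodesic_segment n V sig d ?L" using orbit_geodesic[OF v] by simp
  have "\<exists>k\<le>m. plen ((F.T ^^ k) x) \<noteq> 0"
  proof (rule ccontr)
    assume z: "\<not> ?thesis"
    let ?s = "snd (snd x)"
    have "?s * slope (fst x) < ?s * slope (fst ((F.T ^^ Suc k) x))" if "k \<le> m" for k
      using that
    proof (induction k)
      case 0 then show ?case using slope_increases[OF v] z by auto
    next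
      case (Suc k)
      have "?s * slope (fst ((F.T ^^ Suc k) x)) < ?s * slope (fst (F.T ((F.T ^^ Suc k) x)))"
        using slope_increases[OF F.iter_valid[OF v, of "Suc k"]] F.iter_side[of "Suc k" x] z Suc.prems by metis
      then show ?case using Suc by simp
    qed
    from this[of m] show False unfolding p by simp
  qed
  then obtain k where k: "k \<le> m" "plen ((F.T ^^ k) x) \<noteq> 0" by blast
  then have "0 < plen ((F.T ^^ k) x)" using piece_props(2)[OF F.iter_valid[OF v, of k]] by simp
  moreover have "piece_offset ?L (Suc k) = piece_offset ?L k + plen ((F.T ^^ k) x)" using orbit_offset k by simp
  moreover have "0 \<le> piece_offset ?L k" "piece_offset ?L (Suc k) \<le> piece_offset ?L (Suc m)"
    using piece_offset_mono[OF g, of 0 k] piece_offset_mono[OF g, of "Suc k" "Suc m"] k by (auto simp: orbit_len)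
  ultimately have pos: "0 < piece_offset ?L (Suc m)" by linarith
  obtain r where r: "vertex_at n V d ?L 0 r" using orbit_vertex[of 0 x "Suc (Suc m)"] c by auto
  moreover have "?L ! Suc m = ?L ! 0" using p by (simp add: orbit_nth del: funpow.simps)
  ultimately have r': "vertex_at n V d ?L (Suc m) r" by (simp add: vertex_at_def orbit_len)
  show False using saddle_connection_between[OF g _ r r'] pos no_saddle d_nz by auto
qed

lemma pstart_interior:
  assumes "valid (e, t, s)" "lo e < t" "t < hi e"
  shows "\<not> is_vertex n V (face (e, t, s), pstart (e, t, s))"
proof -
  have e: "fst e < n" "snd e < length (V (fst e))" using assms by (auto simp: valid_iff E_iff edges_iff)
  interpret p: dir_polygon "V (fst e)" d by (rule dpolygon[OF e(1)])
  show ?thesis using p.interior_not_vertex[OF e(2)] assms by (simp add: is_vertex_def face_def pstart_def lo_def hi_def f_def)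
qed

text \<open>Vertices at different times on the orbit through both pieces would yield a saddle
  connection. At equal times the vertex is the end of the first piece and all pieces from there to
  \<open>(e, t, s)\<close> have length zero. By gluing it is then the base point of this germ, which
  is interior to its edge.\<close>

lemma crit_two_sided:
  assumes v: "valid (e, t, s)" and t: "lo e < t" "t < hi e"
    and c: "crit ((F.T ^^ j) (e, t, s))" "crit ((B.T ^^ Suc k) (e, t, s))"
  shows False
proof -
  let ?x = "(e, t, s)"
  define y where "y = (B.T ^^ Suc k) ?x"
  have vy: "valid y" unfolding y_def using B.iter_valid[OF v] .
  have iter_FB: "valid x \<Longrightarrow> (F.T ^^ k) ((B.T ^^ k) x) = x" for k x
  proof (induction k arbitrary: x)
    case (Suc k)
    have "(F.T ^^ Suc k) ((B.T ^^ Suc k) x) = (F.T ^^ k) (F.T (B.T ((B.T ^^ k) x)))" by (simp add: funpow_swap1)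
    then show ?case using FB_T[OF B.iter_valid[OF Suc.prems, of k]] Suc by simp
  qed simp
  have xy: "(F.T ^^ Suc k) y = ?x" unfolding y_def by (rule iter_FB[OF v])
  define M where "M = Suc (Suc k + j)"
  let ?L = "orbit_list y M"
  have g: "geodesic_segment n V sig d ?L" using orbit_geodesic[OF vy] by (simp add: M_def)
  obtain r1 where r1: "0 \<le> r1" "r1 \<le> plen ((F.T ^^ 0) y)" "vertex_at n V d ?L 0 r1"
    using orbit_vertex[of 0 y M] c(2) by (auto simp: y_def M_def)
  have "(F.T ^^ (Suc k + j)) y = (F.T ^^ j) ?x" 
    unfolding xy[symmetric] by (subst add.commute) (simp only: funpow_add comp_apply)
  then obtain r2 where r2: "0 \<le> r2" "vertex_at n V d ?L (Suc k + j) r2"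
    using orbit_vertex[of "Suc k + j" y M] c(1) by (auto simp: M_def)
  have o1: "piece_offset ?L 1 = plen y" using orbit_offset[of 0 M y] by (simp add: M_def)
  have le: "piece_offset ?L a \<le> piece_offset ?L b" if "a \<le> b" "b \<le> M" for a b
    using piece_offset_mono[OF g that(1)] that(2) by (simp add: orbit_len)
  have "\<not> piece_offset ?L 0 + r1 < piece_offset ?L (Suc k + j) + r2"
    using saddle_connection_between[OF g _ r1(3) r2(2)] no_saddle d_nz by auto
  then have eq: "piece_offset ?L (Suc k) = plen y" "r1 = plen y"
    using r1 r2 o1 le[of 1 "Suc k"] le[of "Suc k" "Suc k + j"] by (auto simp: M_def)
  have "is_vertex n V (face ((F.T ^^ Suc i) y), pstart ((F.T ^^ Suc i) y))" if "i \<le> k" for i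
    using that
  proof (induction i)
    case 0
    have "is_vertex n V (face y, pstart y + of_real (plen y) * d)"
      using r1(3) eq(2) orbit_nth[of 0 M y] by (simp add: vertex_at_def pc_def M_def)
    then show ?case using glue_vertex[OF piece_glue[OF vy]] by simp
  next
    case (Suc i)
    let ?z = "(F.T ^^ Suc i) y"
    have "piece_offset ?L (Suc (Suc i)) = piece_offset ?L (Suc i) + plen ?z"
      using orbit_offset[of "Suc i" M y] Suc by (simp add: M_def)
    moreover have "piece_offset ?L (Suc (Suc i)) \<le> plen y" "plen y \<le> piece_offset ?L (Suc i)"
      using le[of "Suc (Suc i)" "Suc k"] le[of 1 "Suc i"] eq(1) o1 Suc by (auto simp: M_def)
    moreover have vz: "valid ?z" using F.iter_valid[OF vy] .
    ultimately have "plen ?z = 0" using piece_props(2)[OF vz] by linarith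
    then show ?case using glue_vertex[OF piece_glue[OF vz]] Suc by simp
  qed
  from this[of k] show False using pstart_interior[OF v t] unfolding xy by simp
qed

lemma noncrit:
  assumes v: "valid (e, t, s)" and c: "\<not> crit (e, t, s)"
  shows "lo e < t \<and> t < hi e \<and> nx e t (- s) = nx e t s"
proof -
  note fw = forward[OF v]
  interpret p: dir_polygon "V (fst e)" d by (rule dpolygon[OF fw(1)])
  have g: "p.gn (snd e) t s (jx e t s)" using fw(3) by (simp add: gnE_def)
  have nv: "pnt d y t \<notin> set (V (fst e))" if "p.f (snd e) t \<le> y" "y \<le> p.f (jx e t s) t" for y
  proof
    assume "pnt d y t \<in> set (V (fst e))"
    moreover have "pstart (e, t, s) + of_real (y - f e t) * d = pnt d y t"
      by (simp only: pstart_def prod.case pnt_add_d) simp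
    ultimately have "crit (e, t, s)" unfolding crit_def using that fw(1)
      by (intro exI[of _ "y - f e t"] conjI) (simp_all only: is_vertex_def, simp_all add: plen_def face_def f_def)
    then show False using c by simp
  qed
  note N = p.no_vertex_nxt[OF fw(2) g nv]
  have "jx e t (- s) = jx e t s" using jx_eq[OF fw(1)] N(5) by (simp add: gnE_def)
  then show ?thesis using N(1) by (simp add: nx_def p.spn_def lo_def hi_def)
qed

text \<open>Leaving edges get the colour of their partners. Invariance of \<open>A\<close> under the
  return map then says that both ends of a generic chord have the same colour, which spreads over
  the whole face.\<close>

lemma face_colour:
  assumes A: "\<And>x. valid x \<Longrightarrow> fst x \<in> A \<longleftrightarrow> fst (F.T x) \<in> A" and i: "i < n" and kj: "k < length (V i)" "j < length (V i)"
  defines "col \<equiv> \<lambda>e. if entering e then e \<in> A else sig e \<in> A"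
  shows "col (i, k) = col (i, j)"
proof -
  interpret p: dir_polygon "V i" d by (rule dpolygon[OF i])
  show ?thesis
  proof (rule p.edge_colour_constant[where col="\<lambda>k. col (i, k)", OF _ _ kj])
    fix k j u assume a: "u \<notin> p.vh" "p.nxt k u j" "p.entering k"
    obtain e where e: "e > 0" "\<And>h. 0 < h \<Longrightarrow> h < e \<Longrightarrow> u + 1 * h \<notin> p.vh" using p.generic_side[of 1 u] by auto
    obtain e' where e': "e' > 0" "\<And>h. 0 < h \<Longrightarrow> h < e' \<Longrightarrow> u + -1 * h \<notin> p.vh" using p.generic_side[of "-1" u] by auto
    have st: "w \<notin> p.vh" if "u - e' < w" "w < u + e" for w
    proof -
      consider "w < u" | "w = u" | "u < w" by linarith
      then show ?thesis using e(2)[of "w - u"] e'(2)[of "u - w"] that a(1) by cases auto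
    qed
    have g: "p.gn k u 1 j" by (rule p.strip_gn(3)[OF st _ _ a(2)]) (use e(1) e'(1) in auto)
    have ge: "p.germ_on k u 1" using p.gn_germ[OF side_1 g] by simp
    obtain j' where j': "p.gn k u 1 j'" "\<not> p.entering j'" using p.entering_gn[OF side_1 ge a(3)] .
    have "\<not> p.entering j" using j' p.gn_unique[OF g] by auto
    then have en: "entering (i, k)" "\<not> entering (i, j)" using a(3) by (simp_all add: entering_def)
    have gE: "gnE i k u 1 j" using g by (simp add: gnE_def)
    have v: "valid ((i, k), u, 1)" using gn_valid(1)[OF i side_1 gE en] .
    have "nx (i, k) u 1 = sig (i, j)" using jx_eq[of "(i, k)" u 1 j] i gE by (simp add: nx_def)
    then show "col (i, k) = col (i, j)" using A[OF v] en by (simp add: F.T_eq col_def)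
  next
    fix x y t assume "x < y" "pnt d x t \<in> set (V i)" "pnt d y t \<in> set (V i)" "\<And>w. x \<le> w \<Longrightarrow> w \<le> y \<Longrightarrow> pnt d w t \<in> p.F"
    then show False by (rule no_two_vertices[OF i])
  qed
qed

text \<open>Glued edges share their colour, and so do all edges of one face. The chains of faces in
  \<open>translation_surface\<close> therefore make the colour constant on the surface.\<close>

lemma connectivity:
  assumes AE: "A \<subseteq> E" and ne: "A \<noteq> {}" and A: "\<And>x. valid x \<Longrightarrow> fst x \<in> A \<longleftrightarrow> fst (F.T x) \<in> A"
  shows "A = E"
proof -
  define col where "col e = (if entering e then e \<in> A else sig e \<in> A)" for e
  have const: "col (i, k) = col (i, j)" if "i < n" "k < length (V i)" "j < length (V i)" for i k j
    using face_colour[OF A that] by (simp add: col_def)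
  have csig: "col (sig e) = col e" if e: "e \<in> edges n V" for e
    using sig_edge(1)[OF e] sig_props(2)[OF e] by (simp add: col_def)
  have col_step: "col (a, k) = col (b, j)" if "a < n" "j0 < length (V a)" "fst (sig (a, j0)) = b" "k < length (V a)" "j < length (V b)" for a b j0 k j
  proof -
    have e: "(a, j0) \<in> edges n V" using that by (simp add: edges_iff)
    have s: "sig (a, j0) = (b, snd (sig (a, j0)))" using that(3) by (metis prod.collapse)
    have b: "b < n" "snd (sig (a, j0)) < length (V b)" using sig_props(1)[OF e] that(3) by (auto simp: edges_iff)
    have "col (a, k) = col (a, j0)" using const that by blast
    also have "\<dots> = col (b, snd (sig (a, j0)))" using csig[OF e] s by metis
    also have "\<dots> = col (b, j)" using const b that(5) by blast
    finally show ?thesis .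
  qed
  have len: "0 < length (V i)" if "i < n" for i
  proof -
    interpret p: jordan_polygon "V i" by (rule polygon[OF that])
    show ?thesis using p.len3 by linarith
  qed
  have all: "col e = col e'" if e: "e \<in> edges n V" "e' \<in> edges n V" for e e'
  proof -
    let ?R = "\<lambda>a b. a < n \<and> (\<exists>j<length (V a). fst (sig (a, j)) = b)"
    have "?R\<^sup>*\<^sup>* (fst e) (fst e')" using ts e unfolding translation_surface_def by (simp add: edges_iff)
    then have "fst e' < n \<longrightarrow> (\<forall>k<length (V (fst e)). \<forall>j<length (V (fst e')). col (fst e, k) = col (fst e', j))"
    proof (induction rule: rtranclp_induct)
      case base then show ?case using const by blast
    next
      case (step b c)
      then obtain j0 where j0: "b < n" "j0 < length (V b)" "fst (sig (b, j0)) = c" by blast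
      then show ?case using step.IH col_step len by metis
    qed
    then show ?thesis using e by (metis edges_iff prod.collapse)
  qed
  obtain e0 where e0: "e0 \<in> A" using ne by blast
  then have "e0 \<in> edges n V" "col e0" using AE by (auto simp: E_iff col_def)
  then have "e \<in> A" if "e \<in> E" for e using all[of e0 e] that by (auto simp: E_iff col_def)
  then show ?thesis using AE by blast
qed

sublocale germ_sys E lo hi nx "\<lambda>e e'. hc e'" D nx' "\<lambda>e e'. - hc e" D' crit
proof
  show "\<And>x. valid x \<Longrightarrow> B.T (F.T x) = x" by (rule BF_T)
  show "\<And>x. valid x \<Longrightarrow> F.T (B.T x) = x" by (rule FB_T)
  show "\<And>e t s j k. valid (e, t, s) \<Longrightarrow> lo e < t \<Longrightarrow> t < hi e \<Longrightarrow> crit ((F.T ^^ j) (e, t, s)) \<Longrightarrow> crit ((B.T ^^ Suc k) (e, t, s)) \<Longrightarrow> False"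
    by (rule crit_two_sided)
  show "\<And>x m. valid x \<Longrightarrow> (F.T ^^ Suc m) x = x \<Longrightarrow> crit x \<Longrightarrow> False" by (rule crit_periodic)
  show "\<And>e t s. valid (e, t, s) \<Longrightarrow> \<not> crit (e, t, s) \<Longrightarrow> lo e < t \<and> t < hi e \<and> nx e t (- s) = nx e t s" by (rule noncrit)
  show "\<And>A. A \<subseteq> E \<Longrightarrow> A \<noteq> {} \<Longrightarrow> (\<And>x. valid x \<Longrightarrow> fst x \<in> A \<longleftrightarrow> fst (F.T x) \<in> A) \<Longrightarrow> A = E" by (rule connectivity)
qed

end

section \<open>Visiting frequency\<close>

context flow_surface begin

section \<open>Geodesics without vertices follow orbits\<close>

definition lam where "lam x k = (\<Sum>j<k. plen ((F.T ^^ j) x))"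

text \<open>The orbit of the germ \<open>x\<close> is at \<open>y\<close> at time \<open>\<tau>\<close>. When it crosses an edge, both representatives
  of the crossing point count.\<close>

definition at_time where
  "at_time x \<tau> y \<longleftrightarrow> (\<exists>k. lam x k \<le> \<tau> \<and> \<tau> \<le> lam x (Suc k) \<and>
     y = (face ((F.T ^^ k) x), pstart ((F.T ^^ k) x) + of_real (\<tau> - lam x k) * d))"

lemma lam_0 [simp]: "lam x 0 = 0" and lam_Suc: "lam x (Suc k) = lam x k + plen ((F.T ^^ k) x)"
  by (simp_all add: lam_def)

lemma lam_mono: assumes v: "valid x" and jk: "j \<le> k" shows "lam x j \<le> lam x k"
  using jk
proof (induction k rule: dec_induct)
  case (step k)
  then show ?case using piece_props(2)[OF F.iter_valid[OF v, of k]] by (simp add: lam_Suc)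
qed simp

lemma piece_next:
  assumes v: "valid (e, t, s)"
  defines "ej \<equiv> (fst e, jx e t s)"
  shows "ej \<in> edges n V" "F.T (e, t, s) = (sig ej, t + hc (sig ej), s)"
    "face (F.T (e, t, s)) = fst (sig ej)"
    "pstart (F.T (e, t, s)) = pnt d (f ej t) t + (edge_end V (sig ej) - edge_start V ej)"
proof -
  note fw = forward[OF v]
  show ej: "ej \<in> edges n V" unfolding ej_def using gn_edge(2)[OF fw(1-3)] .
  show T: "F.T (e, t, s) = (sig ej, t + hc (sig ej), s)" by (simp add: F.T_eq nx_def ej_def)
  show "face (F.T (e, t, s)) = fst (sig ej)" by (simp add: T face_def)
  have se: "sig (sig ej) = ej" "sig ej \<in> edges n V" using sig_props[OF ej] by simp_all
  have "f (sig ej) (t + hc (sig ej)) = f ej t + xc (sig ej)" using sig_edge(5)[OF se(2)] se(1) by simp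
  moreover have "pnt d (xc (sig ej)) (hc (sig ej)) = edge_end V (sig ej) - edge_start V (sig (sig ej))"
    by (simp add: xc_def hc_def pnt_coords)
  moreover have "pnt d (a + b) (a' + b') = pnt d a a' + pnt d b b'" for a b a' b'
    by (simp add: pnt_def complex_eq_iff algebra_simps)
  ultimately show "pstart (F.T (e, t, s)) = pnt d (f ej t) t + (edge_end V (sig ej) - edge_start V ej)"
    by (simp add: T pstart_def se(1))
qed

text \<open>Along the flow the face stops locally just before an entering edge and just after a
  leaving one. The last two facts serve to pin a point on an edge to the matching end of an orbit
  piece.\<close>

lemma edge_point:
  assumes e: "e \<in> edges n V" and z: "pnt d w t \<in> closed_segment (edge_start V e) (edge_end V e)"
    and nv: "\<not> is_vertex n V (fst e, pnt d w t)"
  shows "w = f e t" "lo e < t" "t < hi e"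
    "entering e \<Longrightarrow> \<exists>r>0. \<forall>q. 0 < q \<and> q < r \<longrightarrow> pnt d (w - q) t \<notin> face_region (V (fst e))"
    "\<not> entering e \<Longrightarrow> \<exists>r>0. \<forall>q. 0 < q \<and> q < r \<longrightarrow> pnt d (w + q) t \<notin> face_region (V (fst e))"
proof -
  have i: "fst e < n" "snd e < length (V (fst e))" using e by (auto simp: edges_iff)
  interpret p: dir_polygon "V (fst e)" d by (rule dpolygon[OF i(1)])
  have 1: "p.lo (snd e) \<le> t" "t \<le> p.hi (snd e)" "w = p.f (snd e) t"
    using z p.seg_iff[OF i(2)] by (auto simp: edge_start_end)
  have s: "p.spn (snd e) t" using p.no_vertex_spn[OF i(2) 1(1,2)] nv i 1 by (simp add: is_vertex_def)
  show "w = f e t" using 1 by (simp add: f_def)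
  show "lo e < t" "t < hi e" using s by (auto simp: p.spn_def lo_def hi_def)
  obtain r where r: "r > 0" "\<forall>q. 0 < q \<and> q < r \<longrightarrow> (if p.entering (snd e) then p.P (p.f (snd e) t + q) t \<in> p.R \<and> p.P (p.f (snd e) t - q) t \<in> outside p.bdry
      else p.P (p.f (snd e) t - q) t \<in> p.R \<and> p.P (p.f (snd e) t + q) t \<in> outside p.bdry)"
    using p.sides[OF i(2)] s by (auto simp: p.spn_def)
  show "entering e \<Longrightarrow> \<exists>r>0. \<forall>q. 0 < q \<and> q < r \<longrightarrow> pnt d (w - q) t \<notin> face_region (V (fst e))"
    using r p.out_not_F 1(3) by (intro exI[of _ r]) (simp add: entering_def)
  show "\<not> entering e \<Longrightarrow> \<exists>r>0. \<forall>q. 0 < q \<and> q < r \<longrightarrow> pnt d (w + q) t \<notin> face_region (V (fst e))"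
    using r p.out_not_F 1(3) by (intro exI[of _ r]) (simp add: entering_def)
qed

lemma edge_unique:
  assumes e: "e \<in> edges n V" "e' \<in> edges n V" "fst e = fst e'"
    and "lo e < t" "t < hi e" "lo e' \<le> t" "t \<le> hi e'" "f e t = f e' t"
  shows "e = e'"
proof -
  have i: "fst e < n" "snd e < length (V (fst e))" "snd e' < length (V (fst e))" using e by (auto simp: edges_iff)
  interpret p: dir_polygon "V (fst e)" d by (rule dpolygon[OF i(1)])
  have "snd e' = snd e"
    using p.edges_disjoint[of "snd e'" "snd e" t] i assms by (auto simp: lo_def hi_def f_def)
  then show ?thesis using e(3) by (simp add: prod_eq_iff)
qed

lemma piece_in_face:
  assumes v: "valid (e, t, s)" and w: "f e t \<le> w" "w \<le> f (fst e, jx e t s) t"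
  shows "pnt d w t \<in> face_region (V (fst e))"
proof -
  have "pnt d w t \<in> closed_segment (pstart (e, t, s)) (pstart (e, t, s) + of_real (plen (e, t, s)) * d)"
    using closed_segment_d[of "plen (e, t, s)" "f e t" t] piece_props(2)[OF v] w
    by (auto simp: pstart_def plen_def)
  then show ?thesis using piece_props(3)[OF v] by (auto simp: face_def)
qed

lemma valid_range: "valid (e, t, s) \<Longrightarrow> e \<in> edges n V \<and> entering e \<and> lo e \<le> t \<and> t \<le> hi e"
  by (auto simp: valid_iff E_iff)

lemma exit_range:
  assumes "valid (e, t, s)"
  shows "lo (fst e, jx e t s) \<le> t \<and> t \<le> hi (fst e, jx e t s)"
  using gn_edge(6)[OF forward(1-3)[OF assms]] by auto

text \<open>By \<open>edge_point\<close> the orbit is at the end of its current piece if the edge is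
  leaving, and at the start if it is entering. Gluing then moves the point to the start of the next
  piece or to the end of the previous one, which have the same time.\<close>

lemma at_time_glue:
  assumes v: "valid x" and \<tau>: "0 < \<tau>" and at: "at_time x \<tau> y" and nv: "\<not> is_vertex n V y" and g: "glue n V sig y y'"
  shows "at_time x \<tau> y'"
proof -
  obtain k where k: "lam x k \<le> \<tau>" "\<tau> \<le> lam x (Suc k)"
    "y = (face ((F.T ^^ k) x), pstart ((F.T ^^ k) x) + of_real (\<tau> - lam x k) * d)"
    using at unfolding at_time_def by blast
  obtain e t s where xk: "(F.T ^^ k) x = (e, t, s)" by (cases "(F.T ^^ k) x")
  have vk: "valid (e, t, s)" using F.iter_valid[OF v, of k] xk by simp
  define ej where "ej = (fst e, jx e t s)"
  define w where "w = f e t + (\<tau> - lam x k)"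
  have wr: "f e t \<le> w" "w \<le> f ej t" using k(1,2) xk by (auto simp: w_def lam_Suc plen_def ej_def)
  have y: "y = (fst e, pnt d w t)" using k(3) xk by (simp add: face_def pstart_def pnt_add_d w_def del: of_real_diff)
  obtain e' where e': "e' \<in> edges n V" "fst e' = fst e" "pnt d w t \<in> closed_segment (edge_start V e') (edge_end V e')"
    "y' = (fst (sig e'), pnt d w t + (edge_end V (sig e') - edge_start V e'))"
    using g y by (auto simp: glue_def prod_eq_iff)
  have nv': "\<not> is_vertex n V (fst e', pnt d w t)" using nv y e'(2) by simp
  note ep = edge_point[OF e'(1,3) nv']
  have inF: "pnt d w' t \<in> face_region (V (fst e'))" if "f e t \<le> w'" "w' \<le> f ej t" for w'
    using piece_in_face[OF vk that[unfolded ej_def]] e'(2) by simp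
  show ?thesis
  proof (cases "entering e'")
    case False
    obtain r where r: "r > 0" "\<And>q. 0 < q \<Longrightarrow> q < r \<Longrightarrow> pnt d (w + q) t \<notin> face_region (V (fst e'))" using ep(5)[OF False] by blast
    have "w = f ej t"
    proof (rule ccontr)
      assume "w \<noteq> f ej t"
      then have "w < f ej t" using wr by simp
      define q where "q = min (r / 2) (f ej t - w)"
      have "0 < q" "q < r" "w + q \<le> f ej t" using r \<open>w < f ej t\<close> by (auto simp: q_def)
      then show False using r(2)[of q] inF[of "w + q"] wr by auto
    qed
    then have "e' = ej" using edge_unique[of e' ej t] piece_next(1)[OF vk] e' ep(1,2,3) exit_range[OF vk] by (simp add: ej_def)
    then have "y' = (face ((F.T ^^ Suc k) x), pstart ((F.T ^^ Suc k) x))"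
      using e'(4) piece_next(3,4)[OF vk] xk \<open>w = f ej t\<close> by (simp add: ej_def)
    moreover have "\<tau> = lam x (Suc k)" using \<open>w = f ej t\<close> xk by (simp add: w_def lam_Suc plen_def ej_def)
    ultimately show ?thesis unfolding at_time_def using lam_mono[OF v, of "Suc k" "Suc (Suc k)"] by (intro exI[of _ "Suc k"]) simp
  next
    case True
    obtain r where r: "r > 0" "\<And>q. 0 < q \<Longrightarrow> q < r \<Longrightarrow> pnt d (w - q) t \<notin> face_region (V (fst e'))" using ep(4)[OF True] by blast
    have we: "w = f e t"
    proof (rule ccontr)
      assume "w \<noteq> f e t"
      then have l: "f e t < w" using wr by simp
      define q where "q = min (r / 2) (w - f e t)"
      have "0 < q" "q < r" "f e t \<le> w - q" using r l by (auto simp: q_def)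
      then show False using r(2)[of q] inF[of "w - q"] wr by auto
    qed
    then have ee: "e' = e" using edge_unique[of e' e t] valid_range[OF vk] e' ep(1,2,3) by simp
    have \<tau>k: "\<tau> = lam x k" using we by (simp add: w_def)
    \<comment> \<open>A positive time guarantees that a previous piece exists.\<close>
    then obtain k' where k': "k = Suc k'" using \<tau> by (cases k) auto
    obtain e2 t2 s2 where xk': "(F.T ^^ k') x = (e2, t2, s2)" by (cases "(F.T ^^ k') x")
    have vk': "valid (e2, t2, s2)" using F.iter_valid[OF v, of k'] xk' by simp
    define ej' where "ej' = (fst e2, jx e2 t2 s2)"
    note pn = piece_next[OF vk', folded ej'_def]
    have T: "F.T (e2, t2, s2) = (e, t, s)" using xk xk' k' by simp
    have es: "e = sig ej'" "sig e = ej'" using T pn(2) sig_props(2)[OF pn(1)] by auto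
    have "pnt d w t = pnt d (f ej' t2) t2 + (edge_end V e - edge_start V ej')"
      using pn(4) es T we by (simp add: pstart_def)
    moreover have "edge_end V ej' = edge_start V ej' - edge_end V e + edge_start V e"
      using sig_props(3)[OF e'(1)] ee es by (simp add: diff_eq_eq)
    ultimately have "y' = (fst ej', pnt d (f ej' t2) t2)" using e'(4) ee es by simp
    moreover have "plen (e2, t2, s2) = f ej' t2 - f e2 t2" by (simp add: plen_def ej'_def)
    ultimately have "y' = (face ((F.T ^^ k') x), pstart ((F.T ^^ k') x) + of_real (\<tau> - lam x k') * d)"
      using xk' \<tau>k k' by (simp add: lam_Suc face_def pstart_def pnt_add_d ej'_def del: of_real_diff)
    then show ?thesis unfolding at_time_def using lam_mono[OF v, of k' "Suc k'"] \<tau>k k' by (intro exI[of _ k']) simp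
  qed
qed

lemma at_time_same_point:
  assumes v: "valid x" and \<tau>: "0 < \<tau>" and at: "at_time x \<tau> y" and nv: "\<not> is_vertex n V y" and g: "same_point n V sig y y'"
  shows "at_time x \<tau> y'"
proof -
  have "at_time x \<tau> y' \<and> \<not> is_vertex n V y'"
    using g unfolding same_point_def
  proof (induction rule: rtranclp_induct)
    case base show ?case using at nv by simp
  next
    case (step a b)
    have g: "glue n V sig a b" using step(2) glue_sym unfolding symclp_def by blast
    then show ?case using at_time_glue[OF v \<tau> _ _ g] glue_vertex[OF glue_sym[OF g]] step.IH by blast
  qed
  then show ?thesis ..
qed

text \<open>To run past the end of the current orbit piece would mean to leave the face through an
  interior point of the exit edge. So the whole geodesic piece fits into the rest of one orbit
  piece.\<close>

lemma at_time_move: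
  assumes v: "valid x" and at: "at_time x \<tau> (i, z)" and l: "0 \<le> l"
    and seg: "closed_segment z (z + of_real l * d) \<subseteq> face_region (V i)"
    and nv: "\<And>s. 0 \<le> s \<Longrightarrow> s \<le> l \<Longrightarrow> \<not> is_vertex n V (i, z + of_real s * d)"
    and s: "0 \<le> s" "s \<le> l"
  shows "at_time x (\<tau> + s) (i, z + of_real s * d)"
proof -
  obtain k where k: "lam x k \<le> \<tau>" "\<tau> \<le> lam x (Suc k)"
    "i = face ((F.T ^^ k) x)" "z = pstart ((F.T ^^ k) x) + of_real (\<tau> - lam x k) * d"
    using at unfolding at_time_def by auto
  obtain e t s' where xk: "(F.T ^^ k) x = (e, t, s')" by (cases "(F.T ^^ k) x")
  have vk: "valid (e, t, s')" using F.iter_valid[OF v, of k] xk by simp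
  define ej where "ej = (fst e, jx e t s')"
  define w where "w = f e t + (\<tau> - lam x k)"
  have wr: "f e t \<le> w" "w \<le> f ej t" using k(1,2) xk by (auto simp: w_def lam_Suc plen_def ej_def)
  have z: "i = fst e" "z = pnt d w t" using k(3,4) xk by (simp_all add: face_def pstart_def pnt_add_d w_def del: of_real_diff)
  have "w + l \<le> f ej t"
  proof (rule ccontr)
    assume "\<not> ?thesis"
    then have lt: "f ej t < w + l" by simp
    have e: "ej \<in> edges n V" "fst ej = fst e" "\<not> entering ej" using piece_next(1)[OF vk] forward(4)[OF vk] by (auto simp: ej_def)
    have i: "fst e < n" "jx e t s' < length (V (fst e))" using e by (auto simp: edges_iff ej_def)
    interpret p: dir_polygon "V (fst e)" d by (rule dpolygon[OF i(1)])
    have "pnt d (f ej t) t \<in> closed_segment (edge_start V ej) (edge_end V ej)"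
      using exit_range[OF vk] p.f_mem_seg[OF i(2)] by (simp add: ej_def lo_def hi_def f_def edge_start_end)
    moreover have "\<not> is_vertex n V (fst ej, pnt d (f ej t) t)"
      using nv[of "f ej t - w"] wr lt z by (simp add: pnt_add_d e(2) del: of_real_diff)
    ultimately obtain r where r: "r > 0" "\<And>q. 0 < q \<Longrightarrow> q < r \<Longrightarrow> pnt d (f ej t + q) t \<notin> face_region (V (fst ej))"
      using edge_point(5)[OF e(1) _ _ e(3)] by blast
    define q where "q = min (r / 2) (w + l - f ej t)"
    have q: "0 < q" "q < r" "f ej t + q \<le> w + l" "w \<le> f ej t + q" using r lt wr by (auto simp: q_def)
    then have "pnt d (f ej t + q) t \<in> closed_segment z (z + of_real l * d)"
      using closed_segment_d[OF l, of w t] z by auto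
    then show False using r(2)[OF q(1,2)] seg z e(2) by auto
  qed
  then have "\<tau> + l \<le> lam x (Suc k)" using xk by (simp add: w_def lam_Suc plen_def ej_def)
  then show ?thesis unfolding at_time_def using k s by (intro exI[of _ k]) (auto simp: algebra_simps)
qed

lemma at_time_exit:
  assumes e: "(i, j) \<in> edges n V" "\<not> entering (i, j)" and z: "z \<in> closed_segment (edge_start V (i, j)) (edge_end V (i, j))"
    and nv: "\<not> is_vertex n V (i, z)"
  obtains x \<tau> where "valid x" "0 < \<tau>" "at_time x \<tau> (i, z)"
proof -
  have i: "i < n" "j < length (V i)" using e by (auto simp: edges_iff)
  interpret p: dir_polygon "V i" d by (rule dpolygon[OF i(1)])
  let ?t = "hgt d z"
  have zz: "z = pnt d (xco d z) ?t" by (simp add: pnt_coords)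
  have ep: "xco d z = f (i, j) ?t" "lo (i, j) < ?t" "?t < hi (i, j)"
    using edge_point(1-3)[OF e(1), of "xco d z" ?t, unfolded pnt_coords fst_conv, OF z nv] by simp_all
  have g: "p.germ_on j ?t 1" using i ep by (auto simp: p.germ_on_def lo_def hi_def)
  obtain k where k: "p.gn k ?t 1 j" "p.entering k" using p.leaving_gn[OF side_1 g] e(2) by (auto simp: entering_def)
  have gk: "gnE i k ?t 1 j" using k by (simp add: gnE_def)
  have v: "valid ((i, k), ?t, 1)" using gn_valid(1)[OF i(1) side_1 gk] k e by (simp add: entering_def)
  have jx: "jx (i, k) ?t 1 = j" using jx_eq[of "(i, k)" ?t 1 j] i gk by simp
  \<comment> \<open>The exit point is interior to its edge, so no other edge passes through it, and
    the piece has positive length.\<close>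
  have "f (i, k) ?t \<noteq> f (i, j) ?t"
    using edge_unique[of "(i, j)" "(i, k)" ?t] e(1) valid_range[OF v] ep p.gn_ne[OF k(1)] by auto
  then have pos: "0 < plen ((i, k), ?t, 1)" using gn_edge(3)[OF i(1) side_1 gk] jx by (simp add: plen_def)
  have "at_time ((i, k), ?t, 1) (plen ((i, k), ?t, 1)) (i, z)"
    unfolding at_time_def
  proof (intro exI[of _ 0] conjI)
    have "z = pnt d (f (i, j) ?t) ?t" using zz ep(1) by simp
    then show "(i, z) = (face ((F.T ^^ 0) ((i, k), ?t, 1)), pstart ((F.T ^^ 0) ((i, k), ?t, 1)) + of_real (plen ((i, k), ?t, 1) - lam ((i, k), ?t, 1) 0) * d)"
      using jx by (simp add: face_def pstart_def plen_def pnt_add_d del: of_real_diff)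
  qed (use pos in \<open>simp_all add: lam_Suc\<close>)
  then show ?thesis using that v pos by blast
qed

text \<open>An interior point lies inside a chord, and a point of a leaving edge ends one. A point
  of an entering edge is first glued to the leaving partner: a germ based at the point itself would
  give time 0.\<close>

lemma at_time_start:
  assumes i: "i < n" and z: "z \<in> face_region (V i)" and nv: "\<not> is_vertex n V (i, z)"
  obtains x \<tau> where "valid x" "0 < \<tau>" "at_time x \<tau> (i, z)"
proof -
  interpret p: dir_polygon "V i" d by (rule dpolygon[OF i])
  let ?t = "hgt d z" and ?x = "xco d z"
  have zz: "z = pnt d ?x ?t" by (simp add: pnt_coords)
  show ?thesis
  proof (cases "z \<in> p.R")
    case True
    then have R: "pnt d ?x ?t \<in> p.R" by (simp add: pnt_coords)
    obtain k j where kj: "p.thru ?x ?t 1 k j" "p.entering k" "\<not> p.entering j" using p.thru_exists[OF side_1 R] .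
    have g: "gnE i k ?t 1 j" using p.thru_gn[OF kj(1)] by (simp add: gnE_def)
    have v: "valid ((i, k), ?t, 1)" using gn_valid(1)[OF i side_1 g] kj by (simp add: entering_def)
    have jx: "jx (i, k) ?t 1 = j" using jx_eq[of "(i, k)" ?t 1 j] i g by simp
    have l: "f (i, k) ?t < ?x" "?x < f (i, j) ?t" using p.thru_less[OF side_1 kj(1) R] by (simp_all add: f_def)
    have "at_time ((i, k), ?t, 1) (?x - f (i, k) ?t) (i, z)"
      unfolding at_time_def
    proof (intro exI[of _ 0] conjI)
      show "(i, z) = (face ((F.T ^^ 0) ((i, k), ?t, 1)), pstart ((F.T ^^ 0) ((i, k), ?t, 1)) + of_real (?x - f (i, k) ?t - lam ((i, k), ?t, 1) 0) * d)"
        by (simp add: face_def pstart_def pnt_add_d pnt_coords del: of_real_diff)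
    qed (use l jx in \<open>simp_all add: lam_Suc plen_def\<close>)
    from that[OF v _ this] show ?thesis using l by simp
  next
    case False
    then have "z \<in> p.bdry" using z by (simp add: p.F_eq)
    then obtain k where k: "k < length (V i)" "z \<in> p.seg k" by (auto simp: p.bdry_eq)
    let ?e = "(i, k)"
    have e: "?e \<in> edges n V" using i k by (simp add: edges_iff)
    have ze: "z \<in> closed_segment (edge_start V ?e) (edge_end V ?e)" using k by (simp add: edge_start_end)
    show ?thesis
    proof (cases "entering ?e")
      case False
      then show ?thesis using at_time_exit[OF e False ze nv] that by blast
    next
      case True
      define y where "y = (fst (sig ?e), z + (edge_end V (sig ?e) - edge_start V ?e))"
      have gl: "glue n V sig (i, z) y" unfolding glue_def y_def using e ze by (intro bexI[OF _ e]) auto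
      note gl' = glue_sym[OF gl]
      have nvy: "\<not> is_vertex n V y" using glue_vertex[OF gl'] nv by blast
      have se: "(fst (sig ?e), snd (sig ?e)) \<in> edges n V" "\<not> entering (fst (sig ?e), snd (sig ?e))"
        using sig_props(1)[OF e] sig_edge(1)[OF e] True by simp_all
      have "edge_start V (sig ?e) = (edge_end V (sig ?e) - edge_start V ?e) + edge_end V ?e"
        using sig_props(3)[OF e] by (simp add: algebra_simps)
      moreover have "edge_end V (sig ?e) = (edge_end V (sig ?e) - edge_start V ?e) + edge_start V ?e" by simp
      moreover have "(edge_end V (sig ?e) - edge_start V ?e) + z \<in> closed_segment ((edge_end V (sig ?e) - edge_start V ?e) + edge_end V ?e) ((edge_end V (sig ?e) - edge_start V ?e) + edge_start V ?e)"
        using ze by (simp only: closed_segment_translation_eq) (simp add: closed_segment_commute)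
      ultimately have "snd y \<in> closed_segment (edge_start V (fst (sig ?e), snd (sig ?e))) (edge_end V (fst (sig ?e), snd (sig ?e)))"
        unfolding y_def by (simp add: add.commute) 
      then obtain x \<tau> where x: "valid x" "0 < \<tau>" "at_time x \<tau> (fst (sig ?e), snd y)"
        using at_time_exit[OF se] nvy y_def by (metis fst_conv prod.collapse)
      then have "at_time x \<tau> y" by (simp add: y_def)
      then have "at_time x \<tau> (i, z)" using at_time_glue[OF x(1,2) _ nvy gl'] by blast
      then show ?thesis using that x by blast
    qed
  qed
qed

lemma geodesic_follows:
  assumes v: "valid x" and \<tau>: "0 < \<tau>" and g: "geodesic_segment n V sig d L"
    and nv: "\<And>k s. \<not> vertex_at n V d L k s"
    and at0: "at_time x \<tau> (fst (L ! 0), fst (snd (L ! 0)))"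
    and k: "k < length L" and s: "0 \<le> s" "s \<le> snd (snd (L ! k))"
  shows "at_time x (\<tau> + piece_offset L k + s) (fst (L ! k), fst (snd (L ! k)) + of_real s * d)"
proof -
  have mv: "at_time x (\<sigma> + s) (fst (L ! k), fst (snd (L ! k)) + of_real s * d)"
    if "at_time x \<sigma> (fst (L ! k), fst (snd (L ! k)))" "k < length L" "0 \<le> s" "s \<le> snd (snd (L ! k))" for k s \<sigma>
    by (rule at_time_move[OF v that(1) _ _ _ that(3,4)])
       (use geodesic_piece[OF g that(2)] nv[of k] that(2) in \<open>auto simp: vertex_at_def\<close>)
  have st: "at_time x (\<tau> + piece_offset L k) (fst (L ! k), fst (snd (L ! k)))" if "k < length L" for k
    using that
  proof (induction k)
    case 0 then show ?case using at0 by simp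
  next
    case (Suc k)
    let ?l = "snd (snd (L ! k))"
    have kl: "k < length L" "0 \<le> ?l" using Suc.prems geodesic_piece(2)[OF g, of k] by auto
    have a: "at_time x (\<tau> + piece_offset L k + ?l) (piece_end d (L ! k))"
      using mv[OF Suc.IH[OF kl(1)] kl(1) kl(2)] by (simp add: piece_end_alt)
    have "\<not> is_vertex n V (piece_end d (L ! k))"
      using nv[of k ?l] kl by (simp add: vertex_at_def piece_end_alt)
    moreover have "same_point n V sig (piece_end d (L ! k)) (fst (L ! Suc k), fst (snd (L ! Suc k)))"
      using g Suc.prems by (simp add: geodesic_segment_def)
    moreover have "0 < \<tau> + piece_offset L k + ?l" using \<tau> kl piece_offset_mono[OF g, of 0 k] by simp
    ultimately show ?case using at_time_same_point[OF v _ a] piece_offset_Suc[OF kl(1)] by (simp add: add.assoc)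
  qed
  show ?thesis using mv[OF st[OF k] k s] .
qed

section \<open>Uniform bounds and the frequency of visits\<close>

lemma plen_bounded:
  obtains C where "0 < C" "\<And>x. valid x \<Longrightarrow> plen x \<le> C"
proof -
  have "bounded (face_region (V i))" if "i < n" for i
  proof -
    interpret p: dir_polygon "V i" d by (rule dpolygon[OF that])
    show ?thesis by (rule p.bounded_F)
  qed
  then have "bounded (\<Union>i<n. face_region (V i))" by auto
  then obtain M where M: "\<And>z. z \<in> (\<Union>i<n. face_region (V i)) \<Longrightarrow> norm z \<le> M" by (auto simp: bounded_iff)
  have "plen x \<le> 2 * \<bar>M\<bar> + 1" if v: "valid x" for x
  proof -
    have "pstart x \<in> face_region (V (face x))" "pstart x + of_real (plen x) * d \<in> face_region (V (face x))"
      using piece_props(3)[OF v] by auto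
    then have "norm (pstart x) \<le> M" "norm (pstart x + of_real (plen x) * d) \<le> M" using M piece_props(1)[OF v] by auto
    moreover have "plen x = norm (of_real (plen x) * d)" using piece_props(2)[OF v] d1 by (simp add: norm_mult)
    moreover have "norm (of_real (plen x) * d) \<le> norm (pstart x + of_real (plen x) * d) + norm (pstart x)"
      using norm_triangle_ineq4[of "pstart x + of_real (plen x) * d" "pstart x"] by simp
    ultimately show ?thesis by linarith
  qed
  then show ?thesis using that[of "2 * \<bar>M\<bar> + 1"] by auto
qed

text \<open>Interior points are dense in a face, so \<open>G\<close> contains a box inside a face.
  Only heights just above that of \<open>z\<close> are taken: they are generic, so that all chords
  through the box join the same two edges.\<close>

lemma flow_box:
  assumes G: "surf_open n V sig G" "G \<noteq> {}"
  obtains e a b x1 \<eta> where "e \<in> E" "lo e \<le> a" "a < b" "b \<le> hi e" "0 < \<eta>"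
    "\<And>u s w. a < u \<Longrightarrow> u < b \<Longrightarrow> side s \<Longrightarrow> x1 < w \<Longrightarrow> w < x1 + \<eta> \<Longrightarrow>
       f e u < w \<and> w < f (fst e, jx e u s) u \<and> (fst e, pnt d w u) \<in> G"
proof -
  obtain i p where ip: "(i, p) \<in> G" using G(2) by (metis ex_in_conv prod.collapse)
  have i: "i < n" and pF: "p \<in> face_region (V i)" using G(1) ip by (auto simp: surf_open_def surf_points_def)
  interpret q: dir_polygon "V i" d by (rule dpolygon[OF i])
  have "openin (top_of_set q.F) {p. (i, p) \<in> G}" using G(1) i by (simp add: surf_open_def)
  then obtain U where U: "open U" "{p. (i, p) \<in> G} = q.F \<inter> U" by (auto simp: openin_open)
  have "p \<in> closure q.R" "p \<in> U" using q.F_closure pF ip U(2) by auto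
  then obtain z where z: "z \<in> q.R" "z \<in> U"
    using open_Int_closure_eq_empty[OF U(1), of q.R] by blast
  let ?x = "xco d z" and ?t = "hgt d z"
  have zz: "pnt d ?x ?t = z" by (simp add: pnt_coords)
  have "open (q.R \<inter> U)" using q.jordan U(1) by auto
  then obtain e0 where e0: "e0 > 0" "ball z e0 \<subseteq> q.R \<inter> U" using z open_contains_ball by blast
  define e where "e = e0 / 2"
  have e: "e > 0" using e0 by (simp add: e_def)
  have box: "pnt d x' t' \<in> q.R \<inter> U" if "\<bar>x' - ?x\<bar> < e" "\<bar>t' - ?t\<bar> < e" for x' t'
  proof -
    have "dist z (pnt d x' t') < e0" using dist_pnt[of ?x ?t x' t'] that unfolding zz e_def by linarith
    then show ?thesis using e0(2) by auto
  qed
  have inG: "(i, z') \<in> G" if "z' \<in> q.R \<inter> U" for z' using that U(2) by (auto simp: q.F_eq)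
  obtain k j where kj: "q.thru ?x ?t 1 k j" "q.entering k" "\<not> q.entering j"
    using q.thru_exists[OF side_1, of ?x ?t] z zz by auto
  obtain h0 where h0: "h0 > 0" "\<And>h. 0 < h \<Longrightarrow> h < h0 \<Longrightarrow> ?t + 1 * h \<notin> q.vh \<and> q.nxt k (?t + 1 * h) j \<and> q.f k (?t + 1 * h) < ?x \<and> ?x < q.f j (?t + 1 * h)"
    using eventually_conj[OF q.ev_generic[OF side_1, of ?t] kj(1)[unfolded q.thru_def]] unfolding q.ev_iff by blast
  define b where "b = ?t + min (h0 / 2) e"
  have b: "?t < b" "b < ?t + h0" "b \<le> ?t + e" using h0 e by (auto simp: b_def)
  have st: "u \<notin> q.vh" "q.nxt k u j" "q.f k u < ?x" "?x < q.f j u" if "?t < u" "u < ?t + h0" for u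
    using h0(2)[of "u - ?t"] that by auto
  have gE: "gnE i k ?t 1 j" using q.thru_gn[OF kj(1)] by (simp add: gnE_def)
  have v: "valid ((i, k), ?t, 1)" using gn_valid(1)[OF i side_1 gE] kj by (simp add: entering_def)
  have nb: "q.nxt k b j" using st[of b] b by simp
  show ?thesis
  proof (rule that[of "(i, k)" ?t b e ?x])
    show "(i, k) \<in> E" "lo (i, k) \<le> ?t" using v by (auto simp: valid_iff)
    show "?t < b" "0 < e" using b e by auto
    show "b \<le> hi (i, k)" using nb by (auto simp: q.nxt_def q.spn_def hi_def)
    fix u s w assume u: "?t < u" "u < b" and s: "side s" and w: "?x < w" "w < ?x + e"
    have uh: "?t < u" "u < ?t + h0" using u b by auto
    have "q.gn k u s j" using q.strip_gn(3)[OF st(1) uh st(2)[OF uh] uh s] .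
    then have jx: "jx (i, k) u s = j" using jx_eq[of "(i, k)" u s j] i by (simp add: gnE_def)
    have inR: "pnt d y u \<in> q.R \<inter> U" if "?x \<le> y" "y \<le> w" for y using box[of y u] that u b w by auto
    have "w < q.f j u"
    proof (rule ccontr)
      assume "\<not> w < q.f j u"
      then have "pnt d (q.f j u) u \<in> q.R" using inR[of "q.f j u"] st(4)[OF uh] by auto
      moreover have "pnt d (q.f j u) u \<in> q.bdry"
        using q.bdry_generic[OF st(1)[OF uh]] st(2)[OF uh] by (auto simp: q.nxt_def)
      ultimately show False using inside_no_overlap by blast
    qed
    then show "f (i, k) u < w \<and> w < f (fst (i, k), jx (i, k) u s) u \<and> (fst (i, k), pnt d w u) \<in> G"
      using st(3)[OF uh] w inG[OF inR[of w]] jx by (simp add: f_def)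
  qed
qed

lemma open_sections_borel:
  assumes G: "surf_open n V sig G" shows "{p. (i, p) \<in> G} \<in> sets borel"
proof (cases "i < n")
  case True
  interpret p: dir_polygon "V i" d by (rule dpolygon[OF True])
  have "openin (top_of_set p.F) {p. (i, p) \<in> G}" using G True by (simp add: surf_open_def)
  then obtain U where "open U" "{p. (i, p) \<in> G} = p.F \<inter> U" by (auto simp: openin_open)
  then show ?thesis using p.closed_F by auto
next
  case False
  then have "{p. (i, p) \<in> G} = {}" using G by (auto simp: surf_open_def surf_points_def)
  then show ?thesis by simp
qed

text \<open>At times in \<open>W\<close> the orbit is in \<open>G\<close> whichever representative
  of its position is taken. As \<open>L\<close> runs along the orbit, each piece of \<open>L\<close>
  receives its share of \<open>W\<close> by a translation of the parameter.\<close>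

lemma visit_lower_bound:
  assumes v: "valid x" and \<tau>: "0 < \<tau>" and g: "geodesic_segment n V sig d L"
    and nv: "\<And>k s. \<not> vertex_at n V d L k s"
    and at0: "at_time x \<tau> (fst (L ! 0), fst (snd (L ! 0)))"
    and G: "\<And>i. {p. (i, p) \<in> G} \<in> sets borel"
    and W: "W \<in> sets borel" "\<And>\<sigma> y. \<sigma> \<in> W \<Longrightarrow> at_time x \<sigma> y \<Longrightarrow> y \<in> G"
  shows "measure lborel (W \<inter> {\<tau>..\<tau> + seg_length L}) \<le> visit_measure d G L"
proof -
  have fm: "W \<inter> {a..b} \<in> fmeasurable lborel" for a b
    unfolding Int_commute[of W]
    by (rule fmeasurable_Int_fmeasurable) (use W in \<open>auto simp: fmeasurable_def emeasure_lborel_Icc_eq\<close>)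
  have main: "measure lborel (W \<inter> {\<tau>..\<tau> + piece_offset L m}) \<le> visit_measure d G (take m L)" if "m \<le> length L" for m
    using that
  proof (induction m)
    case 0
    have "W \<inter> {\<tau>..\<tau> + piece_offset L 0} \<subseteq> {\<tau>}" by auto
    then have "measure lborel (W \<inter> {\<tau>..\<tau> + piece_offset L 0}) \<le> measure lborel {\<tau>}"
      by (intro measure_mono_fmeasurable) (use W in \<open>auto simp: fmeasurable_def\<close>)
    then show ?case by simp
  next
    case (Suc m)
    let ?i = "fst (L ! m)" and ?z = "fst (snd (L ! m))" and ?l = "snd (snd (L ! m))"
    let ?\<sigma> = "\<tau> + piece_offset L m"
    have m: "m < length L" using Suc by simp
    have l: "0 \<le> ?l" using geodesic_piece(2)[OF g m] .
    have sub: "(+) (- ?\<sigma>) ` (W \<inter> {?\<sigma>..?\<sigma> + ?l}) \<subseteq> {s. 0 \<le> s \<and> s \<le> ?l \<and> (?i, ?z + complex_of_real s * d) \<in> G}"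
    proof (rule image_subsetI)
      fix \<sigma> assume s: "\<sigma> \<in> W \<inter> {?\<sigma>..?\<sigma> + ?l}"
      define r where "r = - ?\<sigma> + \<sigma>"
      have r: "0 \<le> r" "r \<le> ?l" "?\<sigma> + r = \<sigma>" using s by (auto simp: r_def)
      have "at_time x (?\<sigma> + r) (?i, ?z + of_real r * d)"
        by (rule geodesic_follows[OF v \<tau> g nv at0 m r(1,2)])
      then have "(?i, ?z + of_real r * d) \<in> G" using W(2) s r(3) by auto
      then show "- ?\<sigma> + \<sigma> \<in> {s. 0 \<le> s \<and> s \<le> ?l \<and> (?i, ?z + complex_of_real s * d) \<in> G}"
        using r(1,2) unfolding r_def by blast
    qed
    have "measure lborel (W \<inter> {?\<sigma>..?\<sigma> + ?l}) = measure lebesgue (W \<inter> {?\<sigma>..?\<sigma> + ?l})"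
      by (rule measure_completion[symmetric]) (use W in auto)
    also have "\<dots> = measure lebesgue ((+) (- ?\<sigma>) ` (W \<inter> {?\<sigma>..?\<sigma> + ?l}))" by (simp only: measure_translation)
    also have "\<dots> \<le> measure lebesgue {s. 0 \<le> s \<and> s \<le> ?l \<and> (?i, ?z + complex_of_real s * d) \<in> G}"
    proof (rule measure_mono_fmeasurable[OF sub])
      have "W \<inter> {?\<sigma>..?\<sigma> + ?l} \<in> sets lebesgue" using W by auto
      then show "(+) (- ?\<sigma>) ` (W \<inter> {?\<sigma>..?\<sigma> + ?l}) \<in> sets lebesgue" by (rule lebesgue_sets_translation)
      show "{s. 0 \<le> s \<and> s \<le> ?l \<and> (?i, ?z + complex_of_real s * d) \<in> G} \<in> fmeasurable lebesgue"
      proof (rule bounded_set_imp_lmeasurable)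
        show "bounded {s. 0 \<le> s \<and> s \<le> ?l \<and> (?i, ?z + complex_of_real s * d) \<in> G}"
          by (rule bounded_subset[of "{0..?l}"]) auto
        show "{s. 0 \<le> s \<and> s \<le> ?l \<and> (?i, ?z + complex_of_real s * d) \<in> G} \<in> sets lebesgue"
          using visit_set_measurable(1)[OF G, of 0 ?l ?i ?z d] by simp
      qed
    qed
    also have "\<dots> = measure lborel {s. 0 \<le> s \<and> s \<le> ?l \<and> (?i, ?z + complex_of_real s * d) \<in> G}"
      by (rule measure_completion) (use visit_set_measurable(1)[OF G, of 0 ?l ?i ?z d] in simp)
    finally have piece: "measure lborel (W \<inter> {?\<sigma>..?\<sigma> + ?l}) \<le> measure lborel {s. 0 \<le> s \<and> s \<le> ?l \<and> (?i, ?z + complex_of_real s * d) \<in> G}" .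
    have "W \<inter> {\<tau>..\<tau> + piece_offset L (Suc m)} \<subseteq> (W \<inter> {\<tau>..?\<sigma>}) \<union> (W \<inter> {?\<sigma>..?\<sigma> + ?l})"
      using piece_offset_Suc[OF m] by auto
    then have "measure lborel (W \<inter> {\<tau>..\<tau> + piece_offset L (Suc m)}) \<le> measure lborel ((W \<inter> {\<tau>..?\<sigma>}) \<union> (W \<inter> {?\<sigma>..?\<sigma> + ?l}))"
      by (rule measure_mono_fmeasurable) (use fm W in \<open>auto intro: fmeasurable.Un\<close>)
    also have "\<dots> \<le> measure lborel (W \<inter> {\<tau>..?\<sigma>}) + measure lborel (W \<inter> {?\<sigma>..?\<sigma> + ?l})"
      by (rule measure_Un_le) (use W in auto)
    also have "\<dots> \<le> visit_measure d G (take (Suc m) L)"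
      using Suc piece m by (simp add: take_Suc_conv_app_nth)
    finally show ?case .
  qed
  from main[of "length L"] show ?thesis by (simp add: piece_offset_length)
qed

theorem visiting_frequency:
  assumes G: "surf_open n V sig G" "G \<noteq> {}"
  shows "\<exists>F c. F > 0 \<and> c > 0 \<and> (\<forall>L. geodesic_segment n V sig d L \<and> seg_length L \<ge> c \<longrightarrow> visit_measure d G L \<ge> F * seg_length L)"
proof -
  obtain e a b x1 \<eta> where box: "e \<in> E" "lo e \<le> a" "a < b" "b \<le> hi e" "0 < \<eta>"
    "\<And>u s w. a < u \<Longrightarrow> u < b \<Longrightarrow> side s \<Longrightarrow> x1 < w \<Longrightarrow> w < x1 + \<eta> \<Longrightarrow>
       f e u < w \<and> w < f (fst e, jx e u s) u \<and> (fst e, pnt d w u) \<in> G"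
    by (rule flow_box[OF G], rule that)
  obtain N where N: "\<And>x. valid x \<Longrightarrow> \<exists>k<N. \<exists>w s. (F.T ^^ k) x = (e, w, s) \<and> a < w \<and> w < b"
    using uniform_hitting[OF box(1-4)] by blast
  obtain C where C: "0 < C" "\<And>x. valid x \<Longrightarrow> plen x \<le> C" by (rule plen_bounded, rule that)
  \<comment> \<open>Every time window of length \<open>Q\<close> contains a full passage through the
    box: it covers the rest of the current piece, fewer than \<open>N\<close> pieces until the
    interval from \<open>a\<close> to \<open>b\<close> is hit, and the piece that crosses the
    box.\<close>
  define Q where "Q = (real N + 2) * C"
  have Q: "0 < Q" using C by (simp add: Q_def)
  have Gb: "\<And>i. {p. (i, p) \<in> G} \<in> sets borel" using open_sections_borel[OF G(1)] .
  have main: "\<eta> / (2 * Q) * seg_length L \<le> visit_measure d G L"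
    if g: "geodesic_segment n V sig d L" and nv: "\<And>k s. \<not> vertex_at n V d L k s" and len: "Q \<le> seg_length L" for L
  proof -
    have L0: "0 < length L" using g by (simp add: geodesic_segment_def)
    have "\<not> is_vertex n V (fst (L ! 0), fst (snd (L ! 0)))"
      using nv[of 0 0] L0 geodesic_piece(2)[OF g L0] by (simp add: vertex_at_def)
    moreover have "fst (snd (L ! 0)) \<in> face_region (V (fst (L ! 0)))" using geodesic_piece(3)[OF g L0] by auto
    ultimately obtain x \<tau> where x: "valid x" "0 < \<tau>" "at_time x \<tau> (fst (L ! 0), fst (snd (L ! 0)))"
      using at_time_start[OF geodesic_piece(1)[OF g L0]] by metis
    \<comment> \<open>The times at which the orbit is in the box during its \<open>k\<close>-th
      piece.\<close>
    define J where "J k = (case (F.T ^^ k) x of (e', u, s) \<Rightarrow>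
        if e' = e \<and> a < u \<and> u < b then {lam x k + (x1 - f e u)<..<lam x k + (x1 - f e u) + \<eta>} else {})" for k
    define W where "W = (\<Union>k. J k)"
    have Jo: "open (J k)" for k by (auto simp: J_def split: prod.splits)
    then have "open W" by (auto simp: W_def)
    then have Wb: "W \<in> sets borel" by simp
    have JJ: "lam x k < \<sigma> \<and> \<sigma> < lam x (Suc k) \<and> (face ((F.T ^^ k) x), pstart ((F.T ^^ k) x) + of_real (\<sigma> - lam x k) * d) \<in> G"
      if j: "\<sigma> \<in> J k" for \<sigma> k
    proof -
      obtain e' u s where xk: "(F.T ^^ k) x = (e', u, s)" by (cases "(F.T ^^ k) x")
      have 1: "e' = e" "a < u" "u < b" "x1 < f e u + (\<sigma> - lam x k)" "f e u + (\<sigma> - lam x k) < x1 + \<eta>"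
        using j xk by (auto simp: J_def split: if_splits)
      have "side s" using valid_side F.iter_valid[OF x(1), of k] xk by simp
      from box(6)[OF 1(2,3) this 1(4,5)]
      show ?thesis using xk 1(1) by (auto simp: lam_Suc plen_def face_def pstart_def pnt_add_d simp del: of_real_diff)
    qed
    \<comment> \<open>Times in \<open>J k\<close> are strictly inside the \<open>k\<close>-th piece,
      so no other piece can be responsible for the position \<open>y\<close>.\<close>
    have WG: "y \<in> G" if s: "\<sigma> \<in> W" and at: "at_time x \<sigma> y" for \<sigma> y
    proof -
      obtain k where k: "\<sigma> \<in> J k" using s by (auto simp: W_def)
      obtain k' where k': "lam x k' \<le> \<sigma>" "\<sigma> \<le> lam x (Suc k')"
        "y = (face ((F.T ^^ k') x), pstart ((F.T ^^ k') x) + of_real (\<sigma> - lam x k') * d)"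
        using at unfolding at_time_def by blast
      have "\<not> k' < k" using lam_mono[OF x(1), of "Suc k'" k] k'(2) JJ[OF k] by auto
      moreover have "\<not> k < k'" using lam_mono[OF x(1), of "Suc k" k'] k'(1) JJ[OF k] by auto
      ultimately show ?thesis using k'(3) JJ[OF k] by simp
    qed
    have fm: "W \<inter> {a..b} \<in> fmeasurable lborel" for a b
      unfolding Int_commute[of W]
      by (rule fmeasurable_Int_fmeasurable) (use Wb in \<open>auto simp: fmeasurable_def emeasure_lborel_Icc_eq\<close>)
    \<comment> \<open>That the orbit lasts up to time \<open>\<sigma>\<close>, although its pieces
      may be arbitrarily short, is inferred from the geodesic, which runs along it.\<close>
    have find: "\<exists>y. at_time x \<sigma> y" if s: "\<tau> \<le> \<sigma>" "\<sigma> \<le> \<tau> + seg_length L" for \<sigma>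
    proof -
      obtain k where k: "k < length L" "piece_offset L k \<le> \<sigma> - \<tau>" "\<sigma> - \<tau> \<le> piece_offset L (Suc k)"
        using geodesic_piece_at[OF g, of "\<sigma> - \<tau>"] s by auto
      have "at_time x (\<tau> + piece_offset L k + (\<sigma> - \<tau> - piece_offset L k)) (fst (L ! k), fst (snd (L ! k)) + of_real (\<sigma> - \<tau> - piece_offset L k) * d)"
        by (rule geodesic_follows[OF x(1,2) g nv x(3) k(1)]) (use k piece_offset_Suc[OF k(1)] in auto)
      then show ?thesis by auto
    qed
    have hit: "\<exists>c. {c<..<c + \<eta>} \<subseteq> W \<and> \<sigma> \<le> c \<and> c + \<eta> \<le> \<sigma> + Q" if s: "\<tau> \<le> \<sigma>" "\<sigma> \<le> \<tau> + seg_length L" for \<sigma>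
    proof -
      obtain k where k: "lam x k \<le> \<sigma>" "\<sigma> \<le> lam x (Suc k)" using find[OF s] unfolding at_time_def by blast
      obtain m w s where m: "m < N" "(F.T ^^ m) ((F.T ^^ Suc k) x) = (e, w, s)" "a < w" "w < b"
        using N[OF F.iter_valid[OF x(1), of "Suc k"]] by blast
      define k' where "k' = m + Suc k"
      have xk': "(F.T ^^ k') x = (e, w, s)" unfolding k'_def funpow_add using m(2) by simp
      define c where "c = lam x k' + (x1 - f e w)"
      have Jk: "J k' = {c<..<c + \<eta>}" using xk' m by (simp add: J_def c_def)
      have grow: "lam x (k0 + i) \<le> lam x k0 + real i * C" for k0 i
      proof (induction i)
        case (Suc i)
        then show ?case using C(2)[OF F.iter_valid[OF x(1), of "k0 + i"]] by (simp add: lam_Suc algebra_simps)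
      qed simp
      have "lam x (Suc k') \<le> lam x k + real (Suc (Suc m)) * C"
        using grow[of k "Suc (Suc m)"] by (simp add: k'_def add.commute add.left_commute)
      also have "real (Suc (Suc m)) * C \<le> Q" unfolding Q_def using m(1) C(1) by (intro mult_right_mono) auto
      finally have up: "lam x (Suc k') \<le> \<sigma> + Q" using k(1) by simp
      have low: "\<sigma> \<le> lam x k'" using k(2) lam_mono[OF x(1), of "Suc k" k'] by (simp add: k'_def)
      have "lam x k' \<le> c"
      proof (rule ccontr)
        assume "\<not> ?thesis"
        then have "c + min (\<eta> / 2) (lam x k' - c) \<in> J k'" using box(5) unfolding Jk by auto
        from JJ[OF this] show False by linarith
      qed
      moreover have "c + \<eta> \<le> lam x (Suc k')"
      proof (rule ccontr)
        assume "\<not> ?thesis"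
        then have "c + \<eta> - min (\<eta> / 2) (c + \<eta> - lam x (Suc k')) \<in> J k'" using box(5) unfolding Jk by auto
        from JJ[OF this] show False by linarith
      qed
      moreover have "{c<..<c + \<eta>} \<subseteq> W" using Jk by (auto simp: W_def)
      ultimately show ?thesis using up low by (intro exI[of _ c]) auto
    qed
    have count: "real p * \<eta> \<le> measure lborel (W \<inter> {\<tau>..\<tau> + real p * Q})" if "real p * Q \<le> seg_length L" for p
      using that
    proof (induction p)
      case (Suc p)
      have pQ: "real p * Q \<le> seg_length L" "0 \<le> real p * Q" using Suc.prems Q by (auto simp: algebra_simps)
      let ?\<sigma> = "\<tau> + real p * Q"
      obtain c where c: "{c<..<c + \<eta>} \<subseteq> W" "?\<sigma> \<le> c" "c + \<eta> \<le> ?\<sigma> + Q" using hit[of ?\<sigma>] pQ by auto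
      have "real (Suc p) * \<eta> \<le> measure lborel (W \<inter> {\<tau>..?\<sigma>}) + measure lborel {c<..<c + \<eta>}"
        using Suc.IH[OF pQ(1)] box(5) by (simp add: algebra_simps)
      also have "\<dots> = measure lborel ((W \<inter> {\<tau>..?\<sigma>}) \<union> {c<..<c + \<eta>})"
      proof (rule measure_Union[symmetric])
        show "emeasure lborel (W \<inter> {\<tau>..?\<sigma>}) \<noteq> \<infinity>" using fm[of \<tau> ?\<sigma>] by (simp add: fmeasurable_def less_top)
        show "emeasure lborel {c<..<c + \<eta>} \<noteq> \<infinity>" using box(5) by simp
      qed (use Wb c in auto)
      also have "\<dots> \<le> measure lborel (W \<inter> {\<tau>..\<tau> + real (Suc p) * Q})"
      proof (rule measure_mono_fmeasurable)
        show "W \<inter> {\<tau>..?\<sigma>} \<union> {c<..<c + \<eta>} \<subseteq> W \<inter> {\<tau>..\<tau> + real (Suc p) * Q}"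
        proof -
          have eq: "\<tau> + real (Suc p) * Q = ?\<sigma> + Q" by (simp add: algebra_simps)
          have "\<tau> \<le> c" using c(2) pQ(2) by linarith
          then show ?thesis unfolding eq using c Q by auto
        qed
      qed (use fm Wb in auto)
      finally show ?case .
    qed simp
    \<comment> \<open>As \<open>seg_length L\<close> is at least \<open>Q\<close>, rounding the
      number of windows down loses at most a factor 2.\<close>
    define p where "p = nat \<lfloor>seg_length L / Q\<rfloor>"
    have r: "1 \<le> seg_length L / Q" using len Q by simp
    then have p: "real p \<le> seg_length L / Q" "seg_length L / Q < real p + 1" "1 \<le> real p"
    proof -
      have f1: "1 \<le> \<lfloor>seg_length L / Q\<rfloor>" using r by (simp add: le_floor_iff)
      then have "real p = real_of_int \<lfloor>seg_length L / Q\<rfloor>" by (simp add: p_def)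
      then show "real p \<le> seg_length L / Q" "seg_length L / Q < real p + 1" "1 \<le> real p"
        using f1 by linarith+
    qed
    have pl: "real p * Q \<le> seg_length L" using p(1) Q by (simp add: field_simps)
    have "seg_length L / Q \<le> 2 * real p" using p by linarith
    then have "\<eta> * (seg_length L / Q) \<le> \<eta> * (2 * real p)" using box(5) by (intro mult_left_mono) auto
    then have "\<eta> / (2 * Q) * seg_length L \<le> real p * \<eta>" by (simp add: field_simps)
    also have "\<dots> \<le> measure lborel (W \<inter> {\<tau>..\<tau> + real p * Q})" by (rule count[OF pl])
    also have "\<dots> \<le> measure lborel (W \<inter> {\<tau>..\<tau> + seg_length L})"
      by (rule measure_mono_fmeasurable) (use fm Wb pl in auto)
    also have "\<dots> \<le> visit_measure d G L" by (rule visit_lower_bound[OF x(1,2) g nv x(3) Gb Wb WG])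
    finally show ?thesis .
  qed
  \<comment> \<open>The part without vertices has at least a third of the length. This gives the
    threshold \<open>3 * Q\<close> and, with the factor 2 from rounding, the constant
    \<open>\<eta> / (6 * Q)\<close>.\<close>
  show ?thesis
  proof (rule exI[of _ "\<eta> / (6 * Q)"], rule exI[of _ "3 * Q"], intro conjI allI impI)
    show "0 < \<eta> / (6 * Q)" "0 < 3 * Q" using box(5) Q by auto
    fix L assume L: "geodesic_segment n V sig d L \<and> 3 * Q \<le> seg_length L"
    then have g: "geodesic_segment n V sig d L" and l: "0 < seg_length L" using Q by auto
    obtain L' where L': "geodesic_segment n V sig d L'" "seg_length L / 3 \<le> seg_length L'"
      "visit_measure d G L' \<le> visit_measure d G L" "\<And>k s. \<not> vertex_at n V d L' k s"
      using vertex_free_part[OF g d_nz Gb no_saddle l] by blast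
    have "\<eta> / (6 * Q) * seg_length L = \<eta> / (2 * Q) * (seg_length L / 3)" by simp
    also have "\<dots> \<le> \<eta> / (2 * Q) * seg_length L'" using L'(2) box(5) Q by (intro mult_left_mono) auto
    also have "\<dots> \<le> visit_measure d G L'" using main[OF L'(1,4)] L'(2) L by simp
    finally show "\<eta> / (6 * Q) * seg_length L \<le> visit_measure d G L" using L'(3) by simp
  qed
qed

end

theorem theorem3:
  fixes n :: nat and V :: "nat \<Rightarrow> complex list" and sig :: "nat \<times> nat \<Rightarrow> nat \<times> nat"
    and \<alpha> :: real
  assumes "translation_surface n V sig"
    and "\<not> saddle_slope n V sig \<alpha>"
  shows "\<forall>G. surf_open n V sig G \<and> G \<noteq> {} \<longrightarrow>
           (\<exists>F c5. F > 0 \<and> c5 > 0 \<and>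
              (\<forall>d L. slope_dir \<alpha> d \<and> geodesic_segment n V sig d L \<and> seg_length L \<ge> c5
                 \<longrightarrow> visit_measure d G L \<ge> F * seg_length L))"
proof (intro allI impI)
  fix G assume G: "surf_open n V sig G \<and> G \<noteq> {}"
  define d0 where "d0 = Complex 1 \<alpha> / complex_of_real (cmod (Complex 1 \<alpha>))"
  have "Complex 1 \<alpha> \<noteq> 0" by (simp add: complex_eq_iff)
  then have d0: "cmod d0 = 1" by (simp add: d0_def norm_divide)
  have dir: "slope_dir \<alpha> d \<longleftrightarrow> d = d0 \<or> d = - d0" for d by (simp add: slope_dir_def d0_def)
  \<comment> \<open>A slope does not fix an orientation, so both unit vectors are treated and the
    worse of the two constants is taken.\<close>
  have ex: "\<exists>F c. F > 0 \<and> c > 0 \<and> (\<forall>L. geodesic_segment n V sig d L \<and> seg_length L \<ge> c \<longrightarrow> visit_measure d G L \<ge> F * seg_length L)"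
    if "slope_dir \<alpha> d" for d
  proof -
    interpret flow_surface d n V sig
      by unfold_locales (use assms that d0 dir in \<open>auto simp: saddle_slope_def\<close>)
    show ?thesis using visiting_frequency G by blast
  qed
  obtain F1 c1 where F1: "F1 > 0" "c1 > 0" "\<And>L. geodesic_segment n V sig d0 L \<Longrightarrow> seg_length L \<ge> c1 \<Longrightarrow> visit_measure d0 G L \<ge> F1 * seg_length L"
    using ex[of d0] dir by blast
  obtain F2 c2 where F2: "F2 > 0" "c2 > 0" "\<And>L. geodesic_segment n V sig (- d0) L \<Longrightarrow> seg_length L \<ge> c2 \<Longrightarrow> visit_measure (- d0) G L \<ge> F2 * seg_length L"
    using ex[of "- d0"] dir by blast
  show "\<exists>F c5. F > 0 \<and> c5 > 0 \<and> (\<forall>d L. slope_dir \<alpha> d \<and> geodesic_segment n V sig d L \<and> seg_length L \<ge> c5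
                 \<longrightarrow> visit_measure d G L \<ge> F * seg_length L)"
  proof (rule exI[of _ "min F1 F2"], rule exI[of _ "max c1 c2"], intro conjI allI impI)
    show "0 < min F1 F2" "0 < max c1 c2" using F1(1,2) F2(1,2) by auto
    fix d L assume a: "slope_dir \<alpha> d \<and> geodesic_segment n V sig d L \<and> max c1 c2 \<le> seg_length L"
    then have "0 \<le> seg_length L" using F1(2) by auto
    then have m: "min F1 F2 * seg_length L \<le> F1 * seg_length L" "min F1 F2 * seg_length L \<le> F2 * seg_length L"
      by (auto intro: mult_right_mono)
    from a dir consider "d = d0" | "d = - d0" by blast
    then show "min F1 F2 * seg_length L \<le> visit_measure d G L"
    proof cases
      case 1
      then show ?thesis using F1(3)[of L] a m by auto
    next
      case 2
      then show ?thesis using F2(3)[of L] a m by auto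
    qed
  qed
qed

end
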